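(* Division gradings, by abelian groups, on the real algebra $M_{n/2}(\mathbb{H})$ ($n$ an even positive integer), whose (nonzero) homogeneous components have dimension $1$, exist if and only if $n=2^m\geq 2$ for some integer $m$. They are determined up to isomorphism by the signs of the squares of the homogeneous elements: for such a grading with support $T\cong\mathbb{Z}_2^{2m}$, the map $\mu:T\to\{\pm1\}$ such that $X^2$ is a positive real multiple of $\mu(t)I$ for every nonzero homogeneous $X$ of degree $t$ is well defined. Assigning $\mu$ to the grading yields a bijective correspondence between the isomorphism classes of such gradings (with support $T\cong\mathbb{Z}_2^{2m}$) and the quadratic forms on $\mathbb{Z}_2^{2m}$ with polarization of type I and Arf invariant $-1$. All these gradings (for given $n=2^m$) belong to the same equivalence class, represented by the graded tensor product $M_{n/2}(\mathbb{H})\cong M_2(\mathbb{R})\otimes\dots\otimes M_2(\mathbb{R})\otimes\mathbb{H}$ with $m-1$ factors $M_2(\mathbb{R})$, graded as in the context.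
   Context: A grading on an algebra $\mathcal{D}$ by a group $G$ is a vector space decomposition $\mathcal{D}=\bigoplus_{g\in G}\mathcal{D}_g$ with $\mathcal{D}_g\mathcal{D}_h\subseteq\mathcal{D}_{gh}$ for all $g,h$. The support is the set of $g$ with $\mathcal{D}_g\neq0$. A grading on a unital associative algebra is a division grading if every nonzero homogeneous element is invertible. Two $G$-graded algebras $\mathcal{D},\mathcal{E}$ are isomorphic if there is an algebra isomorphism $\psi$ with $\psi(\mathcal{D}_g)=\mathcal{E}_g$ for all $g\in G$. A $G$-graded $\mathcal{D}$ and an $H$-graded $\mathcal{E}$ are equivalent if there is an algebra isomorphism $\psi:\mathcal{D}\to\mathcal{E}$ such that for every $g$ in the support of $\mathcal{D}$ there is $h\in H$ with $\psi(\mathcal{D}_g)=\mathcal{E}_h$. In the bijection, the gradings are regarded as gradings by their support $T$, a fixed group isomorphic to $\mathbb{Z}_2^{2m}$. An alternating bicharacter on a group $T$ is a map $\beta:T\times T\to\mathbb{R}\setminus\{0\}$ multiplicative in each variable with $\beta(u,u)=1$ for all $u$. Its radical is $\{t\in T\mid\beta(u,t)=1\ \forall u\in T\}$, and $\beta$ is of type I if its radical is $\{e\}$. A quadratic form on $T$ is a map $\mu:T\to\{\pm1\}$ such that its polarization $\beta_\mu(u,v)=\mu(uv)\mu(u)^{-1}\mu(v)^{-1}$ is an alternating bicharacter. The Arf invariant of a map $\mu:T\to\{\pm1\}$ on a finite set is $+1$, $-1$ or $0$ according to whether $\mu$ takes the value $+1$ more often than, less often than, or as often as the value $-1$. The graded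 tensor product of a $G$-graded $\mathcal{D}$ and an $H$-graded $\mathcal{E}$ is $\mathcal{D}\otimes_{\mathbb{R}}\mathcal{E}$, graded by $G\times H$ with component of degree $(g,h)$ equal to $\mathcal{D}_g\otimes\mathcal{E}_h$. Here $M_2(\mathbb{R})$ is graded by $\mathbb{Z}_2^2=\langle a,b\mid a^2=e=b^2,ab=ba\rangle$ with components of degrees $e,a,b,ab$ spanned by $\begin{pmatrix}1&0\\0&1\end{pmatrix},\begin{pmatrix}-1&0\\0&1\end{pmatrix},\begin{pmatrix}0&1\\1&0\end{pmatrix},\begin{pmatrix}0&-1\\1&0\end{pmatrix}$, and $\mathbb{H}$ is graded by $\mathbb{Z}_2^2$ with components of degrees $e,a,b,ab$ spanned by $1,i,j,k$. *)

theory Defs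
  imports
    "HOL-Algebra.Product_Groups"
    "HOL-Algebra.Elementary_Groups"
    "HOL-Algebra.QuotRing"
    "HOL-Library.Poly_Mapping"
    "Jordan_Normal_Form.VS_Connect"
begin

hide_const (open) Modules.module
hide_const (open) Polynomial.smult
hide_const (open) Multiset.mult

section \<open>Real algebras\<close>

text \<open>A real algebra is a record of type \<open>(real, 'a) module\<close>; the field of scalars is
  \<open>class_ring :: real ring\<close>. (The locale \<open>algebra\<close> of HOL-Algebra is for commutative
  algebras only.)\<close>

definition real_algebra :: "(real, 'a) module \<Rightarrow> bool" where
  "real_algebra A \<longleftrightarrow>
     ring A \<and> vectorspace (class_ring :: real ring) A \<and>
     (\<forall>r. \<forall>x\<in>carrier A. \<forall>y\<in>carrier A.
        (r \<odot>\<^bsub>A\<^esub> x) \<otimes>\<^bsub>A\<^esub> y = r \<odot>\<^bsub>A\<^esub> (x \<otimes>\<^bsub>A\<^esub> y) \<and>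
        x \<otimes>\<^bsub>A\<^esub> (r \<odot>\<^bsub>A\<^esub> y) = r \<odot>\<^bsub>A\<^esub> (x \<otimes>\<^bsub>A\<^esub> y))"

definition algebra_iso :: "(real, 'a) module \<Rightarrow> (real, 'b) module \<Rightarrow> ('a \<Rightarrow> 'b) set" where
  "algebra_iso A B =
     {\<psi> \<in> ring_iso A B. \<forall>r. \<forall>x\<in>carrier A. \<psi> (r \<odot>\<^bsub>A\<^esub> x) = r \<odot>\<^bsub>B\<^esub> \<psi> x}"

definition type_algebra :: "(real, 'a::real_algebra_1) module" where
  "type_algebra =
     \<lparr>carrier = UNIV, mult = (*), one = 1, zero = 0, add = (+), smult = (*\<^sub>R)\<rparr>"

definition matrix_algebra :: "nat \<Rightarrow> (real, 'a::real_algebra_1 mat) module" where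
  "matrix_algebra k =
     \<lparr>carrier = carrier_mat k k, mult = (*), one = 1\<^sub>m k, zero = 0\<^sub>m k k, add = (+),
      smult = (\<lambda>r. map_mat ((*\<^sub>R) r))\<rparr>"

section \<open>Quaternions\<close>

datatype quat = Quat (q1: real) (qi: real) (qj: real) (qk: real)

instantiation quat :: real_algebra_1
begin

definition "0 = Quat 0 0 0 0"
definition "1 = Quat 1 0 0 0"
definition "x + y = Quat (q1 x + q1 y) (qi x + qi y) (qj x + qj y) (qk x + qk y)"
definition "x - y = Quat (q1 x - q1 y) (qi x - qi y) (qj x - qj y) (qk x - qk y)"
definition "- x = Quat (- q1 x) (- qi x) (- qj x) (- qk x)"
definition "x * y = Quat
  (q1 x * q1 y - qi x * qi y - qj x * qj y - qk x * qk y)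
  (q1 x * qi y + qi x * q1 y + qj x * qk y - qk x * qj y)
  (q1 x * qj y - qi x * qk y + qj x * q1 y + qk x * qi y)
  (q1 x * qk y + qi x * qj y - qj x * qi y + qk x * q1 y)"
definition "r *\<^sub>R x = Quat (r * q1 x) (r * qi x) (r * qj x) (r * qk x)"

instance
  by intro_classes
    (simp_all add: zero_quat_def one_quat_def plus_quat_def minus_quat_def uminus_quat_def
      times_quat_def scaleR_quat_def quat.expand algebra_simps)

end

text \<open>\<open>M\<^bsub>n/2\<^esub>(\<bbbH>)\<close> for even \<open>n\<close>\<close>

abbreviation half_quat_matrices :: "nat \<Rightarrow> (real, quat mat) module" where
  "half_quat_matrices n \<equiv> matrix_algebra (n div 2)"

section \<open>Gradings\<close>

definition graded_algebra ::
    "'g monoid \<Rightarrow> (real, 'a) module \<Rightarrow> ('g \<Rightarrow> 'a set) \<Rightarrow> bool" where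
  "graded_algebra G A \<Gamma> \<longleftrightarrow>
     group G \<and> real_algebra A \<and>
     (\<forall>g\<in>carrier G. VectorSpace.subspace class_ring (\<Gamma> g) A) \<and>
     (\<forall>x\<in>carrier A. \<exists>!c. c \<in> (\<Pi>\<^sub>E g\<in>carrier G. \<Gamma> g) \<and>
        finite {g \<in> carrier G. c g \<noteq> \<zero>\<^bsub>A\<^esub>} \<and>
        x = (\<Oplus>\<^bsub>A\<^esub>g\<in>{g \<in> carrier G. c g \<noteq> \<zero>\<^bsub>A\<^esub>}. c g)) \<and>
     (\<forall>g\<in>carrier G. \<forall>h\<in>carrier G. \<forall>x\<in>\<Gamma> g. \<forall>y\<in>\<Gamma> h. x \<otimes>\<^bsub>A\<^esub> y \<in> \<Gamma> (g \<otimes>\<^bsub>G\<^esub> h))"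

definition grading_support ::
    "'g monoid \<Rightarrow> (real, 'a) module \<Rightarrow> ('g \<Rightarrow> 'a set) \<Rightarrow> 'g set" where
  "grading_support G A \<Gamma> = {g \<in> carrier G. \<Gamma> g \<noteq> {\<zero>\<^bsub>A\<^esub>}}"

definition division_grading ::
    "'g monoid \<Rightarrow> (real, 'a) module \<Rightarrow> ('g \<Rightarrow> 'a set) \<Rightarrow> bool" where
  "division_grading G A \<Gamma> \<longleftrightarrow>
     graded_algebra G A \<Gamma> \<and> (\<forall>g\<in>carrier G. \<forall>x\<in>\<Gamma> g. x \<noteq> \<zero>\<^bsub>A\<^esub> \<longrightarrow> x \<in> Units A)"

text \<open>The conjunct \<open>fin_dim\<close> is needed because \<open>dim\<close> is unspecified in infinite dimension.\<close>

definition one_dim_components ::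
    "'g monoid \<Rightarrow> (real, 'a) module \<Rightarrow> ('g \<Rightarrow> 'a set) \<Rightarrow> bool" where
  "one_dim_components G A \<Gamma> \<longleftrightarrow>
     (\<forall>g\<in>grading_support G A \<Gamma>.
        vectorspace.fin_dim class_ring (A\<lparr>carrier := \<Gamma> g\<rparr>) \<and>
        vectorspace.dim class_ring (A\<lparr>carrier := \<Gamma> g\<rparr>) = 1)"

definition abelian_division_grading_1 ::
    "'g monoid \<Rightarrow> (real, 'a) module \<Rightarrow> ('g \<Rightarrow> 'a set) \<Rightarrow> bool" where
  "abelian_division_grading_1 G A \<Gamma> \<longleftrightarrow>
     comm_group G \<and> division_grading G A \<Gamma> \<and> one_dim_components G A \<Gamma>"

definition graded_isomorphic ::
    "'g monoid \<Rightarrow> (real, 'a) module \<Rightarrow> ('g \<Rightarrow> 'a set) \<Rightarrow>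
     (real, 'b) module \<Rightarrow> ('g \<Rightarrow> 'b set) \<Rightarrow> bool" where
  "graded_isomorphic G A \<Gamma> B \<Delta> \<longleftrightarrow>
     (\<exists>\<psi>\<in>algebra_iso A B. \<forall>g\<in>carrier G. \<psi> ` \<Gamma> g = \<Delta> g)"

definition graded_equivalent ::
    "'g monoid \<Rightarrow> (real, 'a) module \<Rightarrow> ('g \<Rightarrow> 'a set) \<Rightarrow>
     'h monoid \<Rightarrow> (real, 'b) module \<Rightarrow> ('h \<Rightarrow> 'b set) \<Rightarrow> bool" where
  "graded_equivalent G A \<Gamma> H B \<Delta> \<longleftrightarrow>
     (\<exists>\<psi>\<in>algebra_iso A B.
        \<forall>g\<in>grading_support G A \<Gamma>. \<exists>h\<in>carrier H. \<psi> ` \<Gamma> g = \<Delta> h)"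

definition square_sign ::
    "'g monoid \<Rightarrow> (real, 'a) module \<Rightarrow> ('g \<Rightarrow> 'a set) \<Rightarrow> ('g \<Rightarrow> real) \<Rightarrow> bool" where
  "square_sign G A \<Gamma> \<mu> \<longleftrightarrow>
     \<mu> \<in> grading_support G A \<Gamma> \<rightarrow>\<^sub>E {1, -1} \<and>
     (\<forall>t\<in>grading_support G A \<Gamma>. \<forall>X\<in>\<Gamma> t. X \<noteq> \<zero>\<^bsub>A\<^esub> \<longrightarrow>
        (\<exists>r>0. X \<otimes>\<^bsub>A\<^esub> X = (r * \<mu> t) \<odot>\<^bsub>A\<^esub> \<one>\<^bsub>A\<^esub>))"

definition full_gradings :: "'g monoid \<Rightarrow> (real, 'a) module \<Rightarrow> ('g \<Rightarrow> 'a set) set" where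
  "full_gradings T A =
     {\<Gamma>. abelian_division_grading_1 T A \<Gamma> \<and> grading_support T A \<Gamma> = carrier T}"

definition full_grading_iso_rel ::
    "'g monoid \<Rightarrow> (real, 'a) module \<Rightarrow> (('g \<Rightarrow> 'a set) \<times> ('g \<Rightarrow> 'a set)) set" where
  "full_grading_iso_rel T A =
     {(\<Gamma>, \<Delta>). \<Gamma> \<in> full_gradings T A \<and> \<Delta> \<in> full_gradings T A \<and> graded_isomorphic T A \<Gamma> A \<Delta>}"

section \<open>Quadratic forms\<close>

definition alternating_bicharacter :: "'g monoid \<Rightarrow> ('g \<Rightarrow> 'g \<Rightarrow> real) \<Rightarrow> bool" where
  "alternating_bicharacter T \<beta> \<longleftrightarrow>
     (\<forall>u\<in>carrier T. \<forall>v\<in>carrier T. \<beta> u v \<noteq> 0) \<and>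
     (\<forall>u\<in>carrier T. \<forall>v\<in>carrier T. \<forall>w\<in>carrier T.
        \<beta> (u \<otimes>\<^bsub>T\<^esub> v) w = \<beta> u w * \<beta> v w \<and> \<beta> u (v \<otimes>\<^bsub>T\<^esub> w) = \<beta> u v * \<beta> u w) \<and>
     (\<forall>u\<in>carrier T. \<beta> u u = 1)"

definition bichar_radical :: "'g monoid \<Rightarrow> ('g \<Rightarrow> 'g \<Rightarrow> real) \<Rightarrow> 'g set" where
  "bichar_radical T \<beta> = {t \<in> carrier T. \<forall>u\<in>carrier T. \<beta> u t = 1}"

definition type_I :: "'g monoid \<Rightarrow> ('g \<Rightarrow> 'g \<Rightarrow> real) \<Rightarrow> bool" where
  "type_I T \<beta> \<longleftrightarrow> bichar_radical T \<beta> = {\<one>\<^bsub>T\<^esub>}"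

definition polarization :: "'g monoid \<Rightarrow> ('g \<Rightarrow> real) \<Rightarrow> 'g \<Rightarrow> 'g \<Rightarrow> real" where
  "polarization T \<mu> u v = \<mu> (u \<otimes>\<^bsub>T\<^esub> v) * inverse (\<mu> u) * inverse (\<mu> v)"

definition quadratic_forms :: "'g monoid \<Rightarrow> ('g \<Rightarrow> real) set" where
  "quadratic_forms T =
     {\<mu> \<in> carrier T \<rightarrow>\<^sub>E {1, -1}. alternating_bicharacter T (polarization T \<mu>)}"

definition arf_invariant :: "'g set \<Rightarrow> ('g \<Rightarrow> real) \<Rightarrow> int" where
  "arf_invariant S \<mu> =
     sgn (int (card {t \<in> S. \<mu> t = 1}) - int (card {t \<in> S. \<mu> t = -1}))"

definition Z2_power :: "nat \<Rightarrow> (nat \<Rightarrow> int) monoid" where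
  "Z2_power r = product_group {..<r} (\<lambda>_. integer_mod_group 2)"

section \<open>Graded tensor products\<close>

text \<open>The tensor product of a family of real algebras \<open>A i\<close>, \<open>i \<in> I\<close>: the real vector space
  freely generated by the tuples in the product of the carriers (finitely supported functions
  \<open>p\<close>, with \<open>single x 1\<close> the generator at \<open>x\<close>), modulo the span of the multilinearity relations,
  with the tuplewise product of generators. All factors of a tensor product are
  treated at once, since iterating a binary construction would change the type at each step.\<close>

definition tuples :: "'i set \<Rightarrow> ('i \<Rightarrow> (real, 'a) module) \<Rightarrow> ('i \<Rightarrow> 'a) set" where
  "tuples I A = (\<Pi>\<^sub>E i\<in>I. carrier (A i))"

definition free_scale :: "real \<Rightarrow> ('x \<Rightarrow>\<^sub>0 real) \<Rightarrow> ('x \<Rightarrow>\<^sub>0 real)" where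
  "free_scale r p = Poly_Mapping.map ((*) r) p"

definition free_mult ::
    "'i set \<Rightarrow> ('i \<Rightarrow> (real, 'a) module) \<Rightarrow>
     (('i \<Rightarrow> 'a) \<Rightarrow>\<^sub>0 real) \<Rightarrow> (('i \<Rightarrow> 'a) \<Rightarrow>\<^sub>0 real) \<Rightarrow> (('i \<Rightarrow> 'a) \<Rightarrow>\<^sub>0 real)" where
  "free_mult I A p q =
     (\<Sum>x\<in>Poly_Mapping.keys p. \<Sum>y\<in>Poly_Mapping.keys q.
        Poly_Mapping.single (\<lambda>i\<in>I. x i \<otimes>\<^bsub>A i\<^esub> y i)
          (Poly_Mapping.lookup p x * Poly_Mapping.lookup q y))"

inductive_set multilinear_relations ::
    "'i set \<Rightarrow> ('i \<Rightarrow> (real, 'a) module) \<Rightarrow> (('i \<Rightarrow> 'a) \<Rightarrow>\<^sub>0 real) set"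
  for I :: "'i set" and A :: "'i \<Rightarrow> (real, 'a) module" where
  additive: "x \<in> tuples I A \<Longrightarrow> i \<in> I \<Longrightarrow> a \<in> carrier (A i) \<Longrightarrow> b \<in> carrier (A i) \<Longrightarrow>
    Poly_Mapping.single (x(i := a \<oplus>\<^bsub>A i\<^esub> b)) 1
      - Poly_Mapping.single (x(i := a)) 1 - Poly_Mapping.single (x(i := b)) 1
      \<in> multilinear_relations I A"
| homogeneous: "x \<in> tuples I A \<Longrightarrow> i \<in> I \<Longrightarrow> a \<in> carrier (A i) \<Longrightarrow>
    Poly_Mapping.single (x(i := r \<odot>\<^bsub>A i\<^esub> a)) 1
      - free_scale r (Poly_Mapping.single (x(i := a)) 1)
      \<in> multilinear_relations I A"
| zero: "0 \<in> multilinear_relations I A"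
| plus: "p \<in> multilinear_relations I A \<Longrightarrow> q \<in> multilinear_relations I A \<Longrightarrow>
    p + q \<in> multilinear_relations I A"
| scale: "p \<in> multilinear_relations I A \<Longrightarrow> free_scale r p \<in> multilinear_relations I A"

definition tensor_class ::
    "'i set \<Rightarrow> ('i \<Rightarrow> (real, 'a) module) \<Rightarrow>
     (('i \<Rightarrow> 'a) \<Rightarrow>\<^sub>0 real) \<Rightarrow> (('i \<Rightarrow> 'a) \<Rightarrow>\<^sub>0 real) set" where
  "tensor_class I A p =
     {q. Poly_Mapping.keys q \<subseteq> tuples I A \<and> q - p \<in> multilinear_relations I A}"

definition tensor_algebra ::
    "'i set \<Rightarrow> ('i \<Rightarrow> (real, 'a) module) \<Rightarrow> (real, (('i \<Rightarrow> 'a) \<Rightarrow>\<^sub>0 real) set) module" where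
  "tensor_algebra I A =
     \<lparr>carrier = tensor_class I A ` {p. Poly_Mapping.keys p \<subseteq> tuples I A},
      mult = (\<lambda>P Q. \<Union>p\<in>P. \<Union>q\<in>Q. tensor_class I A (free_mult I A p q)),
      one = tensor_class I A (Poly_Mapping.single (\<lambda>i\<in>I. \<one>\<^bsub>A i\<^esub>) 1),
      zero = tensor_class I A 0,
      add = (\<lambda>P Q. \<Union>p\<in>P. \<Union>q\<in>Q. tensor_class I A (p + q)),
      smult = (\<lambda>r P. \<Union>p\<in>P. tensor_class I A (free_scale r p))\<rparr>"

text \<open>The component of degree \<open>g\<close> is spanned by the pure tensors with \<open>i\<close>-th entry of
  degree \<open>g i\<close>; the grading group is \<open>product_group I G\<close>.\<close>

definition tensor_grading ::
    "'i set \<Rightarrow> ('i \<Rightarrow> (real, 'a) module) \<Rightarrow> ('i \<Rightarrow> 'g \<Rightarrow> 'a set) \<Rightarrow>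
     ('i \<Rightarrow> 'g) \<Rightarrow> (('i \<Rightarrow> 'a) \<Rightarrow>\<^sub>0 real) set set" where
  "tensor_grading I A \<Gamma> g =
     tensor_class I A ` {p. Poly_Mapping.keys p \<subseteq> (\<Pi>\<^sub>E i\<in>I. \<Gamma> i (g i))}"

section \<open>The graded algebra \<open>M\<^sub>2(\<real>) \<otimes> \<dots> \<otimes> M\<^sub>2(\<real>) \<otimes> \<bbbH>\<close>\<close>

definition Z2_squared :: "(int \<times> int) monoid" where
  "Z2_squared = integer_mod_group 2 \<times>\<times> integer_mod_group 2"

text \<open>The degrees \<open>e, a, b, ab\<close> are \<open>(0, 0), (1, 0), (0, 1), (1, 1)\<close>.\<close>

definition M2_basis :: "int \<times> int \<Rightarrow> real mat" where
  "M2_basis g =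
     (if g = (0, 0) then mat_of_rows_list 2 [[1, 0], [0, 1]]
      else if g = (1, 0) then mat_of_rows_list 2 [[-1, 0], [0, 1]]
      else if g = (0, 1) then mat_of_rows_list 2 [[0, 1], [1, 0]]
      else mat_of_rows_list 2 [[0, -1], [1, 0]])"

definition quat_basis :: "int \<times> int \<Rightarrow> quat" where
  "quat_basis g =
     (if g = (0, 0) then Quat 1 0 0 0
      else if g = (1, 0) then Quat 0 1 0 0
      else if g = (0, 1) then Quat 0 0 1 0
      else Quat 0 0 0 1)"

definition M2_algebra :: "(real, real mat) module" where
  "M2_algebra = matrix_algebra 2"

definition quat_algebra :: "(real, quat) module" where
  "quat_algebra = type_algebra"

definition M2_grading :: "int \<times> int \<Rightarrow> real mat set" where
  "M2_grading g = {r \<odot>\<^bsub>M2_algebra\<^esub> M2_basis g | r. True}"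

definition quat_grading :: "int \<times> int \<Rightarrow> quat set" where
  "quat_grading g = {r \<odot>\<^bsub>quat_algebra\<^esub> quat_basis g | r. True}"

text \<open>The copy of an algebra along a map that is injective on its carrier. It is used to put
  \<open>M2_algebra\<close> and \<open>quat_algebra\<close> on the common type \<open>real mat + quat\<close>.\<close>

definition image_algebra :: "('a \<Rightarrow> 'b) \<Rightarrow> (real, 'a) module \<Rightarrow> (real, 'b) module" where
  "image_algebra f A =
     (let f' = inv_into (carrier A) f in
      \<lparr>carrier = f ` carrier A,
       mult = (\<lambda>x y. f (f' x \<otimes>\<^bsub>A\<^esub> f' y)), one = f \<one>\<^bsub>A\<^esub>,
       zero = f \<zero>\<^bsub>A\<^esub>, add = (\<lambda>x y. f (f' x \<oplus>\<^bsub>A\<^esub> f' y)),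
       smult = (\<lambda>r x. f (r \<odot>\<^bsub>A\<^esub> f' x))\<rparr>)"

definition standard_factor :: "nat \<Rightarrow> nat \<Rightarrow> (real, real mat + quat) module" where
  "standard_factor m i =
     (if i < m - 1 then image_algebra Inl M2_algebra else image_algebra Inr quat_algebra)"

definition standard_factor_grading :: "nat \<Rightarrow> nat \<Rightarrow> int \<times> int \<Rightarrow> (real mat + quat) set" where
  "standard_factor_grading m i g =
     (if i < m - 1 then Inl ` M2_grading g else Inr ` quat_grading g)"

definition standard_group :: "nat \<Rightarrow> (nat \<Rightarrow> int \<times> int) monoid" where
  "standard_group m = product_group {..<m} (\<lambda>_. Z2_squared)"

definition standard_algebra ::
    "nat \<Rightarrow> (real, ((nat \<Rightarrow> real mat + quat) \<Rightarrow>\<^sub>0 real) set) module" where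
  "standard_algebra m = tensor_algebra {..<m} (standard_factor m)"

definition standard_grading ::
    "nat \<Rightarrow> (nat \<Rightarrow> int \<times> int) \<Rightarrow> ((nat \<Rightarrow> real mat + quat) \<Rightarrow>\<^sub>0 real) set set" where
  "standard_grading m = tensor_grading {..<m} (standard_factor m) (standard_factor_grading m)"

end

theory Submission
  imports Defs
begin

text \<open>A grading of this kind has a basis \<open>X t\<close>, \<open>t \<in> T\<close>, with \<open>X u * X v\<close> a real multiple of
  \<open>X (u v)\<close>. Since the center is \<open>\<real>\<close>, the commutation factors are signs and form a bicharacter with
  trivial radical, so \<open>T\<close> is an elementary \<open>2\<close>-group; after normalizing \<open>X t * X t = \<mu> t\<close>, the
  bicharacter is the polarization of \<open>\<mu>\<close>. The form \<open>Re (tr (x * y))\<close> is diagonal in this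
  basis with signs \<open>\<mu>\<close> and has signature \<open>dim Herm - dim Antiherm < 0\<close>, which gives the Arf invariant.
  Splitting off hyperbolic planes produces a symplectic basis of \<open>T\<close> on which \<open>\<mu>\<close> takes standard
  values. The corresponding \<open>X\<close>'s generate \<open>m\<close> commuting copies of the factors \<open>M\<^sub>2(\<real>)\<close> and \<open>\<bbbH>\<close>;
  distinct characters and the equality of dimensions make the induced map from the tensor product
  an isomorphism. Hence any two gradings with the same \<open>\<mu>\<close> are isomorphic and all are equivalent
  to the tensor product, and an explicit family of monomial quaternionic matrices shows existence.\<close>

text \<open>The bicharacter does not distinguish the factors M_2(\<real>) and \<bbbH>; only
  \<open>\<mu>\<close> does. Splitting off a plane generated by two elements with
  \<open>\<mu>\<close> = 1 halves the sum of \<open>\<mu>\<close>, so a negative sum survives until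
  four elements are left, where it forces \<open>\<mu>\<close> = -1 off the identity. Hence exactly
  one factor \<bbbH>, and it comes last. The symplectic basis is chosen from T and
  \<open>\<mu>\<close> alone, before any matrices. Two gradings with the same \<open>\<mu>\<close>
  are therefore matched with the same degrees of the tensor product, and an isomorphism arises by
  composition, without structure theory of central simple algebras. The tensor product is only a
  quotient of a free space, with neither its dimension nor the ring axioms known in advance:
  multilinearity bounds it by 4^m basis tensors, a frame makes their images independent, so the
  kernel of the induced map is exactly the relations, and the ring axioms are pulled back from the
  matrices.\<close>

declare Pi_iff [simp]

section \<open>Linear combinations in real algebras\<close>

text \<open>Elimination: an equation with a nonzero coefficient is solved for one unknown, which
  leaves one equation and one unknown fewer. All dimension counts below, the one behind the Arf
  invariant included, rest on this.\<close>

lemma underdetermined_system: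
  fixes a :: "'j \<Rightarrow> 'i \<Rightarrow> real"
  assumes "finite J" "finite I" "card J < card I"
  shows "\<exists>c. (\<exists>i\<in>I. c i \<noteq> 0) \<and> (\<forall>j\<in>J. (\<Sum>i\<in>I. a j i * c i) = 0)"
  using assms
proof (induction J arbitrary: I a rule: finite_induct)
  case empty
  then obtain i where "i \<in> I" by fastforce
  then show ?case by (intro exI[of _ "\<lambda>_. 1"]) auto
next
  case (insert j J)
  show ?case
  proof (cases "\<forall>i\<in>I. a j i = 0")
    case True
    obtain c where c: "\<exists>i\<in>I. c i \<noteq> 0" "\<forall>j\<in>J. (\<Sum>i\<in>I. a j i * c i) = 0"
      using insert.IH[OF insert.prems(1), of a] insert.prems(2) insert.hyps by auto
    then show ?thesis using True by (intro exI[of _ c]) auto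
  next
    case False
    then obtain p where p: "p \<in> I" "a j p \<noteq> 0" by blast
    have "card J < card (I - {p})"
      using insert.prems insert.hyps p(1) by (simp add: card_Diff_singleton)
    then obtain c where c: "\<exists>i\<in>I - {p}. c i \<noteq> 0"
      "\<forall>k\<in>J. (\<Sum>i\<in>I - {p}. (a k i - a k p * a j i / a j p) * c i) = 0"
      using insert.IH[of "I - {p}" "\<lambda>k i. a k i - a k p * a j i / a j p"] insert.prems by auto
    \<comment> \<open>The value that equation \<open>j\<close> forces on the eliminated unknown
      \<open>p\<close>.\<close>
    define s where "s = - (\<Sum>i\<in>I - {p}. a j i * c i) / a j p"
    define d where "d = c(p := s)"
    have split: "(\<Sum>i\<in>I. a k i * d i) = a k p * s + (\<Sum>i\<in>I - {p}. a k i * c i)" for k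
      using insert.prems(1) p(1) by (simp add: sum.remove[of I p] d_def)
    have "(\<Sum>i\<in>I. a k i * d i) = 0" if "k \<in> J" for k
    proof -
      have "0 = (\<Sum>i\<in>I - {p}. a k i * c i - (a k p / a j p) * (a j i * c i))"
        using c(2) that by (auto simp: left_diff_distrib mult.assoc)
      also have "\<dots> = (\<Sum>i\<in>I - {p}. a k i * c i) - (a k p / a j p) * (\<Sum>i\<in>I - {p}. a j i * c i)"
        by (simp add: sum_subtractf sum_distrib_left)
      finally show ?thesis by (simp add: split s_def)
    qed
    moreover have "(\<Sum>i\<in>I. a j i * d i) = 0"
      using p(2) by (simp add: split s_def)
    moreover have "\<exists>i\<in>I. d i \<noteq> 0" using c(1) by (auto simp: d_def)
    ultimately show ?thesis by (intro exI[of _ d]) auto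
  qed
qed

text \<open>The module laws with scalars ranging over all of \<real>, so that they rewrite without
  membership conditions on the scalars.\<close>

locale real_alg = ring A for A :: "(real, 'a) module" (structure) +
  assumes smult_closed [simp, intro]: "x \<in> carrier A \<Longrightarrow> r \<odot> x \<in> carrier A"
    and smult_l_distr: "x \<in> carrier A \<Longrightarrow> (r + s) \<odot> x = r \<odot> x \<oplus> s \<odot> x"
    and smult_r_distr: "x \<in> carrier A \<Longrightarrow> y \<in> carrier A \<Longrightarrow> r \<odot> (x \<oplus> y) = r \<odot> x \<oplus> r \<odot> y"
    and smult_smult: "x \<in> carrier A \<Longrightarrow> r \<odot> (s \<odot> x) = (r * s) \<odot> x"
    and smult_one [simp]: "x \<in> carrier A \<Longrightarrow> 1 \<odot> x = x"
    and smult_mult_left: "x \<in> carrier A \<Longrightarrow> y \<in> carrier A \<Longrightarrow> (r \<odot> x) \<otimes> y = r \<odot> (x \<otimes> y)"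
    and smult_mult_right: "x \<in> carrier A \<Longrightarrow> y \<in> carrier A \<Longrightarrow> x \<otimes> (r \<odot> y) = r \<odot> (x \<otimes> y)"

lemma real_algebra_iff: "real_algebra A \<longleftrightarrow> real_alg A"
proof
  assume *: "real_algebra A"
  then interpret ring A by (simp add: real_algebra_def)
  interpret V: vectorspace "class_ring :: real ring" A using * by (simp add: real_algebra_def)
  show "real_alg A"
    by unfold_locales
      (use * V.smult_closed V.smult_l_distr V.smult_r_distr V.smult_assoc1 V.smult_one in
        \<open>auto simp: real_algebra_def\<close>)
next
  assume "real_alg A"
  then interpret real_alg A .
  have "module (class_ring :: real ring) A"
    by (intro moduleI class_cring.is_cring is_abelian_group)
      (auto simp: smult_l_distr smult_r_distr smult_smult)
  moreover have "field (class_ring :: real ring)"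
    by (rule class_field.field_axioms)
  ultimately show "real_algebra A"
    by (auto simp: real_algebra_def vectorspace_def smult_mult_left smult_mult_right ring_axioms)
qed

text \<open>Families rather than sets of vectors, so that coefficients can be indexed by the degrees
  of a grading.\<close>

definition spans :: "(real, 'a) module \<Rightarrow> ('i \<Rightarrow> 'a) \<Rightarrow> 'i set \<Rightarrow> bool" where
  "spans A X I \<longleftrightarrow>
     finite I \<and> X \<in> I \<rightarrow> carrier A \<and>
     (\<forall>x\<in>carrier A. \<exists>c. x = (\<Oplus>\<^bsub>A\<^esub>i\<in>I. c i \<odot>\<^bsub>A\<^esub> X i))"

definition indep :: "(real, 'a) module \<Rightarrow> ('i \<Rightarrow> 'a) \<Rightarrow> 'i set \<Rightarrow> bool" where
  "indep A X I \<longleftrightarrow>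
     finite I \<and> X \<in> I \<rightarrow> carrier A \<and>
     (\<forall>c. (\<Oplus>\<^bsub>A\<^esub>i\<in>I. c i \<odot>\<^bsub>A\<^esub> X i) = \<zero>\<^bsub>A\<^esub> \<longrightarrow> (\<forall>i\<in>I. c i = 0))"

lemma indep_finite: "indep A X I \<Longrightarrow> finite I"
  unfolding indep_def by blast

lemma indep_closed: "indep A X I \<Longrightarrow> i \<in> I \<Longrightarrow> X i \<in> carrier A"
  unfolding indep_def by blast

lemma indepD:
  "indep A X I \<Longrightarrow> (\<Oplus>\<^bsub>A\<^esub>i\<in>I. c i \<odot>\<^bsub>A\<^esub> X i) = \<zero>\<^bsub>A\<^esub> \<Longrightarrow> i \<in> I \<Longrightarrow> c i = 0"
  by (auto simp: indep_def)

context real_alg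
begin

lemma smult_zero_left [simp]: "x \<in> carrier A \<Longrightarrow> 0 \<odot> x = \<zero>"
  using smult_l_distr[of x 0 0] smult_closed[of x 0] add.r_cancel_one'[of "0 \<odot> x" "0 \<odot> x"]
  by simp

lemma smult_zero_right [simp]: "r \<odot> \<zero> = \<zero>"
  using smult_smult[of \<zero> r 0] by simp

lemma smult_minus_one: "x \<in> carrier A \<Longrightarrow> (- 1) \<odot> x = \<ominus> x"
  using smult_l_distr[of x "- 1" 1] minus_equality[of "(- 1) \<odot> x" x] by simp

lemma smult_eq_zero_iff: "x \<in> carrier A \<Longrightarrow> r \<odot> x = \<zero> \<longleftrightarrow> r = 0 \<or> x = \<zero>"
proof
  assume x: "x \<in> carrier A" and r: "r \<odot> x = \<zero>"
  show "r = 0 \<or> x = \<zero>"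
  proof (rule disjCI)
    assume "x \<noteq> \<zero>"
    then show "r = 0"
      using smult_smult[OF x, of "inverse r" r] x r by (cases "r = 0") auto
  qed
qed auto

lemma smult_right_cancel:
  assumes "x \<in> carrier A" "x \<noteq> \<zero>" "r \<odot> x = s \<odot> x"
  shows "r = s"
proof -
  have "(r - s) \<odot> x = r \<odot> x \<oplus> (- s) \<odot> x" using assms smult_l_distr[of x r "- s"] by simp
  also have "\<dots> = s \<odot> x \<oplus> (- s) \<odot> x" using assms by simp
  also have "\<dots> = \<zero>" using assms smult_l_distr[of x s "- s"] by simp
  finally show ?thesis using assms smult_eq_zero_iff by simp
qed

lemma smult_Units:
  assumes "x \<in> Units A" "r \<noteq> 0"
  shows "r \<odot> x \<in> Units A"
proof -
  have "(inverse r \<odot> inv x) \<otimes> (r \<odot> x) = \<one>" "(r \<odot> x) \<otimes> (inverse r \<odot> inv x) = \<one>"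
    using assms Units_closed Units_inv_closed
    by (auto simp: smult_mult_left smult_mult_right smult_smult Units_l_inv Units_r_inv)
  then show ?thesis
    using assms Units_closed Units_inv_closed unfolding Units_def by blast
qed

lemma finsum_smult:
  assumes "f \<in> I \<rightarrow> carrier A"
  shows "r \<odot> (\<Oplus>i\<in>I. f i) = (\<Oplus>i\<in>I. r \<odot> f i)"
  using assms
  by (induction I rule: infinite_finite_induct) (auto simp: smult_r_distr Pi_def)

lemma finsum_smult_const:
  assumes "finite I" "x \<in> carrier A"
  shows "(\<Oplus>i\<in>I. c i \<odot> x) = (\<Sum>i\<in>I. c i) \<odot> x"
  using assms by (induction I rule: finite_induct) (auto simp: smult_l_distr)

lemma finsum_all_zero: "(\<And>i. i \<in> I \<Longrightarrow> f i = \<zero>) \<Longrightarrow> (\<Oplus>i\<in>I. f i) = \<zero>"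
  using finsum_cong'[of I I "\<lambda>_. \<zero>" f] by (simp add: finsum_zero)

lemma finsum_mono_neutral:
  assumes "finite J" "I \<subseteq> J" "f \<in> J \<rightarrow> carrier A" "\<And>i. i \<in> J - I \<Longrightarrow> f i = \<zero>"
  shows "(\<Oplus>i\<in>I. f i) = (\<Oplus>i\<in>J. f i)"
proof -
  have "(\<Oplus>i\<in>I \<union> (J - I). f i) = (\<Oplus>i\<in>I. f i) \<oplus> (\<Oplus>i\<in>J - I. f i)"
    using assms by (intro finsum_Un_disjoint) (auto intro: finite_subset)
  moreover have "I \<union> (J - I) = J" using assms(2) by blast
  moreover have "(\<Oplus>i\<in>J - I. f i) = \<zero>" using assms(4) by (rule finsum_all_zero)
  moreover have "(\<Oplus>i\<in>I. f i) \<in> carrier A" using assms by (intro finsum_closed) auto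
  ultimately show ?thesis by simp
qed

lemma finsum_single:
  assumes "finite I" "p \<in> I" "f p \<in> carrier A" "\<And>i. i \<in> I \<Longrightarrow> i \<noteq> p \<Longrightarrow> f i = \<zero>"
  shows "(\<Oplus>i\<in>I. f i) = f p"
proof -
  have "(\<Oplus>i\<in>{p}. f i) = (\<Oplus>i\<in>I. f i)"
    using assms by (intro finsum_mono_neutral) (auto, metis zero_closed)
  then show ?thesis using assms(3) by simp
qed

lemma finsum_minus_smult:
  assumes "finite I" "X \<in> I \<rightarrow> carrier A"
  shows "(\<Oplus>i\<in>I. c i \<odot> X i) \<oplus> (- 1) \<odot> (\<Oplus>i\<in>I. d i \<odot> X i) = (\<Oplus>i\<in>I. (c i - d i) \<odot> X i)"
proof -
  have "(c i - d i) \<odot> X i = c i \<odot> X i \<oplus> (- 1) \<odot> (d i \<odot> X i)" if "i \<in> I" for i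
    using that assms(2) smult_l_distr[of "X i" "c i" "- d i"] by (auto simp: smult_smult Pi_iff)
  then have "(\<Oplus>i\<in>I. (c i - d i) \<odot> X i) = (\<Oplus>i\<in>I. c i \<odot> X i \<oplus> (- 1) \<odot> (d i \<odot> X i))"
    using assms by (intro finsum_cong') (auto simp: Pi_iff)
  also have "\<dots> = (\<Oplus>i\<in>I. c i \<odot> X i) \<oplus> (\<Oplus>i\<in>I. (- 1) \<odot> (d i \<odot> X i))"
    using assms by (intro finsum_addf) auto
  also have "(\<Oplus>i\<in>I. (- 1) \<odot> (d i \<odot> X i)) = (- 1) \<odot> (\<Oplus>i\<in>I. d i \<odot> X i)"
    using assms by (intro finsum_smult[symmetric]) auto
  finally show ?thesis by simp
qed

text \<open>A linear combination of linear combinations, with a matrix acting on the coefficients.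
  It reduces linear dependence to a system of equations, and later carries out the character sum for
  frames.\<close>

lemma finsum_smult_swap:
  assumes "finite I" "finite J" "Y \<in> J \<rightarrow> carrier A"
  shows "(\<Oplus>i\<in>I. c i \<odot> (\<Oplus>j\<in>J. a j i \<odot> Y j)) = (\<Oplus>j\<in>J. (\<Sum>i\<in>I. a j i * c i) \<odot> Y j)"
  using assms(1)
proof (induction I rule: finite_induct)
  case empty
  then show ?case using assms(3) by (auto simp: Pi_iff intro!: finsum_all_zero[symmetric])
next
  case (insert p I)
  have Y: "Y j \<in> carrier A" if "j \<in> J" for j using that assms(3) by auto
  have "(\<Oplus>i\<in>insert p I. c i \<odot> (\<Oplus>j\<in>J. a j i \<odot> Y j))
    = c p \<odot> (\<Oplus>j\<in>J. a j p \<odot> Y j) \<oplus> (\<Oplus>i\<in>I. c i \<odot> (\<Oplus>j\<in>J. a j i \<odot> Y j))"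
    using insert.hyps Y by (intro finsum_insert) auto
  also have "c p \<odot> (\<Oplus>j\<in>J. a j p \<odot> Y j) = (\<Oplus>j\<in>J. (a j p * c p) \<odot> Y j)"
    using Y by (auto simp: finsum_smult smult_smult mult.commute intro!: finsum_cong')
  also have "(\<Oplus>i\<in>I. c i \<odot> (\<Oplus>j\<in>J. a j i \<odot> Y j)) = (\<Oplus>j\<in>J. (\<Sum>i\<in>I. a j i * c i) \<odot> Y j)"
    by (rule insert.IH)
  also have "(\<Oplus>j\<in>J. (a j p * c p) \<odot> Y j) \<oplus> (\<Oplus>j\<in>J. (\<Sum>i\<in>I. a j i * c i) \<odot> Y j)
    = (\<Oplus>j\<in>J. (a j p * c p) \<odot> Y j \<oplus> (\<Sum>i\<in>I. a j i * c i) \<odot> Y j)"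
    using Y by (intro finsum_addf[symmetric]) auto
  also have "\<dots> = (\<Oplus>j\<in>J. (\<Sum>i\<in>insert p I. a j i * c i) \<odot> Y j)"
    using Y insert.hyps by (intro finsum_cong') (auto simp: smult_l_distr)
  finally show ?case .
qed

text \<open>Expressing \<open>X\<close> through \<open>Y\<close> turns a dependency of
  \<open>X\<close> into a homogeneous system with more unknowns than equations.\<close>

lemma spans_dependent:
  assumes "spans A Y J" "finite I" "X \<in> I \<rightarrow> carrier A" "card J < card I"
  shows "\<exists>c. (\<exists>i\<in>I. c i \<noteq> 0) \<and> (\<Oplus>i\<in>I. c i \<odot> X i) = \<zero>"
proof -
  have Y: "finite J" "Y \<in> J \<rightarrow> carrier A" using assms(1) by (auto simp: spans_def)
  have "\<forall>i\<in>I. \<exists>c. X i = (\<Oplus>j\<in>J. c j \<odot> Y j)" using assms(1,3) by (auto simp: spans_def)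
  then obtain a where a: "\<And>i. i \<in> I \<Longrightarrow> X i = (\<Oplus>j\<in>J. a i j \<odot> Y j)" by metis
  obtain c where c: "\<exists>i\<in>I. c i \<noteq> 0" "\<forall>j\<in>J. (\<Sum>i\<in>I. a i j * c i) = 0"
    using underdetermined_system[OF Y(1) assms(2,4), of "\<lambda>j i. a i j"] by auto
  have "(\<Oplus>i\<in>I. c i \<odot> X i) = (\<Oplus>i\<in>I. c i \<odot> (\<Oplus>j\<in>J. a i j \<odot> Y j))"
    using Y(2) by (intro finsum_cong') (auto simp: a Pi_def)
  also have "\<dots> = (\<Oplus>j\<in>J. (\<Sum>i\<in>I. a i j * c i) \<odot> Y j)"
    using finsum_smult_swap[OF assms(2) Y, of c "\<lambda>j i. a i j"] .
  also have "\<dots> = \<zero>" using c(2) Y(2) by (intro finsum_all_zero) (auto simp: Pi_def)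
  finally show ?thesis using c(1) by blast
qed

lemma indep_card_le:
  assumes "spans A Y J" "indep A X I"
  shows "card I \<le> card J"
  using spans_dependent[OF assms(1), of I X] assms(2) unfolding indep_def
  by (meson linorder_not_le)

text \<open>Adjoining a vector \<open>x\<close> to \<open>X\<close> gives more than
  \<open>card J\<close> vectors, hence a dependency. Independence of \<open>X\<close> keeps the
  coefficient of \<open>x\<close> in it from vanishing, so it can be solved for
  \<open>x\<close>.\<close>

lemma indep_imp_spans:
  assumes "spans A Y J" "indep A X I" "card J \<le> card I"
  shows "spans A X I"
  unfolding spans_def
proof (intro conjI ballI)
  show fin: "finite I" and X: "X \<in> I \<rightarrow> carrier A" using assms(2) by (auto simp: indep_def)
  fix x assume x: "x \<in> carrier A"
  \<comment> \<open>\<open>None\<close> indexes the adjoined vector \<open>x\<close>, which may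
    already occur among the \<open>X i\<close>.\<close>
  define Z where "Z = case_option x X"
  define K where "K = insert None (Some ` I)"
  have "card K = Suc (card I)" using fin by (simp add: K_def card_insert_if card_image)
  then have "card J < card K" "finite K" using assms(3) fin by (auto simp: K_def)
  moreover have Z: "Z \<in> K \<rightarrow> carrier A" using X x by (auto simp: Z_def K_def)
  ultimately obtain c where c: "\<exists>i\<in>K. c i \<noteq> 0" "(\<Oplus>i\<in>K. c i \<odot> Z i) = \<zero>"
    using spans_dependent[OF assms(1)] by blast
  have "(\<Oplus>i\<in>K. c i \<odot> Z i) = c None \<odot> x \<oplus> (\<Oplus>i\<in>Some ` I. c i \<odot> Z i)"
    unfolding K_def using fin X x by (subst finsum_insert) (auto simp: Z_def)
  also have "(\<Oplus>i\<in>Some ` I. c i \<odot> Z i) = (\<Oplus>i\<in>I. c (Some i) \<odot> X i)"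
    using X by (subst finsum_reindex) (auto simp: Z_def)
  finally have eq: "c None \<odot> x \<oplus> (\<Oplus>i\<in>I. c (Some i) \<odot> X i) = \<zero>" using c(2) by simp
  have S: "(\<Oplus>i\<in>I. c (Some i) \<odot> X i) \<in> carrier A" using X by (intro finsum_closed) auto
  have c0: "c None \<noteq> 0"
  proof
    assume "c None = 0"
    then have "(\<Oplus>i\<in>I. c (Some i) \<odot> X i) = \<zero>" using eq x S by simp
    then have "\<forall>i\<in>I. c (Some i) = 0"
      by (intro ballI indepD[OF assms(2), where c = "\<lambda>i. c (Some i)"])
    with c(1) \<open>c None = 0\<close> show False unfolding K_def by blast
  qed
  have "c None \<odot> x = \<ominus> (\<Oplus>i\<in>I. c (Some i) \<odot> X i)"
    using minus_equality[OF eq] S x by simp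
  also have "\<dots> = (- 1) \<odot> (\<Oplus>i\<in>I. c (Some i) \<odot> X i)" using S by (simp add: smult_minus_one)
  finally have "inverse (c None) \<odot> (c None \<odot> x)
    = inverse (c None) \<odot> ((- 1) \<odot> (\<Oplus>i\<in>I. c (Some i) \<odot> X i))" by simp
  moreover have "inverse (c None) \<odot> (c None \<odot> x) = x"
    using c0 x smult_smult[OF x, of "inverse (c None)" "c None"] by simp
  ultimately have "x = (- inverse (c None)) \<odot> (\<Oplus>i\<in>I. c (Some i) \<odot> X i)"
    using smult_smult[OF S] by simp
  also have "\<dots> = (\<Oplus>i\<in>I. (- inverse (c None) * c (Some i)) \<odot> X i)"
    using X by (auto simp: finsum_smult smult_smult Pi_def intro!: finsum_cong')
  finally show "\<exists>c. x = (\<Oplus>i\<in>I. c i \<odot> X i)"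
    by (rule exI[where x = "\<lambda>i. - inverse (c None) * c (Some i)"])
qed

lemma indep_unique:
  assumes "indep A X I" "(\<Oplus>i\<in>I. c i \<odot> X i) = (\<Oplus>i\<in>I. d i \<odot> X i)" "i \<in> I"
  shows "c i = d i"
proof -
  have X: "finite I" "X \<in> I \<rightarrow> carrier A" using assms(1) by (auto simp: indep_def)
  have "(\<Oplus>i\<in>I. d i \<odot> X i) \<in> carrier A" using X by (intro finsum_closed) auto
  then have "(\<Oplus>i\<in>I. (c i - d i) \<odot> X i) = \<zero>"
    using finsum_minus_smult[OF X, of c d] assms(2) by (simp add: smult_minus_one r_neg)
  then show ?thesis using assms(1,3) by (auto simp: indep_def)
qed

lemma indep_nonzero:
  assumes "indep A X I" "i \<in> I"
  shows "X i \<noteq> \<zero>"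
proof
  assume "X i = \<zero>"
  then have "(\<Oplus>j\<in>I. (if j = i then 1 else 0) \<odot> X j) = \<zero>"
    using assms by (intro finsum_all_zero) (auto simp: indep_def)
  from indepD[OF assms(1) this assms(2)] show False by simp
qed

lemma indep_reindex:
  assumes "indep A X I" "bij_betw f J I"
  shows "indep A (\<lambda>j. X (f j)) J"
  unfolding indep_def
proof (intro conjI allI impI)
  have X: "finite I" "X \<in> I \<rightarrow> carrier A" using assms(1) by (auto simp: indep_def)
  have f: "inj_on f J" "f ` J = I" using assms(2) by (auto simp: bij_betw_def)
  show "finite J" using X(1) assms(2) bij_betw_finite by blast
  show "(\<lambda>j. X (f j)) \<in> J \<rightarrow> carrier A" using X f by auto
  fix c assume "(\<Oplus>j\<in>J. c j \<odot> X (f j)) = \<zero>"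
  also have "(\<Oplus>j\<in>J. c j \<odot> X (f j)) = (\<Oplus>j\<in>J. c (inv_into J f (f j)) \<odot> X (f j))"
    using X f by (intro finsum_cong') auto
  also have "\<dots> = (\<Oplus>i\<in>I. c (inv_into J f i) \<odot> X i)"
    unfolding f(2)[symmetric] using X f by (subst finsum_reindex) (auto simp: Pi_def)
  finally have "\<forall>i\<in>I. c (inv_into J f i) = 0"
    by (intro ballI indepD[OF assms(1), where c = "\<lambda>i. c (inv_into J f i)"])
  then show "\<forall>j\<in>J. c j = 0" using f by auto
qed

lemma finsum_commute_elem:
  assumes "f \<in> I \<rightarrow> carrier A" "y \<in> carrier A" "\<And>i. i \<in> I \<Longrightarrow> f i \<otimes> y = y \<otimes> f i"
  shows "(\<Oplus>i\<in>I. f i) \<otimes> y = y \<otimes> (\<Oplus>i\<in>I. f i)"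
  using assms(1,3)
proof (induction I rule: infinite_finite_induct)
  case (insert p I)
  then have "f p \<in> carrier A" "f \<in> I \<rightarrow> carrier A" "(\<Oplus>i\<in>I. f i) \<in> carrier A"
    by (auto intro!: finsum_closed)
  then show ?case using insert assms(2) by (simp add: l_distr r_distr)
qed (use assms(2) in auto)

end

section \<open>Division gradings with one-dimensional components as graded bases\<close>

definition line :: "(real, 'a) module \<Rightarrow> 'a \<Rightarrow> 'a set" where
  "line A x = {r \<odot>\<^bsub>A\<^esub> x | r. True}"

text \<open>This presents \<open>A\<close> as a twisted group algebra. \<open>T\<close> stands for
  the support of a grading, and the lines through the \<open>X t\<close> are its components.\<close>

definition graded_basis :: "'g monoid \<Rightarrow> (real, 'a) module \<Rightarrow> ('g \<Rightarrow> 'a) \<Rightarrow> bool" where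
  "graded_basis T A X \<longleftrightarrow>
     comm_group T \<and> indep A X (carrier T) \<and> spans A X (carrier T) \<and>
     (\<forall>t\<in>carrier T. X t \<in> Units A) \<and>
     (\<forall>u\<in>carrier T. \<forall>v\<in>carrier T. \<exists>c. X u \<otimes>\<^bsub>A\<^esub> X v = c \<odot>\<^bsub>A\<^esub> X (u \<otimes>\<^bsub>T\<^esub> v))"

lemma one_dim_imp_line:
  assumes "vectorspace (class_ring :: real ring) (A\<lparr>carrier := W\<rparr>)"
    and "vectorspace.fin_dim (class_ring :: real ring) (A\<lparr>carrier := W\<rparr>)"
    and "vectorspace.dim (class_ring :: real ring) (A\<lparr>carrier := W\<rparr>) = 1"
  shows "\<exists>x\<in>W. W = line A x"
proof -
  interpret V: vectorspace "class_ring :: real ring" "A\<lparr>carrier := W\<rparr>" by fact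
  obtain B where B: "finite B" "V.basis B" using V.finite_basis_exists[OF assms(2)] by blast
  then have "card B = 1" using V.dim_basis assms(3) by simp
  then obtain x where x: "B = {x}" by (auto simp: card_1_singleton_iff)
  have xW: "x \<in> W" and W: "W = V.span {x}" using B x by (auto simp: V.basis_def)
  have "W = {V.lincomb a {x} | a. a \<in> {x} \<rightarrow> carrier class_ring}"
    using W V.finite_span[of "{x}"] xW by simp
  moreover have "V.lincomb a {x} = a x \<odot>\<^bsub>A\<^esub> x" for a
  proof -
    have "a x \<odot>\<^bsub>A\<^esub> x \<in> W" using V.smult_closed[of "a x" x] xW by simp
    then show ?thesis using V.M.r_zero[of "a x \<odot>\<^bsub>A\<^esub> x"] by (simp add: V.lincomb_def)
  qed
  ultimately have "W = {a x \<odot>\<^bsub>A\<^esub> x | a :: 'a \<Rightarrow> real. True}" by auto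
  also have "\<dots> = line A x"
  proof -
    have "\<exists>a :: 'a \<Rightarrow> real. r \<odot>\<^bsub>A\<^esub> x = a x \<odot>\<^bsub>A\<^esub> x" for r by (rule exI[where x = "\<lambda>_. r"]) simp
    then show ?thesis unfolding line_def by blast
  qed
  finally show ?thesis using xW by blast
qed

context real_alg
begin

lemma vectorspace_class_ring: "vectorspace (class_ring :: real ring) A"
  using real_alg_axioms by (simp add: real_algebra_iff[symmetric] real_algebra_def)

lemma line_subset: "x \<in> carrier A \<Longrightarrow> line A x \<subseteq> carrier A"
  by (auto simp: line_def)

lemma smult_in_line: "r \<odot> x \<in> line A x"
  by (auto simp: line_def)

lemma self_in_line: "x \<in> carrier A \<Longrightarrow> x \<in> line A x"
  using smult_in_line[of 1 x] by simp

lemma zero_in_line: "x \<in> carrier A \<Longrightarrow> \<zero> \<in> line A x"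
  using smult_in_line[of 0 x] by simp

lemma line_eqI:
  assumes "x \<in> carrier A" "y \<in> line A x" "y \<noteq> \<zero>"
  shows "line A y = line A x"
proof -
  obtain r where r: "y = r \<odot> x" using assms(2) by (auto simp: line_def)
  have "r \<noteq> 0" using r assms by auto
  then have "s \<odot> x = (s * inverse r) \<odot> y" for s
    using assms(1) by (simp add: r smult_smult mult.assoc)
  moreover have "s \<odot> y = (s * r) \<odot> x" for s
    using assms(1) by (simp add: r smult_smult)
  ultimately show ?thesis unfolding line_def by blast
qed

lemma subspace_line:
  assumes "x \<in> carrier A"
  shows "VectorSpace.subspace (class_ring :: real ring) (line A x) A"
proof -
  interpret V: vectorspace "class_ring :: real ring" A by (rule vectorspace_class_ring)
  have "r \<odot> x \<oplus> s \<odot> x \<in> line A x" "r \<odot> (s \<odot> x) \<in> line A x" for r s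
    using assms by (auto simp: smult_l_distr[symmetric] smult_smult smult_in_line)
  then have "LinearCombinations.submodule (class_ring :: real ring) (line A x) A"
    using assms zero_in_line[OF assms] line_subset[OF assms]
      V.module_axioms
    by (auto simp: LinearCombinations.submodule_def line_def)
  then show ?thesis by (simp add: VectorSpace.subspace_def vectorspace_class_ring)
qed

lemma line_one_dim:
  assumes "x \<in> carrier A" "x \<noteq> \<zero>"
  shows "vectorspace.fin_dim (class_ring :: real ring) (A\<lparr>carrier := line A x\<rparr>)"
    and "vectorspace.dim (class_ring :: real ring) (A\<lparr>carrier := line A x\<rparr>) = 1"
proof -
  have vs: "vectorspace (class_ring :: real ring) (A\<lparr>carrier := line A x\<rparr>)"
    using vectorspace.subspace_is_vs[OF vectorspace_class_ring subspace_line[OF assms(1)]] .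
  interpret V: vectorspace "class_ring :: real ring" "A\<lparr>carrier := line A x\<rparr>" by (rule vs)
  have xl: "x \<in> line A x" by (rule self_in_line[OF assms(1)])
  have l: "V.lincomb a {x} = a x \<odot> x" for a
    using smult_in_line[of "a x" x] V.M.r_zero[of "a x \<odot> x"] by (simp add: V.lincomb_def)
  have "V.span {x} = {V.lincomb a {x} | a. a \<in> {x} \<rightarrow> carrier class_ring}"
    using V.finite_span[of "{x}"] xl by simp
  also have "\<dots> = {a x \<odot> x | a :: 'a \<Rightarrow> real. True}" by (auto simp: l)
  also have "\<dots> = line A x"
  proof -
    have "\<exists>a :: 'a \<Rightarrow> real. r \<odot> x = a x \<odot> x" for r by (rule exI[where x = "\<lambda>_. r"]) simp
    then show ?thesis unfolding line_def by blast
  qed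
  finally have gen: "V.gen_set {x}" by simp
  then show "V.fin_dim" unfolding V.fin_dim_def using xl by (intro exI[of _ "{x}"]) auto
  show "V.dim = 1" using gen assms(2) xl by (intro V.dim1I) auto
qed

lemma Units_nonzero: "\<one> \<noteq> \<zero> \<Longrightarrow> x \<in> Units A \<Longrightarrow> x \<noteq> \<zero>"
  by (metis Units_inv_closed Units_l_inv r_null)

text \<open>Finiteness of \<open>carrier T\<close> turns the finitely supported decompositions
  required of a grading into coordinates with respect to \<open>X\<close>, which exist and are
  unique.\<close>

lemma graded_basis_imp_grading:
  assumes gb: "graded_basis T A X" and \<Gamma>: "\<And>t. t \<in> carrier T \<Longrightarrow> \<Gamma> t = line A (X t)"
  shows "abelian_division_grading_1 T A \<Gamma>" "grading_support T A \<Gamma> = carrier T"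
proof -
  interpret T: comm_group T using gb by (simp add: graded_basis_def)
  have ind: "indep A X (carrier T)" and sp: "spans A X (carrier T)"
    and unit: "\<And>t. t \<in> carrier T \<Longrightarrow> X t \<in> Units A"
    and prod: "\<And>u v. u \<in> carrier T \<Longrightarrow> v \<in> carrier T \<Longrightarrow> \<exists>c. X u \<otimes> X v = c \<odot> X (u \<otimes>\<^bsub>T\<^esub> v)"
    using gb by (auto simp: graded_basis_def)
  have fin: "finite (carrier T)" and X: "\<And>t. t \<in> carrier T \<Longrightarrow> X t \<in> carrier A"
    using ind by (auto simp: indep_def)
  have nz: "X t \<noteq> \<zero>" if "t \<in> carrier T" for t using indep_nonzero[OF ind that] .
  have supp: "\<Gamma> t \<noteq> {\<zero>}" if "t \<in> carrier T" for t
    using \<Gamma>[OF that] self_in_line[OF X[OF that]] nz[OF that] by auto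
  then show S: "grading_support T A \<Gamma> = carrier T" by (auto simp: grading_support_def)
  have sum_supp: "(\<Oplus>g\<in>{g \<in> carrier T. c g \<noteq> \<zero>}. c g) = (\<Oplus>g\<in>carrier T. c g)"
    if "c \<in> (\<Pi>\<^sub>E g\<in>carrier T. \<Gamma> g)" for c
  proof (rule finsum_mono_neutral)
    show "c \<in> carrier T \<rightarrow> carrier A"
      using that line_subset[OF X] \<Gamma> by (fastforce simp: PiE_iff)
  qed (use fin in auto)
  have decomp: "\<exists>!c. c \<in> (\<Pi>\<^sub>E g\<in>carrier T. \<Gamma> g) \<and> finite {g \<in> carrier T. c g \<noteq> \<zero>} \<and>
      x = (\<Oplus>g\<in>{g \<in> carrier T. c g \<noteq> \<zero>}. c g)" if "x \<in> carrier A" for x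
  proof -
    obtain a where a: "x = (\<Oplus>t\<in>carrier T. a t \<odot> X t)"
      using sp \<open>x \<in> carrier A\<close> unfolding spans_def by blast
    define c where "c = (\<lambda>t\<in>carrier T. a t \<odot> X t)"
    have c: "c \<in> (\<Pi>\<^sub>E g\<in>carrier T. \<Gamma> g)" using \<Gamma> smult_in_line by (auto simp: c_def)
    have "x = (\<Oplus>g\<in>carrier T. c g)"
      unfolding a using X by (intro finsum_cong') (auto simp: c_def)
    then have 1: "c \<in> (\<Pi>\<^sub>E g\<in>carrier T. \<Gamma> g) \<and> finite {g \<in> carrier T. c g \<noteq> \<zero>} \<and>
      x = (\<Oplus>g\<in>{g \<in> carrier T. c g \<noteq> \<zero>}. c g)"
      using c fin sum_supp[OF c] by simp
    have 2: "d = c" if d: "d \<in> (\<Pi>\<^sub>E g\<in>carrier T. \<Gamma> g)"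
      and xd: "x = (\<Oplus>g\<in>{g \<in> carrier T. d g \<noteq> \<zero>}. d g)" for d
    proof -
      have "\<forall>g\<in>carrier T. \<exists>r. d g = r \<odot> X g" using d \<Gamma> by (fastforce simp: PiE_iff line_def)
      then obtain b where b: "\<And>g. g \<in> carrier T \<Longrightarrow> d g = b g \<odot> X g" by metis
      have "(\<Oplus>t\<in>carrier T. b t \<odot> X t) = (\<Oplus>g\<in>carrier T. d g)"
        using X b by (intro finsum_cong') auto
      also have "\<dots> = (\<Oplus>t\<in>carrier T. a t \<odot> X t)"
        using sum_supp[OF d] xd a by metis
      finally have "b t = a t" if "t \<in> carrier T" for t
        using indep_unique[OF ind _ that] by blast
      then show ?thesis using d c b by (intro PiE_ext[OF d c]) (simp add: c_def)
    qed
    show ?thesis using 1 2 by blast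
  qed
  have mult: "x \<otimes> y \<in> \<Gamma> (g \<otimes>\<^bsub>T\<^esub> h)"
    if gh: "g \<in> carrier T" "h \<in> carrier T" and xy: "x \<in> \<Gamma> g" "y \<in> \<Gamma> h" for g h x y
  proof -
    obtain r s where "x = r \<odot> X g" "y = s \<odot> X h" using gh xy \<Gamma> by (auto simp: line_def)
    moreover obtain c where "X g \<otimes> X h = c \<odot> X (g \<otimes>\<^bsub>T\<^esub> h)" using prod gh by blast
    ultimately have "x \<otimes> y = (r * s * c) \<odot> X (g \<otimes>\<^bsub>T\<^esub> h)"
      using X gh by (simp add: smult_mult_left smult_mult_right smult_smult ac_simps)
    then show ?thesis using \<Gamma> gh smult_in_line by auto
  qed
  have "graded_algebra T A \<Gamma>"
    unfolding graded_algebra_def real_algebra_iff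
    using T.is_group real_alg_axioms decomp mult subspace_line \<Gamma> X by auto
  moreover have "x \<in> Units A" if "g \<in> carrier T" "x \<in> \<Gamma> g" "x \<noteq> \<zero>" for g x
  proof -
    have "\<exists>r. x = r \<odot> X g" using that \<Gamma> by (auto simp: line_def)
    then obtain r where "x = r \<odot> X g" by blast
    then show ?thesis
      using smult_Units[OF unit[OF that(1)], of r] that(1,3) smult_zero_left[OF X] by (cases "r = 0") auto
  qed
  ultimately have "division_grading T A \<Gamma>" by (simp add: division_grading_def)
  moreover have "one_dim_components T A \<Gamma>"
    unfolding one_dim_components_def S using \<Gamma> line_one_dim X nz by auto
  ultimately show "abelian_division_grading_1 T A \<Gamma>"
    by (simp add: abelian_division_grading_1_def T.comm_group_axioms)
qed

text \<open>Uniqueness of the decomposition of \<zero>: the family \<open>d\<close>, extended by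
  \<zero> outside \<open>I\<close>, competes with the family that is \<zero> everywhere.\<close>

lemma grading_homogeneous_indep:
  assumes gr: "graded_algebra G A \<Gamma>" and I: "finite I" "I \<subseteq> carrier G"
    and d: "\<And>g. g \<in> I \<Longrightarrow> d g \<in> \<Gamma> g" "(\<Oplus>g\<in>I. d g) = \<zero>" "g \<in> I"
  shows "d g = \<zero>"
proof -
  have sub: "\<And>g. g \<in> carrier G \<Longrightarrow> VectorSpace.subspace (class_ring :: real ring) (\<Gamma> g) A"
    using gr by (simp add: graded_algebra_def)
  have z: "\<zero> \<in> \<Gamma> g" and sb: "\<Gamma> g \<subseteq> carrier A" if "g \<in> carrier G" for g
    using sub[OF that]
    by (auto simp: VectorSpace.subspace_def LinearCombinations.submodule_def)
  have uniq: "\<exists>!c. c \<in> (\<Pi>\<^sub>E g\<in>carrier G. \<Gamma> g) \<and> finite {g \<in> carrier G. c g \<noteq> \<zero>} \<and>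
      \<zero> = (\<Oplus>g\<in>{g \<in> carrier G. c g \<noteq> \<zero>}. c g)"
    using gr by (simp add: graded_algebra_def)
  define c where "c = (\<lambda>g\<in>carrier G. if g \<in> I then d g else \<zero>)"
  define e where "e = (\<lambda>g\<in>carrier G. \<zero>)"
  have e: "{g \<in> carrier G. e g \<noteq> \<zero>} = {}" by (auto simp: e_def)
  have "(\<Oplus>g\<in>{g \<in> carrier G. c g \<noteq> \<zero>}. c g) = (\<Oplus>g\<in>I. c g)"
    using I d(1) sb by (intro finsum_mono_neutral) (auto simp: c_def split: if_splits)
  also have "\<dots> = (\<Oplus>g\<in>I. d g)"
    using I d(1) sb by (intro finsum_cong') (auto simp: c_def)
  finally have "\<zero> = (\<Oplus>g\<in>{g \<in> carrier G. c g \<noteq> \<zero>}. c g)" using d(2) by simp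
  moreover have "finite {g \<in> carrier G. c g \<noteq> \<zero>}"
    by (rule finite_subset[OF _ I(1)]) (auto simp: c_def)
  moreover have "c \<in> (\<Pi>\<^sub>E g\<in>carrier G. \<Gamma> g)" using d(1) z by (auto simp: c_def)
  moreover have "e \<in> (\<Pi>\<^sub>E g\<in>carrier G. \<Gamma> g)" using z by (auto simp: e_def)
  ultimately have "c = e" using uniq unfolding Ex1_def
    by (metis (no_types, lifting) e finite.emptyI finsum_empty)
  then have "c g = e g" by simp
  then show ?thesis using d(3) I(2) by (auto simp: c_def e_def)
qed

text \<open>Nonzero homogeneous elements of different degrees are independent, so finite dimension
  makes the support finite. It is closed under products because a product of units is a unit, hence
  nonzero.\<close>

lemma grading_imp_graded_basis:
  assumes sp: "spans A Y J" and one: "\<one> \<noteq> \<zero>"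
    and gr: "abelian_division_grading_1 G A \<Gamma>"
  defines "S \<equiv> grading_support G A \<Gamma>"
  shows "subgroup S G"
    and "\<exists>X. graded_basis (G\<lparr>carrier := S\<rparr>) A X \<and> (\<forall>t\<in>S. \<Gamma> t = line A (X t))"
proof -
  interpret G: comm_group G using gr by (simp add: abelian_division_grading_1_def)
  interpret V: vectorspace "class_ring :: real ring" A by (rule vectorspace_class_ring)
  have ga: "graded_algebra G A \<Gamma>" and unit: "\<And>g x. g \<in> carrier G \<Longrightarrow> x \<in> \<Gamma> g \<Longrightarrow> x \<noteq> \<zero> \<Longrightarrow> x \<in> Units A"
    and od: "one_dim_components G A \<Gamma>"
    using gr by (auto simp: abelian_division_grading_1_def division_grading_def)
  have mult: "\<And>g h x y. g \<in> carrier G \<Longrightarrow> h \<in> carrier G \<Longrightarrow> x \<in> \<Gamma> g \<Longrightarrow> y \<in> \<Gamma> h \<Longrightarrow> x \<otimes> y \<in> \<Gamma> (g \<otimes>\<^bsub>G\<^esub> h)"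
    using ga by (simp add: graded_algebra_def)
  have sub: "\<And>g. g \<in> carrier G \<Longrightarrow> VectorSpace.subspace (class_ring :: real ring) (\<Gamma> g) A"
    using ga by (simp add: graded_algebra_def)
  have SG: "S \<subseteq> carrier G" by (auto simp: S_def grading_support_def)
  have "\<forall>t\<in>S. \<exists>x. x \<in> \<Gamma> t \<and> \<Gamma> t = line A x"
    using one_dim_imp_line[OF V.subspace_is_vs[OF sub]] od SG
    unfolding one_dim_components_def S_def by blast
  then obtain X where X: "\<And>t. t \<in> S \<Longrightarrow> X t \<in> \<Gamma> t" "\<And>t. t \<in> S \<Longrightarrow> \<Gamma> t = line A (X t)" by metis
  have sb: "\<Gamma> g \<subseteq> carrier A" if "g \<in> carrier G" for g
    using sub[OF that] by (auto simp: VectorSpace.subspace_def LinearCombinations.submodule_def)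
  have XA: "X t \<in> carrier A" if "t \<in> S" for t using X(1)[OF that] sb SG that by blast
  have nz: "X t \<noteq> \<zero>" if "t \<in> S" for t
  proof
    assume "X t = \<zero>"
    then have "\<Gamma> t = {\<zero>}" using X(2)[OF that] by (auto simp: line_def)
    then show False using that by (simp add: S_def grading_support_def)
  qed
  have U: "X t \<in> Units A" if "t \<in> S" for t using unit X(1) nz that SG by blast
  have ind: "indep A X I" if I: "finite I" "I \<subseteq> S" for I
    unfolding indep_def
  proof (intro conjI allI impI ballI)
    show "finite I" by fact
    show "X \<in> I \<rightarrow> carrier A" using XA I by auto
    fix c i assume c: "(\<Oplus>i\<in>I. c i \<odot> X i) = \<zero>" and i: "i \<in> I"
    have "I \<subseteq> carrier G" using I SG by blast
    moreover have "c g \<odot> X g \<in> \<Gamma> g" if "g \<in> I" for g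
      using that I X(2) smult_in_line by blast
    ultimately have "c i \<odot> X i = \<zero>"
      using grading_homogeneous_indep[OF ga I(1), where d = "\<lambda>i. c i \<odot> X i", OF _ _ c i] by blast
    then show "c i = 0" using smult_eq_zero_iff XA nz I i by blast
  qed
  have fin: "finite S"
  proof (rule ccontr)
    assume "infinite S"
    then obtain I where "finite I" "card I = Suc (card J)" "I \<subseteq> S"
      by (meson infinite_arbitrarily_large)
    then show False using indep_card_le[OF sp ind] by fastforce
  qed
  have spS: "spans A X S"
    unfolding spans_def
  proof (intro conjI ballI)
    show "finite S" by fact
    show "X \<in> S \<rightarrow> carrier A" using XA by auto
    fix x assume "x \<in> carrier A"
    then obtain c where c: "c \<in> (\<Pi>\<^sub>E g\<in>carrier G. \<Gamma> g)" "x = (\<Oplus>g\<in>{g \<in> carrier G. c g \<noteq> \<zero>}. c g)"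
      using ga unfolding graded_algebra_def by blast
    have cS: "{g \<in> carrier G. c g \<noteq> \<zero>} \<subseteq> S"
      using c(1) by (fastforce simp: S_def grading_support_def PiE_iff)
    have "\<forall>g\<in>S. \<exists>r. c g = r \<odot> X g" using c(1) X(2) SG by (fastforce simp: PiE_iff line_def)
    then obtain b where b: "\<And>g. g \<in> S \<Longrightarrow> c g = b g \<odot> X g" by metis
    have "x = (\<Oplus>g\<in>S. c g)"
      unfolding c(2) using cS fin b XA SG by (intro finsum_mono_neutral) auto
    also have "\<dots> = (\<Oplus>g\<in>S. b g \<odot> X g)" using b XA by (intro finsum_cong') auto
    finally show "\<exists>c. x = (\<Oplus>i\<in>S. c i \<odot> X i)" by (rule exI[where x = b])
  qed
  have closed: "u \<otimes>\<^bsub>G\<^esub> v \<in> S \<and> (\<exists>c. X u \<otimes> X v = c \<odot> X (u \<otimes>\<^bsub>G\<^esub> v))" if "u \<in> S" "v \<in> S" for u v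
  proof -
    have in\<Gamma>: "X u \<otimes> X v \<in> \<Gamma> (u \<otimes>\<^bsub>G\<^esub> v)" using that X(1) mult SG by blast
    have "X u \<otimes> X v \<noteq> \<zero>" using Units_nonzero[OF one Units_m_closed] U that by blast
    then have "u \<otimes>\<^bsub>G\<^esub> v \<in> S" using in\<Gamma> that SG by (auto simp: S_def grading_support_def)
    then show ?thesis using in\<Gamma> X(2) by (auto simp: line_def)
  qed
  have "S \<noteq> {}"
  proof
    assume "S = {}"
    then have "\<one> = \<zero>" using spS unfolding spans_def by (metis finsum_empty one_closed)
    then show False using one by blast
  qed
  \<comment> \<open>Translation is injective on the finite set \<open>S\<close>, hence onto; the
    identity and the inverses are then found as preimages.\<close>
  have onto: "(\<lambda>s. t \<otimes>\<^bsub>G\<^esub> s) ` S = S" if "t \<in> S" for t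
  proof (rule card_subset_eq[OF fin])
    show "(\<lambda>s. t \<otimes>\<^bsub>G\<^esub> s) ` S \<subseteq> S" using closed that by blast
    have "inj_on (\<lambda>s. t \<otimes>\<^bsub>G\<^esub> s) S"
      using that SG by (intro inj_onI) (metis G.Units_eq G.Units_l_cancel subsetD)
    then show "card ((\<lambda>s. t \<otimes>\<^bsub>G\<^esub> s) ` S) = card S" by (rule card_image)
  qed
  obtain t where t: "t \<in> S" using \<open>S \<noteq> {}\<close> by blast
  then obtain s where "s \<in> S" "t \<otimes>\<^bsub>G\<^esub> s = t" using onto by (metis imageE)
  then have e: "\<one>\<^bsub>G\<^esub> \<in> S" using t SG by (metis G.l_cancel_one subsetD)
  show sg: "subgroup S G"
  proof (rule G.subgroupI)
    fix a assume a: "a \<in> S"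
    then obtain s where s: "s \<in> S" "a \<otimes>\<^bsub>G\<^esub> s = \<one>\<^bsub>G\<^esub>" using onto e by (metis imageE)
    then have "inv\<^bsub>G\<^esub> a = s" using a SG by (metis G.inv_equality G.m_comm subsetD)
    then show "inv\<^bsub>G\<^esub> a \<in> S" using s by simp
  qed (use SG \<open>S \<noteq> {}\<close> closed in auto)
  have "comm_group (G\<lparr>carrier := S\<rparr>)" 
    using G.subgroup_imp_group[OF sg] G.m_comm SG
    by (intro group.group_comm_groupI) auto
  then have "graded_basis (G\<lparr>carrier := S\<rparr>) A X"
    using ind[OF fin] spS U closed by (auto simp: graded_basis_def)
  then show "\<exists>X. graded_basis (G\<lparr>carrier := S\<rparr>) A X \<and> (\<forall>t\<in>S. \<Gamma> t = line A (X t))"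
    using X(2) by blast
qed

end

section \<open>Signs of squares and quadratic forms\<close>

definition central_algebra :: "(real, 'a) module \<Rightarrow> bool" where
  "central_algebra A \<longleftrightarrow>
     (\<forall>z\<in>carrier A. (\<forall>x\<in>carrier A. z \<otimes>\<^bsub>A\<^esub> x = x \<otimes>\<^bsub>A\<^esub> z) \<longrightarrow> (\<exists>r. z = r \<odot>\<^bsub>A\<^esub> \<one>\<^bsub>A\<^esub>))"

definition sign_basis :: "'g monoid \<Rightarrow> (real, 'a) module \<Rightarrow> ('g \<Rightarrow> real) \<Rightarrow> ('g \<Rightarrow> 'a) \<Rightarrow> bool" where
  "sign_basis T A \<mu> X \<longleftrightarrow>
     graded_basis T A X \<and> \<mu> \<in> carrier T \<rightarrow>\<^sub>E {1, -1} \<and>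
     (\<forall>t\<in>carrier T. X t \<otimes>\<^bsub>A\<^esub> X t = \<mu> t \<odot>\<^bsub>A\<^esub> \<one>\<^bsub>A\<^esub>)"

lemma (in monoid) Units_nat_pow_closed: "x \<in> Units G \<Longrightarrow> x [^] (n :: nat) \<in> Units G"
  by (induction n) auto

lemma (in group) finite_order_elem:
  assumes "finite (carrier G)" "u \<in> carrier G"
  shows "\<exists>n > (0 :: nat). u [^] n = \<one>"
proof -
  have "\<not> inj_on (\<lambda>n :: nat. u [^] n) UNIV"
    using assms finite_subset[of "range (\<lambda>n :: nat. u [^] n)" "carrier G"] by (auto dest: finite_imageD)
  then obtain i j :: nat where ij: "i < j" and "u [^] i = u [^] j"
    unfolding inj_on_def by (metis linorder_neqE_nat)
  moreover have "u [^] i \<otimes> u [^] (j - i) = u [^] j"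
    using assms(2) ij by (simp add: nat_pow_mult)
  ultimately show ?thesis
    using assms(2) ij by (intro exI[of _ "j - i"]) (metis l_cancel_one nat_pow_closed zero_less_diff)
qed

context real_alg
begin

section \<open>Commutation and squares in a graded basis\<close>

context
  fixes T :: "'g monoid" and X
  assumes gb: "graded_basis T A X" and nontriv: "\<one> \<noteq> \<zero>"
begin

interpretation T: comm_group T using gb by (simp add: graded_basis_def)

lemma gb_closed: "t \<in> carrier T \<Longrightarrow> X t \<in> carrier A"
  using gb indep_closed unfolding graded_basis_def by blast

lemma gb_Units: "t \<in> carrier T \<Longrightarrow> X t \<in> Units A"
  using gb by (auto simp: graded_basis_def)

lemma gb_finite: "finite (carrier T)"
  using gb indep_finite unfolding graded_basis_def by blast

lemma gb_nonzero: "t \<in> carrier T \<Longrightarrow> X t \<noteq> \<zero>"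
  by (rule Units_nonzero[OF nontriv gb_Units])

lemma gb_mult:
  assumes "u \<in> carrier T" "v \<in> carrier T"
  shows "\<exists>c. c \<noteq> 0 \<and> X u \<otimes> X v = c \<odot> X (u \<otimes>\<^bsub>T\<^esub> v)"
proof -
  obtain c where c: "X u \<otimes> X v = c \<odot> X (u \<otimes>\<^bsub>T\<^esub> v)" using gb assms unfolding graded_basis_def by blast
  have "X u \<otimes> X v \<noteq> \<zero>"
    by (intro Units_nonzero[OF nontriv] Units_m_closed gb_Units assms)
  then have "c \<noteq> 0" using c assms gb_closed by auto
  then show ?thesis using c by blast
qed

text \<open>The component of the identity is closed under products, so its generator squares to a
  multiple of itself; cancelling the unit leaves a scalar.\<close>

lemma gb_one: "\<exists>c. c \<noteq> 0 \<and> X \<one>\<^bsub>T\<^esub> = c \<odot> \<one>"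
proof -
  obtain c where c: "c \<noteq> 0" "X \<one>\<^bsub>T\<^esub> \<otimes> X \<one>\<^bsub>T\<^esub> = c \<odot> X \<one>\<^bsub>T\<^esub>"
    using gb_mult[of "\<one>\<^bsub>T\<^esub>" "\<one>\<^bsub>T\<^esub>"] by auto
  then have "X \<one>\<^bsub>T\<^esub> \<otimes> X \<one>\<^bsub>T\<^esub> = X \<one>\<^bsub>T\<^esub> \<otimes> (c \<odot> \<one>)" using gb_closed by (simp add: smult_mult_right)
  then have "X \<one>\<^bsub>T\<^esub> = c \<odot> \<one>" using gb_Units gb_closed by (simp add: Units_l_cancel)
  then show ?thesis using c by blast
qed

text \<open>Commutativity of \<open>T\<close> puts both products into the same line.\<close>

lemma gb_commutation:
  assumes "u \<in> carrier T" "v \<in> carrier T"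
  shows "\<exists>b. b \<noteq> 0 \<and> X u \<otimes> X v = b \<odot> (X v \<otimes> X u)"
proof -
  obtain c where c: "c \<noteq> 0" "X u \<otimes> X v = c \<odot> X (u \<otimes>\<^bsub>T\<^esub> v)" using gb_mult assms by blast
  obtain d where d: "d \<noteq> 0" "X v \<otimes> X u = d \<odot> X (u \<otimes>\<^bsub>T\<^esub> v)"
    using gb_mult[OF assms(2,1)] assms T.m_comm by auto
  have "X u \<otimes> X v = (c * inverse d) \<odot> (X v \<otimes> X u)"
    using c d gb_closed assms by (simp add: smult_smult mult.assoc)
  then show ?thesis using c d by (intro exI[of _ "c * inverse d"]) auto
qed

lemma gb_pow: "u \<in> carrier T \<Longrightarrow> \<exists>r. X u [^] n = r \<odot> X (u [^]\<^bsub>T\<^esub> n)" for n :: nat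
proof (induction n)
  case 0
  obtain c where "c \<noteq> 0" "X \<one>\<^bsub>T\<^esub> = c \<odot> \<one>" using gb_one by blast
  then show ?case by (intro exI[of _ "inverse c"]) (simp add: smult_smult)
next
  case (Suc n)
  then obtain r where r: "X u [^] n = r \<odot> X (u [^]\<^bsub>T\<^esub> n)" by blast
  obtain c where "X (u [^]\<^bsub>T\<^esub> n) \<otimes> X u = c \<odot> X (u [^]\<^bsub>T\<^esub> Suc n)"
    using gb_mult[of "u [^]\<^bsub>T\<^esub> n" u] Suc.prems by auto
  then show ?case using r Suc.prems gb_closed
    by (intro exI[of _ "r * c"]) (simp add: smult_mult_left smult_smult)
qed

text \<open>As \<open>T\<close> is finite, some power \<open>X u [^] N\<close> with
  \<open>N > 0\<close> is a nonzero scalar and so commutes with \<open>X v\<close>. This gives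
  \<open>b ^ N = 1\<close>, and the only real roots of unity are 1 and -1.\<close>

lemma gb_commutation_sign:
  assumes "u \<in> carrier T" "v \<in> carrier T"
  shows "\<exists>b. (b = 1 \<or> b = - 1) \<and> X u \<otimes> X v = b \<odot> (X v \<otimes> X u)"
proof -
  obtain b where b: "b \<noteq> 0" "X u \<otimes> X v = b \<odot> (X v \<otimes> X u)" using gb_commutation assms by blast
  have Xu: "X u \<in> carrier A" and Xv: "X v \<in> carrier A" using assms gb_closed by auto
  have pow: "X u [^] n \<otimes> X v = (b ^ n) \<odot> (X v \<otimes> X u [^] n)" for n :: nat
  proof (induction n)
    case 0
    then show ?case using Xu Xv by simp
  next
    case (Suc n)
    have "X u [^] Suc n \<otimes> X v = X u [^] n \<otimes> (X u \<otimes> X v)" using Xu Xv by (simp add: m_assoc)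
    also have "\<dots> = b \<odot> ((X u [^] n \<otimes> X v) \<otimes> X u)"
      using Xu Xv b(2) by (simp add: smult_mult_right m_assoc)
    also have "\<dots> = (b ^ Suc n) \<odot> (X v \<otimes> X u [^] Suc n)"
      using Xu Xv Suc by (simp add: smult_mult_left smult_smult m_assoc)
    finally show ?case .
  qed
  obtain N :: nat where "N > 0" "u [^]\<^bsub>T\<^esub> N = \<one>\<^bsub>T\<^esub>"
    using T.finite_order_elem[OF gb_finite assms(1)] by blast
  then obtain r where "X u [^] N = r \<odot> X \<one>\<^bsub>T\<^esub>" using gb_pow[OF assms(1), of N] by auto
  moreover obtain c where "X \<one>\<^bsub>T\<^esub> = c \<odot> \<one>" using gb_one by blast
  ultimately have N: "X u [^] N = (r * c) \<odot> \<one>" by (simp add: smult_smult)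
  have "X u [^] N \<in> Units A" using gb_Units[OF assms(1)] by (rule Units_nat_pow_closed)
  then have "(r * c) \<odot> \<one> \<noteq> \<zero>" unfolding N by (rule Units_nonzero[OF nontriv])
  then have "r * c \<noteq> 0" by auto
  have "(r * c) \<odot> X v = ((b ^ N) * (r * c)) \<odot> X v"
    using pow[of N] Xv unfolding N by (simp add: smult_mult_left smult_mult_right smult_smult)
  then have "r * c = (b ^ N) * (r * c)"
    using smult_right_cancel[OF Xv gb_nonzero[OF assms(2)]] by blast
  then have "b ^ N = 1" using \<open>r * c \<noteq> 0\<close> by simp
  then have "\<bar>b\<bar> ^ N = 1" by (metis abs_one power_abs)
  then have "\<bar>b\<bar> = 1" using \<open>N > 0\<close> power_eq_imp_eq_base[of "\<bar>b\<bar>" N 1] by simp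
  then show ?thesis using b by (intro exI[of _ b]) linarith
qed

lemma gb_central:
  assumes z: "z \<in> carrier A" and c: "\<And>v. v \<in> carrier T \<Longrightarrow> z \<otimes> X v = X v \<otimes> z" and x: "x \<in> carrier A"
  shows "z \<otimes> x = x \<otimes> z"
proof -
  obtain a where a: "x = (\<Oplus>t\<in>carrier T. a t \<odot> X t)"
    using gb x unfolding graded_basis_def spans_def by blast
  have "x \<otimes> z = z \<otimes> x" unfolding a
    by (rule finsum_commute_elem)
      (use z gb_closed c in \<open>auto simp: smult_mult_left smult_mult_right\<close>)
  then show ?thesis by simp
qed

text \<open>Commutation factors are signs, so moving \<open>X v\<close> past \<open>X u\<close>
  twice costs nothing: the square of \<open>X u\<close> is central, hence a scalar, and its degree
  can only be the identity.\<close>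

lemma gb_square:
  assumes cen: "central_algebra A" and u: "u \<in> carrier T"
  shows "\<exists>r. r \<noteq> 0 \<and> X u \<otimes> X u = r \<odot> \<one>" "u \<otimes>\<^bsub>T\<^esub> u = \<one>\<^bsub>T\<^esub>"
proof -
  have Xu: "X u \<in> carrier A" using u gb_closed by auto
  have "X u \<otimes> X u \<otimes> X v = X v \<otimes> (X u \<otimes> X u)" if v: "v \<in> carrier T" for v
  proof -
    obtain b where b: "b = 1 \<or> b = - 1" "X u \<otimes> X v = b \<odot> (X v \<otimes> X u)"
      using gb_commutation_sign u v by blast
    have Xv: "X v \<in> carrier A" using v gb_closed by auto
    have "X u \<otimes> X u \<otimes> X v = X u \<otimes> (b \<odot> (X v \<otimes> X u))" using Xu Xv b(2) by (simp add: m_assoc)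
    also have "\<dots> = b \<odot> ((X u \<otimes> X v) \<otimes> X u)" using Xu Xv by (simp add: m_assoc smult_mult_right)
    also have "\<dots> = (b * b) \<odot> (X v \<otimes> (X u \<otimes> X u))"
      using Xu Xv unfolding b(2) by (simp add: m_assoc smult_mult_left smult_smult)
    also have "b * b = 1" using b(1) by auto
    finally show ?thesis using Xu Xv by simp
  qed
  then obtain r where r: "X u \<otimes> X u = r \<odot> \<one>"
    using cen gb_central[of "X u \<otimes> X u"] Xu unfolding central_algebra_def by (meson m_closed)
  have "X u \<otimes> X u \<noteq> \<zero>"
    by (intro Units_nonzero[OF nontriv] Units_m_closed gb_Units u)
  then have "r \<noteq> 0" using r by auto
  with r show "\<exists>r. r \<noteq> 0 \<and> X u \<otimes> X u = r \<odot> \<one>" by blast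
  obtain c where c: "c \<noteq> 0" "X u \<otimes> X u = c \<odot> X (u \<otimes>\<^bsub>T\<^esub> u)" using gb_mult u by blast
  obtain e where e: "e \<noteq> 0" "X \<one>\<^bsub>T\<^esub> = e \<odot> \<one>" using gb_one by blast
  show "u \<otimes>\<^bsub>T\<^esub> u = \<one>\<^bsub>T\<^esub>"
  proof (rule ccontr)
    \<comment> \<open>Otherwise the square of \<open>X u\<close> has two expansions, one supported
      at the identity and one at \<open>u \<otimes> u\<close>.\<close>
    assume ne: "u \<otimes>\<^bsub>T\<^esub> u \<noteq> \<one>\<^bsub>T\<^esub>"
    have ind: "indep A X (carrier T)" using gb by (simp add: graded_basis_def)
    have \<open>(\<Oplus>t\<in>carrier T. (if t = \<one>\<^bsub>T\<^esub> then r * inverse e else 0) \<odot> X t)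
      = (\<Oplus>t\<in>carrier T. (if t = u \<otimes>\<^bsub>T\<^esub> u then c else 0) \<odot> X t)\<close> (is "?l = ?r")
    proof -
      have "?l = (r * inverse e) \<odot> X \<one>\<^bsub>T\<^esub>"
        by (subst finsum_single[where p = "\<one>\<^bsub>T\<^esub>"]) (use gb_finite gb_closed in auto)
      also have "\<dots> = c \<odot> X (u \<otimes>\<^bsub>T\<^esub> u)" using r c e by (simp add: smult_smult mult.assoc)
      also have "\<dots> = ?r"
        by (subst finsum_single[where p = "u \<otimes>\<^bsub>T\<^esub> u"]) (use gb_finite gb_closed u in auto)
      finally show ?thesis .
    qed
    from indep_unique[OF ind this T.one_closed] show False using ne e(1) \<open>r \<noteq> 0\<close> by auto
  qed
qed

lemma gb_sign_basis:
  assumes cen: "central_algebra A"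
  shows "\<exists>\<mu> Y. sign_basis T A \<mu> Y \<and> (\<forall>t\<in>carrier T. line A (Y t) = line A (X t))"
proof -
  have "\<forall>t\<in>carrier T. \<exists>r. r \<noteq> 0 \<and> X t \<otimes> X t = r \<odot> \<one>" using gb_square(1)[OF cen] by blast
  then obtain r where r: "\<And>t. t \<in> carrier T \<Longrightarrow> r t \<noteq> 0 \<and> X t \<otimes> X t = r t \<odot> \<one>" by metis
  \<comment> \<open>Scaling by \<open>s\<close> multiplies the square by \<open>s * s\<close>, which
    is positive; the absolute value of \<open>r t\<close> can be removed but not its sign.\<close>
  define s where "s t = inverse (sqrt \<bar>r t\<bar>)" for t
  have s: "s t \<noteq> 0" "s t * s t * r t = sgn (r t)" if "t \<in> carrier T" for t
  proof -
    have "s t * s t = inverse \<bar>r t\<bar>" by (simp add: s_def flip: inverse_mult_distrib real_sqrt_mult)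
    then show "s t * s t * r t = sgn (r t)" using r[OF that] by (simp add: real_sgn_eq divide_inverse)
    show "s t \<noteq> 0" using r[OF that] by (simp add: s_def)
  qed
  define Y where "Y t = s t \<odot> X t" for t
  define \<mu> where "\<mu> = (\<lambda>t\<in>carrier T. sgn (r t))"
  have ind: "indep A X (carrier T)" and sp: "spans A X (carrier T)"
    using gb by (auto simp: graded_basis_def)
  have Yc: "Y t \<in> carrier A" if "t \<in> carrier T" for t using that gb_closed by (simp add: Y_def)
  have "indep A Y (carrier T)"
    unfolding indep_def
  proof (intro conjI allI impI ballI)
    fix c t assume c: "(\<Oplus>i\<in>carrier T. c i \<odot> Y i) = \<zero>" and t: "t \<in> carrier T"
    have "(\<Oplus>i\<in>carrier T. (c i * s i) \<odot> X i) = (\<Oplus>i\<in>carrier T. c i \<odot> Y i)"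
      using gb_closed by (intro finsum_cong') (auto simp: Y_def smult_smult)
    then have "c t * s t = 0" using indepD[OF ind _ t, of "\<lambda>i. c i * s i"] c by simp
    then show "c t = 0" using s(1)[OF t] by simp
  qed (use gb_finite Yc in auto)
  moreover have "spans A Y (carrier T)" using indep_imp_spans[OF sp calculation] by simp
  moreover have "Y t \<in> Units A" if "t \<in> carrier T" for t
    using smult_Units[OF gb_Units[OF that] s(1)[OF that]] by (simp add: Y_def)
  moreover have "\<exists>c. Y u \<otimes> Y v = c \<odot> Y (u \<otimes>\<^bsub>T\<^esub> v)" if "u \<in> carrier T" "v \<in> carrier T" for u v
  proof -
    obtain c where "X u \<otimes> X v = c \<odot> X (u \<otimes>\<^bsub>T\<^esub> v)"
      using gb_mult[OF \<open>u \<in> carrier T\<close> \<open>v \<in> carrier T\<close>] by blast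
    then have "Y u \<otimes> Y v = (s u * s v * c * inverse (s (u \<otimes>\<^bsub>T\<^esub> v))) \<odot> Y (u \<otimes>\<^bsub>T\<^esub> v)"
      using that gb_closed s(1)[of "u \<otimes>\<^bsub>T\<^esub> v"]
      by (simp add: Y_def smult_mult_left smult_mult_right smult_smult ac_simps)
    then show ?thesis by blast
  qed
  moreover have "Y t \<otimes> Y t = \<mu> t \<odot> \<one>" if "t \<in> carrier T" for t
  proof -
    have "Y t \<otimes> Y t = (s t * s t) \<odot> (X t \<otimes> X t)"
      using gb_closed[OF that] by (simp add: Y_def smult_mult_left smult_mult_right smult_smult)
    also have "\<dots> = (s t * s t * r t) \<odot> \<one>" using r[OF that] by (simp add: smult_smult)
    finally show ?thesis using s(2)[OF that] that by (simp add: \<mu>_def)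
  qed
  moreover have "\<mu> \<in> carrier T \<rightarrow>\<^sub>E {1, -1}"
    using r by (auto simp: \<mu>_def sgn_if)
  ultimately have "sign_basis T A \<mu> Y"
    using gb by (auto simp: sign_basis_def graded_basis_def)
  moreover have "line A (Y t) = line A (X t)" if "t \<in> carrier T" for t
    using line_eqI[OF gb_closed[OF that]] smult_in_line[of "s t" "X t"] s(1)[OF that]
      smult_eq_zero_iff[OF gb_closed[OF that]] gb_nonzero[OF that] by (simp add: Y_def)
  ultimately show ?thesis by blast
qed

end

text \<open>The square of \<open>X u \<otimes> X v\<close> is computed twice. With the product equal
  to \<open>c \<odot> X (u \<otimes> v)\<close> it is \<open>c * c * \<mu> (u \<otimes> v)\<close>;
  exchanging the two middle factors gives \<open>b * (\<mu> u * \<mu> v)\<close>. Since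
  \<open>c * c\<close> is positive and the rest are signs, \<open>b\<close> is the
  polarization.\<close>

lemma sign_basis_commutation:
  assumes sb: "sign_basis T A \<mu> X" and nontriv: "\<one> \<noteq> \<zero>" and uv: "u \<in> carrier T" "v \<in> carrier T"
  shows "X u \<otimes> X v = polarization T \<mu> u v \<odot> (X v \<otimes> X u)"
    and "polarization T \<mu> u v = 1 \<or> polarization T \<mu> u v = - 1"
proof -
  have gb: "graded_basis T A X" and mu: "\<And>t. t \<in> carrier T \<Longrightarrow> \<mu> t = 1 \<or> \<mu> t = - 1"
    and sq: "\<And>t. t \<in> carrier T \<Longrightarrow> X t \<otimes> X t = \<mu> t \<odot> \<one>"
    using sb by (auto simp: sign_basis_def)
  interpret T: comm_group T using gb by (simp add: graded_basis_def)
  note gb_closed = gb_closed[OF gb nontriv] and gb_mult = gb_mult[OF gb nontriv]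
    and gb_commutation_sign = gb_commutation_sign[OF gb nontriv]
  have X: "X u \<in> carrier A" "X v \<in> carrier A" using uv gb_closed by auto
  obtain b where b: "b = 1 \<or> b = - 1" "X u \<otimes> X v = b \<odot> (X v \<otimes> X u)"
    using gb_commutation_sign uv by blast
  obtain c where c: "c \<noteq> 0" "X u \<otimes> X v = c \<odot> X (u \<otimes>\<^bsub>T\<^esub> v)" using gb_mult uv by blast
  have bb: "b * b = 1" using b(1) by auto
  have vu: "X v \<otimes> X u = b \<odot> (X u \<otimes> X v)"
    using X bb unfolding b(2) by (simp add: smult_smult)
  have "(X u \<otimes> X v) \<otimes> (X u \<otimes> X v) = (c * c) \<odot> (X (u \<otimes>\<^bsub>T\<^esub> v) \<otimes> X (u \<otimes>\<^bsub>T\<^esub> v))"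
    unfolding c(2) using uv gb_closed by (simp add: smult_mult_left smult_mult_right smult_smult)
  also have "\<dots> = (c * c * \<mu> (u \<otimes>\<^bsub>T\<^esub> v)) \<odot> \<one>" using sq uv by (simp add: smult_smult)
  finally have 1: "(X u \<otimes> X v) \<otimes> (X u \<otimes> X v) = (c * c * \<mu> (u \<otimes>\<^bsub>T\<^esub> v)) \<odot> \<one>" .
  have "(X u \<otimes> X v) \<otimes> (X u \<otimes> X v) = X u \<otimes> (X v \<otimes> X u) \<otimes> X v" using X by (simp add: m_assoc)
  also have "\<dots> = b \<odot> ((X u \<otimes> X u) \<otimes> (X v \<otimes> X v))"
    unfolding vu using X by (simp add: m_assoc smult_mult_left smult_mult_right)
  also have "\<dots> = (b * (\<mu> u * \<mu> v)) \<odot> \<one>"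
    using sq uv by (simp add: smult_mult_left smult_mult_right smult_smult ac_simps)
  finally have "c * c * \<mu> (u \<otimes>\<^bsub>T\<^esub> v) = b * (\<mu> u * \<mu> v)"
    using 1 smult_right_cancel[OF one_closed nontriv] by metis
  moreover have "c * c > 0" using c(1) by (auto simp: zero_less_mult_iff linorder_neq_iff)
  moreover have "\<mu> (u \<otimes>\<^bsub>T\<^esub> v) = 1 \<or> \<mu> (u \<otimes>\<^bsub>T\<^esub> v) = - 1" using mu uv by simp
  ultimately have "polarization T \<mu> u v = b"
    using mu[OF uv(1)] mu[OF uv(2)] b(1) unfolding polarization_def by (elim disjE) (simp_all)
  then show "X u \<otimes> X v = polarization T \<mu> u v \<odot> (X v \<otimes> X u)"
    "polarization T \<mu> u v = 1 \<or> polarization T \<mu> u v = - 1" using b by auto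
qed

text \<open>Moving \<open>X w\<close> past \<open>X u \<otimes> X v\<close> one factor at a time
  makes the commutation sign multiplicative. For \<open>t\<close> in the radical \<open>X t\<close>
  is central, hence scalar, and independence of the basis leaves only the identity for
  \<open>t\<close>.\<close>

lemma sign_basis_quadratic:
  assumes sb: "sign_basis T A \<mu> X" and nontriv: "\<one> \<noteq> \<zero>" and cen: "central_algebra A"
  shows "\<mu> \<in> quadratic_forms T" "type_I T (polarization T \<mu>)"
proof -
  have gb: "graded_basis T A X" and mu: "\<And>t. t \<in> carrier T \<Longrightarrow> \<mu> t = 1 \<or> \<mu> t = - 1"
    and sq: "\<And>t. t \<in> carrier T \<Longrightarrow> X t \<otimes> X t = \<mu> t \<odot> \<one>" and muE: "\<mu> \<in> carrier T \<rightarrow>\<^sub>E {1, - 1}"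
    using sb by (auto simp: sign_basis_def)
  interpret T: comm_group T using gb by (simp add: graded_basis_def)
  note gb_closed = gb_closed[OF gb nontriv] and gb_mult = gb_mult[OF gb nontriv]
    and gb_one = gb_one[OF gb nontriv] and gb_nonzero = gb_nonzero[OF gb nontriv]
    and gb_square = gb_square[OF gb nontriv cen]
  let ?\<beta> = "polarization T \<mu>"
  note comm = sign_basis_commutation[OF sb nontriv]
  have left: "?\<beta> (u \<otimes>\<^bsub>T\<^esub> v) w = ?\<beta> u w * ?\<beta> v w"
    if "u \<in> carrier T" "v \<in> carrier T" "w \<in> carrier T" for u v w
  proof -
    have X: "X u \<in> carrier A" "X v \<in> carrier A" "X w \<in> carrier A" "X (u \<otimes>\<^bsub>T\<^esub> v) \<in> carrier A"
      using that gb_closed by auto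
    obtain c where c: "c \<noteq> 0" "X u \<otimes> X v = c \<odot> X (u \<otimes>\<^bsub>T\<^esub> v)"
      using gb_mult[OF \<open>u \<in> carrier T\<close> \<open>v \<in> carrier T\<close>] by blast
    have "(X u \<otimes> X v) \<otimes> X w = X u \<otimes> (?\<beta> v w \<odot> (X w \<otimes> X v))"
      using comm(1)[of v w] that X by (simp add: m_assoc)
    also have "\<dots> = ?\<beta> v w \<odot> ((X u \<otimes> X w) \<otimes> X v)" using X by (simp add: m_assoc smult_mult_right)
    also have "\<dots> = (?\<beta> u w * ?\<beta> v w) \<odot> (X w \<otimes> (X u \<otimes> X v))"
      using comm(1)[of u w] that X by (simp add: m_assoc smult_mult_left smult_smult mult.commute)
    also have "\<dots> = (?\<beta> u w * ?\<beta> v w * c) \<odot> (X w \<otimes> X (u \<otimes>\<^bsub>T\<^esub> v))"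
      unfolding c(2) using X by (simp add: smult_mult_right smult_smult)
    finally have 1: "(X u \<otimes> X v) \<otimes> X w = (?\<beta> u w * ?\<beta> v w * c) \<odot> (X w \<otimes> X (u \<otimes>\<^bsub>T\<^esub> v))" .
    have "(X u \<otimes> X v) \<otimes> X w = (c * ?\<beta> (u \<otimes>\<^bsub>T\<^esub> v) w) \<odot> (X w \<otimes> X (u \<otimes>\<^bsub>T\<^esub> v))"
      unfolding c(2) using comm(1)[of "u \<otimes>\<^bsub>T\<^esub> v" w] that X by (simp add: smult_mult_left smult_smult)
    moreover have "X w \<otimes> X (u \<otimes>\<^bsub>T\<^esub> v) \<noteq> \<zero>"
      using that gb_Units[OF gb nontriv] Units_nonzero[OF nontriv Units_m_closed] by simp
    ultimately have "c * ?\<beta> (u \<otimes>\<^bsub>T\<^esub> v) w = ?\<beta> u w * ?\<beta> v w * c"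
      using 1 by (intro smult_right_cancel[of "X w \<otimes> X (u \<otimes>\<^bsub>T\<^esub> v)"]) (use X in simp_all)
    then show ?thesis using c(1) by simp
  qed
  have sym: "?\<beta> u v = ?\<beta> v u" if "u \<in> carrier T" "v \<in> carrier T" for u v
    using that by (simp add: polarization_def T.m_comm)
  have mu1: "\<mu> \<one>\<^bsub>T\<^esub> = 1"
  proof -
    obtain c where c: "c \<noteq> 0" "X \<one>\<^bsub>T\<^esub> = c \<odot> \<one>" using gb_one by blast
    have "\<mu> \<one>\<^bsub>T\<^esub> \<odot> \<one> = (c * c) \<odot> \<one>"
      using sq[of "\<one>\<^bsub>T\<^esub>"] unfolding c(2) by (simp add: smult_mult_left smult_smult)
    then have "\<mu> \<one>\<^bsub>T\<^esub> = c * c" using smult_right_cancel[OF one_closed nontriv] by blast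
    moreover have "c * c > 0" using c(1) by (auto simp: zero_less_mult_iff linorder_neq_iff)
    ultimately show ?thesis using mu[of "\<one>\<^bsub>T\<^esub>"] by auto
  qed
  have "alternating_bicharacter T ?\<beta>"
    unfolding alternating_bicharacter_def
  proof (intro conjI ballI)
    fix u v assume uv: "u \<in> carrier T" "v \<in> carrier T"
    show "?\<beta> u v \<noteq> 0" using comm(2)[OF uv] by auto
    fix w assume w: "w \<in> carrier T"
    show "?\<beta> (u \<otimes>\<^bsub>T\<^esub> v) w = ?\<beta> u w * ?\<beta> v w" using left uv w by blast
    show "?\<beta> u (v \<otimes>\<^bsub>T\<^esub> w) = ?\<beta> u v * ?\<beta> u w" using left[of v w u] sym uv w by simp
  next
    fix u assume u: "u \<in> carrier T"
    show "?\<beta> u u = 1" using gb_square(2)[OF u] mu1 mu[OF u] by (auto simp: polarization_def)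
  qed
  then show "\<mu> \<in> quadratic_forms T" using muE by (simp add: quadratic_forms_def)
  have "t = \<one>\<^bsub>T\<^esub>" if t: "t \<in> carrier T" "\<forall>u\<in>carrier T. ?\<beta> u t = 1" for t
  proof (rule ccontr)
    assume ne: "t \<noteq> \<one>\<^bsub>T\<^esub>"
    have Xt: "X t \<in> carrier A" using t gb_closed by auto
    have "X t \<otimes> X v = X v \<otimes> X t" if "v \<in> carrier T" for v
      using comm(1)[OF t(1) that] t sym[OF t(1) that] that gb_closed by simp
    then obtain r where r: "X t = r \<odot> \<one>"
      using cen gb_central[OF gb nontriv Xt] Xt unfolding central_algebra_def by blast
    obtain c where c: "c \<noteq> 0" "X \<one>\<^bsub>T\<^esub> = c \<odot> \<one>" using gb_one by blast
    have ind: "indep A X (carrier T)" using gb by (simp add: graded_basis_def)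
    then have fin: "finite (carrier T)" by (rule indep_finite)
    have \<open>(\<Oplus>s\<in>carrier T. (if s = \<one>\<^bsub>T\<^esub> then r else 0) \<odot> X s)
      = (\<Oplus>s\<in>carrier T. (if s = t then c else 0) \<odot> X s)\<close> (is "?l = ?r")
    proof -
      have "?l = r \<odot> X \<one>\<^bsub>T\<^esub>"
        by (subst finsum_single[where p = "\<one>\<^bsub>T\<^esub>"]) (use fin gb_closed in auto)
      also have "\<dots> = c \<odot> X t" using r c by (simp add: smult_smult mult.commute)
      also have "\<dots> = ?r"
        by (subst finsum_single[where p = t]) (use fin gb_closed t in auto)
      finally show ?thesis .
    qed
    from indep_unique[OF ind this t(1)] have "c = 0" using ne by simp
    then show False using c(1) by simp
  qed
  moreover have "?\<beta> u \<one>\<^bsub>T\<^esub> = 1" if "u \<in> carrier T" for u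
    using mu1 mu[OF that] that by (auto simp: polarization_def)
  ultimately show "type_I T ?\<beta>" by (auto simp: type_I_def bichar_radical_def)
qed

end

section \<open>Ordered products and the standard group\<close>

text \<open>One fold for the commutative group \<open>T\<close> and for a noncommutative algebra,
  where the order of the factors counts.\<close>

primrec oprod :: "('a, 'b) monoid_scheme \<Rightarrow> (nat \<Rightarrow> 'a) \<Rightarrow> nat \<Rightarrow> 'a" where
  "oprod M f 0 = \<one>\<^bsub>M\<^esub>"
| "oprod M f (Suc n) = oprod M f n \<otimes>\<^bsub>M\<^esub> f n"

lemma oprod_cong: "(\<And>i. i < n \<Longrightarrow> f i = g i) \<Longrightarrow> oprod M f n = oprod M g n"
  by (induction n) auto

context monoid
begin

lemma oprod_closed: "(\<And>i. i < n \<Longrightarrow> f i \<in> carrier G) \<Longrightarrow> oprod G f n \<in> carrier G"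
  by (induction n) auto

lemma oprod_commute:
  assumes "\<And>i. i < n \<Longrightarrow> f i \<in> carrier G" "y \<in> carrier G" "\<And>i. i < n \<Longrightarrow> f i \<otimes> y = y \<otimes> f i"
  shows "oprod G f n \<otimes> y = y \<otimes> oprod G f n"
  using assms(1,3)
proof (induction n)
  case (Suc n)
  have F: "oprod G f n \<in> carrier G" "f n \<in> carrier G" using Suc.prems oprod_closed[of n f] by auto
  have "oprod G f (Suc n) \<otimes> y = oprod G f n \<otimes> (f n \<otimes> y)" using F assms(2) by (simp add: m_assoc)
  also have "\<dots> = (oprod G f n \<otimes> y) \<otimes> f n" using F assms(2) Suc.prems(2)[of n] by (simp add: m_assoc)
  also have "\<dots> = y \<otimes> oprod G f (Suc n)" using F assms(2) Suc by (simp add: m_assoc)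
  finally show ?case .
qed (use assms(2) in simp)

text \<open>Commutation is required only between different slots: in an algebra the two factors of
  one slot may anticommute.\<close>

lemma oprod_mult:
  assumes "\<And>i. i < n \<Longrightarrow> f i \<in> carrier G" "\<And>i. i < n \<Longrightarrow> g i \<in> carrier G"
    and "\<And>i j. i < n \<Longrightarrow> j < n \<Longrightarrow> i \<noteq> j \<Longrightarrow> g i \<otimes> f j = f j \<otimes> g i"
  shows "oprod G (\<lambda>i. f i \<otimes> g i) n = oprod G f n \<otimes> oprod G g n"
  using assms
proof (induction n)
  case (Suc n)
  have F: "oprod G f n \<in> carrier G" "f n \<in> carrier G" "oprod G g n \<in> carrier G" "g n \<in> carrier G"
    using Suc.prems oprod_closed[of n f] oprod_closed[of n g] by auto
  have c: "oprod G g n \<otimes> f n = f n \<otimes> oprod G g n"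
    using Suc.prems F by (intro oprod_commute) auto
  have "oprod G (\<lambda>i. f i \<otimes> g i) (Suc n) = oprod G f n \<otimes> ((oprod G g n \<otimes> f n) \<otimes> g n)"
    using Suc F by (simp add: m_assoc)
  also have "\<dots> = oprod G f (Suc n) \<otimes> oprod G g (Suc n)"
    unfolding c using F by (simp add: m_assoc)
  finally show ?case .
qed simp

end

text \<open>The product of the two generators of a plane that has degree \<open>g\<close>. In
  \<open>T\<close> such words give coordinates, in an algebra they give homogeneous basis
  elements.\<close>

definition word :: "('a, 'b) monoid_scheme \<Rightarrow> 'a \<Rightarrow> 'a \<Rightarrow> int \<times> int \<Rightarrow> 'a" where
  "word M x y g =
     (if fst g = 1 then x else \<one>\<^bsub>M\<^esub>) \<otimes>\<^bsub>M\<^esub> (if snd g = 1 then y else \<one>\<^bsub>M\<^esub>)"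

lemma (in monoid) word_closed: "x \<in> carrier G \<Longrightarrow> y \<in> carrier G \<Longrightarrow> word G x y g \<in> carrier G"
  by (simp add: word_def)

text \<open>The symplectic form of the plane over the field with two elements, written
  multiplicatively. It is the commutation sign of components of degrees \<open>g\<close> and
  \<open>h\<close> in either standard factor.\<close>

definition pair_sign :: "int \<times> int \<Rightarrow> int \<times> int \<Rightarrow> real" where
  "pair_sign g h = (if odd (fst g * snd h + snd g * fst h) then - 1 else 1)"

text \<open>The signs of the squares in one factor. For \<open>s\<close> = 1 this is the hyperbolic
  plane, belonging to M_2(\<real>); for \<open>s\<close> = -1 it is the anisotropic plane, with
  value -1 at every nontrivial degree, belonging to \<bbbH>.\<close>

definition form_sign :: "real \<Rightarrow> int \<times> int \<Rightarrow> real" where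
  "form_sign s g = (if fst g = 1 then s else 1) * (if snd g = 1 then s else 1) * (if g = (1, 1) then - 1 else 1)"

text \<open>The sign of the squares of the degree \<open>a\<close> and degree \<open>b\<close> generators of the \<open>i\<close>-th
  standard factor.\<close>

definition factor_sign :: "nat \<Rightarrow> nat \<Rightarrow> real" where
  "factor_sign m i = (if i < m - 1 then 1 else - 1)"

lemma factor_sign_cases: "factor_sign m i = 1 \<or> factor_sign m i = - 1"
  by (simp add: factor_sign_def)

lemma factor_sign_square: "factor_sign m i * factor_sign m i = 1"
  by (simp add: factor_sign_def)

lemma carrier_Z2_squared: "carrier Z2_squared = {0, 1} \<times> {0, 1}"
  by (auto simp: Z2_squared_def carrier_integer_mod_group)

lemma mult_Z2_squared:
  "g \<otimes>\<^bsub>Z2_squared\<^esub> h = ((fst g + fst h) mod 2, (snd g + snd h) mod 2)"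
  by (simp add: Z2_squared_def DirProd_def case_prod_unfold)

lemma Z2_squared_group: "comm_group Z2_squared"
  unfolding Z2_squared_def
  by (rule group.group_comm_groupI) (auto simp: DirProd_group add.commute)

lemma one_Z2_squared: "\<one>\<^bsub>Z2_squared\<^esub> = (0, 0)"
  by (simp add: Z2_squared_def)

lemma carrier_standard_group: "carrier (standard_group m) = (\<Pi>\<^sub>E i\<in>{..<m}. {0, 1} \<times> {0, 1})"
  by (simp add: standard_group_def carrier_Z2_squared)

lemma mult_standard_group:
  "g \<otimes>\<^bsub>standard_group m\<^esub> h = (\<lambda>i\<in>{..<m}. g i \<otimes>\<^bsub>Z2_squared\<^esub> h i)"
  by (simp add: standard_group_def)

lemma one_standard_group: "\<one>\<^bsub>standard_group m\<^esub> = (\<lambda>i\<in>{..<m}. (0, 0))"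
  by (simp add: standard_group_def one_Z2_squared)

lemma comm_group_standard_group: "comm_group (standard_group m)"
proof (rule group.group_comm_groupI)
  show "group (standard_group m)"
    using Z2_squared_group by (simp add: standard_group_def comm_group.axioms)
  show "x \<otimes>\<^bsub>standard_group m\<^esub> y = y \<otimes>\<^bsub>standard_group m\<^esub> x" for x y
    by (auto simp: mult_standard_group mult_Z2_squared add.commute)
qed

lemma card_standard_group: "card (carrier (standard_group m)) = 4 ^ m"
proof -
  have "card ({0, 1 :: int} \<times> {0, 1 :: int}) = 4" by (simp add: card_cartesian_product)
  then show ?thesis
    by (simp only: carrier_standard_group card_PiE[OF finite_lessThan] prod_constant card_lessThan)
qed

lemma finite_standard_group: "finite (carrier (standard_group m))"
  by (simp add: carrier_standard_group finite_PiE)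

lemma standard_group_component:
  "g \<in> carrier (standard_group m) \<Longrightarrow> i < m \<Longrightarrow> g i \<in> {0, 1} \<times> {0, 1}"
  by (auto simp: carrier_standard_group PiE_iff)

lemma pair_sign_nondegenerate:
  assumes g: "g \<in> carrier (standard_group m)" and ne: "g \<noteq> \<one>\<^bsub>standard_group m\<^esub>"
  shows "\<exists>h\<in>carrier (standard_group m). (\<Prod>i<m. pair_sign (g i) (h i)) = - 1"
proof -
  have "\<exists>i<m. g i \<noteq> (0, 0)"
  proof (rule ccontr)
    assume "\<not> ?thesis"
    then have "g = \<one>\<^bsub>standard_group m\<^esub>"
      using g by (auto simp: carrier_standard_group one_standard_group PiE_iff extensional_def fun_eq_iff)
    then show False using ne by simp
  qed
  then obtain i where i: "i < m" "g i \<noteq> (0, 0)" by blast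
  \<comment> \<open>A degree that pairs with \<open>g i\<close> to -1: b if \<open>g i\<close>
    involves a, and a otherwise.\<close>
  define k :: "int \<times> int" where "k = (if fst (g i) = 1 then (0, 1) else (1, 0))"
  define h where "h = (\<lambda>j\<in>{..<m}. if j = i then k else (0, 0))"
  have "pair_sign (g i) k = - 1"
    using standard_group_component[OF g i(1)] i(2) by (cases "g i") (auto simp: pair_sign_def k_def)
  moreover have "(\<Prod>j<m. pair_sign (g j) (h j)) = (\<Prod>j<m. if j = i then pair_sign (g i) k else 1)"
    by (rule prod.cong) (auto simp: h_def pair_sign_def)
  moreover have "h \<in> carrier (standard_group m)"
    by (auto simp: carrier_standard_group h_def k_def)
  ultimately show ?thesis using i(1) by (intro bexI[of _ h]) (simp_all add: prod.delta)
qed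

section \<open>Classification of quadratic forms\<close>

text \<open>The involution exchanges the two level sets of \<open>\<chi>\<close>, so the sum folds
  onto one of them.\<close>

lemma sum_involution:
  fixes f :: "'a \<Rightarrow> real"
  assumes "finite W" "\<And>w. w \<in> W \<Longrightarrow> s w \<in> W" "\<And>w. w \<in> W \<Longrightarrow> s (s w) = w"
    and "\<And>w. w \<in> W \<Longrightarrow> \<chi> w = 1 \<or> \<chi> w = (- 1 :: real)" "\<And>w. w \<in> W \<Longrightarrow> \<chi> (s w) = - \<chi> w"
  shows "(\<Sum>w\<in>W. f w) = (\<Sum>w\<in>{w \<in> W. \<chi> w = 1}. f w + f (s w))"
proof -
  have "W = {w \<in> W. \<chi> w = 1} \<union> {w \<in> W. \<chi> w = - 1}" using assms(4) by blast
  then have "(\<Sum>w\<in>W. f w) = (\<Sum>w\<in>{w \<in> W. \<chi> w = 1} \<union> {w \<in> W. \<chi> w = - 1}. f w)" by simp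
  also have "\<dots> = (\<Sum>w\<in>{w \<in> W. \<chi> w = 1}. f w) + (\<Sum>w\<in>{w \<in> W. \<chi> w = - 1}. f w)"
    using assms(1) by (intro sum.union_disjoint) auto
  also have "(\<Sum>w\<in>{w \<in> W. \<chi> w = - 1}. f w) = (\<Sum>w\<in>{w \<in> W. \<chi> w = 1}. f (s w))"
    using assms by (intro sum.reindex_bij_witness[of _ s s]) auto
  finally show ?thesis by (simp add: sum.distrib)
qed

text \<open>A symplectic basis adapted to \<open>\<mu>\<close>: all planes are hyperbolic except the
  last, on which \<open>\<mu>\<close> is -1 off the identity. That it generates \<open>T\<close> is
  obtained by counting in \<open>coord_iso\<close>.\<close>

definition symplectic :: "'g monoid \<Rightarrow> ('g \<Rightarrow> real) \<Rightarrow> nat \<Rightarrow> (nat \<Rightarrow> 'g) \<Rightarrow> (nat \<Rightarrow> 'g) \<Rightarrow> bool" where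
  "symplectic T \<mu> m u v \<longleftrightarrow>
     (\<forall>i<m. u i \<in> carrier T \<and> v i \<in> carrier T \<and>
        \<mu> (u i) = factor_sign m i \<and> \<mu> (v i) = factor_sign m i \<and> polarization T \<mu> (u i) (v i) = - 1 \<and>
        (\<forall>j<m. i \<noteq> j \<longrightarrow> polarization T \<mu> (u i) (u j) = 1 \<and> polarization T \<mu> (u i) (v j) = 1 \<and>
           polarization T \<mu> (v i) (v j) = 1))"

locale quad_form = T: comm_group T for T :: "'g monoid" (structure) +
  fixes \<mu> :: "'g \<Rightarrow> real"
  assumes fin: "finite (carrier T)" and qf: "\<mu> \<in> quadratic_forms T"
    and nondeg: "type_I T (polarization T \<mu>)"
begin

abbreviation \<beta> where "\<beta> \<equiv> polarization T \<mu>"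

lemma mu_cases: "t \<in> carrier T \<Longrightarrow> \<mu> t = 1 \<or> \<mu> t = - 1"
  using qf by (auto simp: quadratic_forms_def)

lemma bichar: "alternating_bicharacter T \<beta>"
  using qf by (simp add: quadratic_forms_def)

lemma beta_left: "u \<in> carrier T \<Longrightarrow> v \<in> carrier T \<Longrightarrow> w \<in> carrier T \<Longrightarrow> \<beta> (u \<otimes> v) w = \<beta> u w * \<beta> v w"
  using bichar unfolding alternating_bicharacter_def by blast

lemma beta_right: "u \<in> carrier T \<Longrightarrow> v \<in> carrier T \<Longrightarrow> w \<in> carrier T \<Longrightarrow> \<beta> u (v \<otimes> w) = \<beta> u v * \<beta> u w"
  using bichar unfolding alternating_bicharacter_def by blast

lemma beta_self: "u \<in> carrier T \<Longrightarrow> \<beta> u u = 1"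
  using bichar unfolding alternating_bicharacter_def by blast

lemma beta_cases: "u \<in> carrier T \<Longrightarrow> v \<in> carrier T \<Longrightarrow> \<beta> u v = 1 \<or> \<beta> u v = - 1"
  using mu_cases[of u] mu_cases[of v] mu_cases[of "u \<otimes> v"] by (auto simp: polarization_def)

lemma beta_sym: "u \<in> carrier T \<Longrightarrow> v \<in> carrier T \<Longrightarrow> \<beta> u v = \<beta> v u"
  by (simp add: polarization_def T.m_comm)

lemma mu_mult: "u \<in> carrier T \<Longrightarrow> v \<in> carrier T \<Longrightarrow> \<mu> (u \<otimes> v) = \<mu> u * \<mu> v * \<beta> u v"
  using mu_cases[of u] mu_cases[of v] by (auto simp: polarization_def)

lemma mu_one: "\<mu> \<one> = 1"
  using beta_self[of \<one>] mu_cases[of \<one>] by (auto simp: polarization_def)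

lemma beta_one: "u \<in> carrier T \<Longrightarrow> \<beta> \<one> u = 1" "u \<in> carrier T \<Longrightarrow> \<beta> u \<one> = 1"
  using mu_one mu_cases[of u] by (auto simp: polarization_def)

lemma radical: "t \<in> carrier T \<Longrightarrow> (\<And>u. u \<in> carrier T \<Longrightarrow> \<beta> u t = 1) \<Longrightarrow> t = \<one>"
  using nondeg unfolding type_I_def bichar_radical_def by blast

text \<open>All values of \<open>\<beta>\<close> are signs, so a square pairs trivially with
  everything and lies in the radical.\<close>

lemma square_one: "u \<in> carrier T \<Longrightarrow> u \<otimes> u = \<one>"
  by (rule radical) (use beta_cases beta_right in fastforce)+

lemma cancel: "u \<in> carrier T \<Longrightarrow> w \<in> carrier T \<Longrightarrow> u \<otimes> (u \<otimes> w) = w"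
  using square_one by (simp add: T.m_assoc[symmetric])

text \<open>Multiplication by \<open>v\<close> flips the sign of \<open>\<beta> u\<close>;
  multiplication by \<open>u\<close> flips that of \<open>\<beta> v\<close> and preserves
  \<open>\<beta> u\<close>. Folding the sum twice leaves a sum over cosets of the plane of
  \<open>u\<close> and \<open>v\<close>, represented by its orthogonal complement.\<close>

lemma split_plane:
  fixes f :: "'g \<Rightarrow> real"
  assumes W: "subgroup W T" and u: "u \<in> W" and v: "v \<in> W" and uv: "\<beta> u v = - 1"
  shows "(\<Sum>w\<in>W. f w)
    = (\<Sum>w\<in>{w \<in> W. \<beta> u w = 1 \<and> \<beta> v w = 1}. f w + f (v \<otimes> w) + f (u \<otimes> w) + f (v \<otimes> (u \<otimes> w)))"
proof -
  have WT: "W \<subseteq> carrier T" using W by (rule subgroup.subset)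
  then have uT: "u \<in> carrier T" and vT: "v \<in> carrier T" using u v by auto
  have cl: "u \<otimes> w \<in> W" "v \<otimes> w \<in> W" if "w \<in> W" for w
    using W u v that by (auto intro: subgroup.m_closed)
  have finW: "finite W" using WT fin finite_subset by blast
  have vu: "\<beta> v u = - 1" using uv beta_sym uT vT by simp
  let ?W1 = "{w \<in> W. \<beta> u w = 1}"
  have "(\<Sum>w\<in>W. f w) = (\<Sum>w\<in>?W1. f w + f (v \<otimes> w))"
    using finW cl WT beta_cases[OF uT] uv
    by (intro sum_involution) (auto simp: cancel vT uT beta_right subset_iff)
  also have "\<dots> = (\<Sum>w\<in>{w \<in> ?W1. \<beta> v w = 1}. (f w + f (v \<otimes> w)) + (f (u \<otimes> w) + f (v \<otimes> (u \<otimes> w))))"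
    using finW cl WT beta_cases[OF vT] vu
    by (intro sum_involution) (auto simp: cancel vT uT beta_right beta_self subset_iff)
  also have "{w \<in> ?W1. \<beta> v w = 1} = {w \<in> W. \<beta> u w = 1 \<and> \<beta> v w = 1}" by auto
  finally show ?thesis by (simp add: add.assoc)
qed

text \<open>Each element of \<open>W\<close> becomes orthogonal to \<open>u\<close> and
  \<open>v\<close> after multiplication by an element of their plane. An element \<open>t\<close> of
  the complement does not see this change, so nondegeneracy is inherited. The cardinality is
  \<open>split_plane\<close> for the constant function 1.\<close>

lemma orthogonal_plane:
  assumes W: "subgroup W T" and nd: "\<forall>t\<in>W. (\<forall>w\<in>W. \<beta> w t = 1) \<longrightarrow> t = \<one>"
    and u: "u \<in> W" and v: "v \<in> W" and uv: "\<beta> u v = - 1"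
  defines "W' \<equiv> {w \<in> W. \<beta> u w = 1 \<and> \<beta> v w = 1}"
  shows "subgroup W' T" "\<forall>t\<in>W'. (\<forall>w\<in>W'. \<beta> w t = 1) \<longrightarrow> t = \<one>"
    "card W = 4 * card W'"
proof -
  have WT: "W \<subseteq> carrier T" using W by (rule subgroup.subset)
  have one: "\<one> \<in> W" using W by (rule subgroup.one_closed)
  have cl: "x \<otimes> y \<in> W" if "x \<in> W" "y \<in> W" for x y using W that by (rule subgroup.m_closed)
  have uT: "u \<in> carrier T" and vT: "v \<in> carrier T" using u v WT by auto
  have W'T: "W' \<subseteq> carrier T" "W' \<subseteq> W" using WT by (auto simp: W'_def)
  note split = split_plane[OF W u v uv, folded W'_def]
  show "subgroup W' T"
  proof (rule T.subgroupI)
    show "W' \<subseteq> carrier T" by fact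
    show "W' \<noteq> {}" using one beta_one uT vT by (auto simp: W'_def)
    fix a assume a: "a \<in> W'"
    then have "inv a = a" using W'T square_one by (intro T.inv_equality) auto
    then show "inv a \<in> W'" using a by simp
    fix b assume "b \<in> W'"
    then show "a \<otimes> b \<in> W'" using a cl beta_right uT vT WT by (auto simp: W'_def subset_iff)
  qed
  have "real (card W) = (\<Sum>w\<in>W'. 1 + 1 + 1 + 1)" using split[of "\<lambda>_. 1"] by simp
  then have "real (card W) = real (4 * card W')" by simp
  then show "card W = 4 * card W'" by (simp only: of_nat_eq_iff)
  have "t = \<one>" if t: "t \<in> W'" "\<And>w. w \<in> W' \<Longrightarrow> \<beta> w t = 1" for t
  proof (rule nd[rule_format])
    show "t \<in> W" using t W'T by blast
    have tT: "t \<in> carrier T" using t W'T by blast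
    fix w assume w: "w \<in> W"
    have wT: "w \<in> carrier T" using w WT by blast
    \<comment> \<open>\<open>a\<close> repairs the pairing of \<open>w\<close> with
      \<open>v\<close>, and \<open>b\<close> the one with \<open>u\<close>; both lie in the plane,
      to which \<open>t\<close> is orthogonal.\<close>
    define a where "a = (if \<beta> v w = 1 then \<one> else u)"
    define b where "b = (if \<beta> u w = 1 then \<one> else v)"
    have ab: "a \<in> W" "b \<in> W" "a \<in> carrier T" "b \<in> carrier T"
      using u v one uT vT by (auto simp: a_def b_def)
    have vu: "\<beta> v u = - 1" using uv beta_sym uT vT by simp
    have "a \<otimes> (b \<otimes> w) \<in> W'"
      using ab w wT uT vT cl uv vu beta_cases[OF uT wT] beta_cases[OF vT wT]
      by (auto simp: W'_def beta_right a_def b_def beta_self beta_one)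
    then have "\<beta> (a \<otimes> (b \<otimes> w)) t = 1" using t(2) by blast
    moreover have "\<beta> a t = 1" "\<beta> b t = 1"
      using t(1) beta_one tT by (auto simp: W'_def a_def b_def)
    ultimately show "\<beta> w t = 1" using ab wT tT by (simp add: beta_left)
  qed
  then show "\<forall>t\<in>W'. (\<forall>w\<in>W'. \<beta> w t = 1) \<longrightarrow> t = \<one>" by blast
qed

text \<open>A nontrivial \<open>u\<close> outside the radical has a partner pairing to -1; the plane
  they span is split off, at the cost of a factor 4.\<close>

lemma card_power_four:
  assumes "subgroup W T" "\<forall>t\<in>W. (\<forall>w\<in>W. \<beta> w t = 1) \<longrightarrow> t = \<one>"
  shows "\<exists>j. card W = 4 ^ j"
  using assms
proof (induction "card W" arbitrary: W rule: less_induct)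
  case less
  have WT: "W \<subseteq> carrier T" using less.prems(1) by (rule subgroup.subset)
  have one: "\<one> \<in> W" using less.prems(1) by (rule subgroup.one_closed)
  have finW: "finite W" using WT fin finite_subset by blast
  show ?case
  proof (cases "W = {\<one>}")
    case True
    then show ?thesis by (intro exI[of _ 0]) simp
  next
    case False
    then obtain u where u: "u \<in> W" "u \<noteq> \<one>" using one by blast
    then have "\<exists>v\<in>W. \<beta> v u \<noteq> 1" using less.prems(2) by blast
    then obtain v where v: "v \<in> W" "\<beta> v u = - 1" using beta_cases u WT by blast
    note plane = orthogonal_plane[OF less.prems v(1) u(1) v(2)]
    have "card W > 0" using finW one by (auto simp: card_gt_0_iff)
    then have "card {w \<in> W. \<beta> v w = 1 \<and> \<beta> u w = 1} < card W" using plane(3) by linarith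
    from less.hyps[OF this plane(1,2)] obtain j where "card {w \<in> W. \<beta> v w = 1 \<and> \<beta> u w = 1} = 4 ^ j"
      by blast
    then show ?thesis using plane(3) by (intro exI[of _ "Suc j"]) simp
  qed
qed

text \<open>The negative sum is the form in which the Arf invariant survives the induction: each
  hyperbolic plane that is split off halves it. With only four elements left, it makes the remaining
  plane anisotropic.\<close>

lemma symplectic_exists_aux:
  assumes "subgroup W T" "\<forall>t\<in>W. (\<forall>w\<in>W. \<beta> w t = 1) \<longrightarrow> t = \<one>"
    and "card W = 4 ^ Suc m" "(\<Sum>w\<in>W. \<mu> w) < 0"
  shows "\<exists>u v. symplectic T \<mu> (Suc m) u v \<and> (\<forall>i<Suc m. u i \<in> W \<and> v i \<in> W)"
  using assms
proof (induction m arbitrary: W)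
  case 0
  have WT: "W \<subseteq> carrier T" using 0(1) by (rule subgroup.subset)
  have one: "\<one> \<in> W" using 0(1) by (rule subgroup.one_closed)
  have finW: "finite W" using WT fin finite_subset by blast
  have neg: "\<mu> w = - 1" if w: "w \<in> W" "w \<noteq> \<one>" for w
  proof (rule ccontr)
    assume "\<mu> w \<noteq> - 1"
    then have mw: "\<mu> w = 1" using mu_cases w WT by blast
    \<comment> \<open>The identity and \<open>w\<close> would contribute 2, which the other two
      elements can at best cancel.\<close>
    have "card (W - {\<one>, w}) = 2" using 0(3) finW one w by (simp add: card_Diff_subset)
    then have "(\<Sum>x\<in>W - {\<one>, w}. - 1) = (- 2 :: real)" by simp
    moreover have "(\<Sum>x\<in>W - {\<one>, w}. - 1) \<le> (\<Sum>x\<in>W - {\<one>, w}. \<mu> x)"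
      using mu_cases WT by (intro sum_mono) force
    moreover have "(\<Sum>x\<in>W. \<mu> x) = (\<Sum>x\<in>W - {\<one>, w}. \<mu> x) + (\<Sum>x\<in>{\<one>, w}. \<mu> x)"
      using finW one w by (intro sum.subset_diff) auto
    moreover have "(\<Sum>x\<in>{\<one>, w}. \<mu> x) = 2" using w mw mu_one by simp
    ultimately show False using 0(4) by linarith
  qed
  have "card W > card {\<one>}" using 0(3) by simp
  then obtain u where u: "u \<in> W" "u \<noteq> \<one>"
    by (metis card_mono finite.emptyI finite_insert insertCI linorder_not_less subsetI)
  then have "\<exists>v\<in>W. \<beta> v u \<noteq> 1" using 0(2) by blast
  then obtain v where v: "v \<in> W" "\<beta> v u = - 1" using beta_cases u WT by blast
  then have "v \<noteq> \<one>" using beta_one(1)[of u] u WT by auto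
  then show ?case
    using u v neg beta_sym[of u v] WT
    by (intro exI[of _ "\<lambda>_. u"] exI[of _ "\<lambda>_. v"])
      (auto simp: symplectic_def factor_sign_def)
next
  case (Suc m)
  have WT: "W \<subseteq> carrier T" using Suc.prems(1) by (rule subgroup.subset)
  have one: "\<one> \<in> W" using Suc.prems(1) by (rule subgroup.one_closed)
  have finW: "finite W" using WT fin finite_subset by blast
  have cl: "x \<otimes> y \<in> W" if "x \<in> W" "y \<in> W" for x y using Suc.prems(1) that by (rule subgroup.m_closed)
  \<comment> \<open>\<open>W\<close> has at least 16 elements, so some element avoids any list of at
    most four.\<close>
  have big: "\<exists>x\<in>W. x \<notin> set F" if "length F \<le> 4" for F
  proof (rule ccontr)
    assume "\<not> ?thesis"
    then have "card W \<le> card (set F)" by (intro card_mono) auto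
    also have "\<dots> \<le> length F" by (rule card_length)
    finally have "card W \<le> length F" .
    moreover have "(4 :: nat) ^ m \<ge> 1" by simp
    then have "(4 :: nat) ^ Suc (Suc m) > 4" unfolding power_Suc by linarith
    ultimately show False using Suc.prems(3) that by simp
  qed
  \<comment> \<open>If \<open>\<mu>\<close> were -1 off the identity, any two distinct nontrivial
    elements would pair to -1. Pairing \<open>w\<close> with \<open>u\<close>, \<open>v\<close> and
    \<open>u \<otimes> v\<close> then contradicts multiplicativity.\<close>
  have "\<exists>u\<in>W. u \<noteq> \<one> \<and> \<mu> u = 1"
  proof (rule ccontr)
    assume "\<not> ?thesis"
    then have neg: "\<mu> x = - 1" if "x \<in> W" "x \<noteq> \<one>" for x using mu_cases WT that by blast
    have b: "\<beta> x y = - 1" if "x \<in> W" "y \<in> W" "x \<noteq> \<one>" "y \<noteq> \<one>" "x \<noteq> y" for x y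
    proof -
      have "x \<otimes> y \<noteq> \<one>"
        using cancel[of x y] that WT by (metis T.r_one subsetD)
      then show ?thesis using neg that cl[of x y] by (simp add: polarization_def)
    qed
    obtain u where u: "u \<in> W" "u \<notin> {\<one>}" using big[of "[\<one>]"] by auto
    obtain v where v: "v \<in> W" "v \<notin> {\<one>, u}" using big[of "[\<one>, u]"] by auto
    obtain w where w: "w \<in> W" "w \<notin> {\<one>, u, v, u \<otimes> v}"
      using big[of "[\<one>, u, v, u \<otimes> v]"] by auto
    have "u \<otimes> v \<noteq> \<one>" using cancel[of u v] u v WT by (metis T.r_one insertCI subsetD)
    then have "\<beta> w (u \<otimes> v) = - 1" using b[of w "u \<otimes> v"] w u v cl by auto
    moreover have "\<beta> w (u \<otimes> v) = \<beta> w u * \<beta> w v" using beta_right u v w WT by blast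
    moreover have "\<beta> w u = - 1" "\<beta> w v = - 1" using b u v w by auto
    ultimately show False by simp
  qed
  then obtain u where u: "u \<in> W" "u \<noteq> \<one>" "\<mu> u = 1" by blast
  then have "\<exists>v\<in>W. \<beta> v u \<noteq> 1" using Suc.prems(2) by blast
  then obtain v0 where v0: "v0 \<in> W" "\<beta> v0 u = - 1" using beta_cases u WT by blast
  have uT: "u \<in> carrier T" using u WT by auto
  have "\<exists>v\<in>W. \<beta> u v = - 1 \<and> \<mu> v = 1"
  proof (cases "\<mu> v0 = 1")
    case True
    then show ?thesis using v0 beta_sym[of u v0] uT WT by auto
  next
    case False
    have v0T: "v0 \<in> carrier T" using v0 WT by auto
    have "\<mu> v0 = - 1" using False mu_cases v0T by blast
    moreover have "\<beta> u v0 = - 1" using v0 beta_sym[of u v0] uT v0T by auto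
    \<comment> \<open>Multiplying \<open>v0\<close> by \<open>u\<close> reverses its sign, since
      \<open>\<mu> u = 1\<close> and the two pair to -1; the pairing with \<open>u\<close> is
      kept.\<close>
    ultimately have "\<mu> (u \<otimes> v0) = 1" "\<beta> u (u \<otimes> v0) = - 1"
      using mu_mult[of u v0] beta_right[of u u v0] beta_self[of u] u uT v0T by auto
    then show ?thesis using cl u v0 by blast
  qed
  then obtain v where v: "v \<in> W" "\<beta> u v = - 1" "\<mu> v = 1" by blast
  have vT: "v \<in> carrier T" using v WT by auto
  define W' where "W' = {w \<in> W. \<beta> u w = 1 \<and> \<beta> v w = 1}"
  have W'T: "W' \<subseteq> carrier T" "W' \<subseteq> W" using WT by (auto simp: W'_def)
  note split = split_plane[OF Suc.prems(1) u(1) v(1,2), folded W'_def]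
  note plane = orthogonal_plane[OF Suc.prems(1,2) u(1) v(1,2), folded W'_def]
  have card: "card W' = 4 ^ Suc m" using plane(3) Suc.prems(3) by simp
  \<comment> \<open>On a coset of the plane \<open>\<mu>\<close> takes the value
    \<open>\<mu> w\<close> three times and its negative once.\<close>
  have "(\<Sum>w\<in>W. \<mu> w) = (\<Sum>w\<in>W'. 2 * \<mu> w)"
    unfolding split
  proof (rule sum.cong)
    fix w assume w: "w \<in> W'"
    then have wT: "w \<in> carrier T" and b: "\<beta> u w = 1" "\<beta> v w = 1" using W'T by (auto simp: W'_def)
    have vu: "\<beta> v u = - 1" using v(2) beta_sym uT vT by simp
    show "\<mu> w + \<mu> (v \<otimes> w) + \<mu> (u \<otimes> w) + \<mu> (v \<otimes> (u \<otimes> w)) = 2 * \<mu> w"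
      using wT uT vT b vu u(3) v(3) by (simp add: mu_mult beta_right)
  qed simp
  then have neg': "(\<Sum>w\<in>W'. \<mu> w) < 0" using Suc.prems(4) by (simp add: sum_distrib_left[symmetric])
  obtain p q where pq: "symplectic T \<mu> (Suc m) p q" "\<forall>i<Suc m. p i \<in> W' \<and> q i \<in> W'"
    using Suc.IH[OF plane(1,2) card neg'] by blast
  \<comment> \<open>The new hyperbolic plane goes to the front, so that the exceptional plane keeps
    the last index.\<close>
  define p' where "p' = case_nat u p"
  define q' where "q' = case_nat v q"
  have perp: "\<beta> u x = 1" "\<beta> v x = 1" "\<beta> x u = 1" "\<beta> x v = 1" if "x \<in> W'" for x
    using that beta_sym[of x u] beta_sym[of x v] uT vT W'T by (auto simp: W'_def)
  have fs: "factor_sign (Suc (Suc m)) (Suc i) = factor_sign (Suc m) i" for i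
    by (simp add: factor_sign_def)
  have fs0: "factor_sign (Suc (Suc m)) 0 = 1" by (simp add: factor_sign_def)
  have "symplectic T \<mu> (Suc (Suc m)) p' q'"
    unfolding symplectic_def
  proof (intro allI impI conjI)
    fix i assume i: "i < Suc (Suc m)"
    show "p' i \<in> carrier T" "q' i \<in> carrier T"
      using i pq(1) uT vT by (auto simp: p'_def q'_def symplectic_def split: nat.split)
    show "\<mu> (p' i) = factor_sign (Suc (Suc m)) i"
      using i pq(1) u(3) by (cases i) (auto simp: p'_def symplectic_def fs fs0)
    show "\<mu> (q' i) = factor_sign (Suc (Suc m)) i"
      using i pq(1) v(3) by (cases i) (auto simp: q'_def symplectic_def fs fs0)
    show "\<beta> (p' i) (q' i) = - 1"
      using i pq(1) v(2) by (cases i) (auto simp: p'_def q'_def symplectic_def)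
    fix j assume j: "j < Suc (Suc m)" "i \<noteq> j"
    show "\<beta> (p' i) (p' j) = 1"
      using i j pq perp by (cases i; cases j) (auto simp: p'_def symplectic_def)
    show "\<beta> (p' i) (q' j) = 1"
      using i j pq perp by (cases i; cases j) (auto simp: p'_def q'_def symplectic_def)
    show "\<beta> (q' i) (q' j) = 1"
      using i j pq perp by (cases i; cases j) (auto simp: q'_def symplectic_def)
  qed
  moreover have "\<forall>i<Suc (Suc m). p' i \<in> W \<and> q' i \<in> W"
    using pq(2) u v W'T by (auto simp: p'_def q'_def split: nat.split)
  ultimately show ?case by blast
qed

lemma symplectic_exists:
  assumes "m \<ge> 1" "card (carrier T) = 4 ^ m" "arf_invariant (carrier T) \<mu> = - 1"
  shows "\<exists>u v. symplectic T \<mu> m u v"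
proof -
  let ?P = "{t \<in> carrier T. \<mu> t = 1}" and ?N = "{t \<in> carrier T. \<mu> t = - 1}"
  have "(\<Sum>t\<in>carrier T. \<mu> t) = (\<Sum>t\<in>?P \<union> ?N. \<mu> t)"
    using mu_cases by (intro sum.cong) auto
  also have "\<dots> = (\<Sum>t\<in>?P. \<mu> t) + (\<Sum>t\<in>?N. \<mu> t)"
    using fin by (intro sum.union_disjoint) auto
  also have "\<dots> = real (card ?P) - real (card ?N)" by simp
  finally have "(\<Sum>t\<in>carrier T. \<mu> t) < 0"
    using assms(3) by (auto simp: arf_invariant_def sgn_if split: if_splits)
  moreover obtain k where "m = Suc k" using assms(1) by (cases m) auto
  ultimately show ?thesis
    using symplectic_exists_aux[OF T.subgroup_self, of k] assms(2) radical by blast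
qed

section \<open>Coordinates with respect to a symplectic basis\<close>

context
  fixes m u v
  assumes symp: "symplectic T \<mu> m u v"
begin

definition coord where
  "coord g = oprod T (\<lambda>i. word T (u i) (v i) (g i)) m"

lemma symp_closed: "i < m \<Longrightarrow> u i \<in> carrier T" "i < m \<Longrightarrow> v i \<in> carrier T"
  using symp by (auto simp: symplectic_def)

lemma word_symp_closed: "i < m \<Longrightarrow> word T (u i) (v i) g \<in> carrier T"
  by (simp add: T.word_closed symp_closed)

lemma coord_closed: "coord g \<in> carrier T"
  unfolding coord_def by (rule T.oprod_closed) (rule word_symp_closed)

text \<open>Squares in \<open>T\<close> are trivial, so exponents add modulo 2, and commutativity
  allows the words to be multiplied slot by slot.\<close>

lemma coord_hom: "coord \<in> hom (standard_group m) T"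
proof (rule homI)
  fix g h assume gh: "g \<in> carrier (standard_group m)" "h \<in> carrier (standard_group m)"
  have "word T (u i) (v i) ((g \<otimes>\<^bsub>standard_group m\<^esub> h) i)
    = word T (u i) (v i) (g i) \<otimes> word T (u i) (v i) (h i)" if i: "i < m" for i
  proof -
    let ?p = "\<lambda>x a. if a = (1 :: int) then x else \<one>"
    have p: "?p x a \<otimes> ?p x c = ?p x ((a + c) mod 2)"
      if "x \<in> carrier T" "a \<in> {0, 1}" "c \<in> {0, 1}" for x a c
      using that by (auto simp: square_one)
    have shuffle: "(x \<otimes> y) \<otimes> (z \<otimes> w) = (x \<otimes> z) \<otimes> (y \<otimes> w)"
      if "x \<in> carrier T" "y \<in> carrier T" "z \<in> carrier T" "w \<in> carrier T" for x y z w
      using that by (simp add: T.m_ac)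
    have gi: "fst (g i) \<in> {0, 1}" "snd (g i) \<in> {0, 1}" "fst (h i) \<in> {0, 1}" "snd (h i) \<in> {0, 1}"
      using standard_group_component[OF gh(1) i] standard_group_component[OF gh(2) i] by auto
    have c: "?p (u i) a \<in> carrier T" "?p (v i) a \<in> carrier T" for a
      using symp_closed[OF i] by auto
    have "word T (u i) (v i) (g i) \<otimes> word T (u i) (v i) (h i)
      = (?p (u i) (fst (g i)) \<otimes> ?p (u i) (fst (h i))) \<otimes> (?p (v i) (snd (g i)) \<otimes> ?p (v i) (snd (h i)))"
      unfolding word_def by (rule shuffle) (rule c)+
    also have "\<dots> = word T (u i) (v i) ((g \<otimes>\<^bsub>standard_group m\<^esub> h) i)"
      unfolding p[OF symp_closed(1)[OF i] gi(1,3)] p[OF symp_closed(2)[OF i] gi(2,4)]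
      using i by (simp add: word_def mult_standard_group mult_Z2_squared)
    finally show ?thesis by simp
  qed
  then have "coord (g \<otimes>\<^bsub>standard_group m\<^esub> h)
    = oprod T (\<lambda>i. word T (u i) (v i) (g i) \<otimes> word T (u i) (v i) (h i)) m"
    unfolding coord_def by (intro oprod_cong) simp
  also have "\<dots> = coord g \<otimes> coord h"
    unfolding coord_def using word_symp_closed by (intro T.oprod_mult) (auto simp: T.m_comm)
  finally show "coord (g \<otimes>\<^bsub>standard_group m\<^esub> h) = coord g \<otimes> coord h" .
qed (rule coord_closed)

lemma beta_oprod_left:
  assumes "\<And>i. i < n \<Longrightarrow> f i \<in> carrier T" "y \<in> carrier T"
  shows "\<beta> (oprod T f n) y = (\<Prod>i<n. \<beta> (f i) y)"
  using assms(1)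
proof (induction n)
  case (Suc n)
  then show ?case using T.oprod_closed[of n f] assms(2) by (simp add: beta_left)
qed (use assms(2) beta_one in simp)

lemma beta_oprod_right:
  assumes "\<And>i. i < n \<Longrightarrow> f i \<in> carrier T" "y \<in> carrier T"
  shows "\<beta> y (oprod T f n) = (\<Prod>i<n. \<beta> y (f i))"
  using assms(1)
proof (induction n)
  case (Suc n)
  then show ?case using T.oprod_closed[of n f] assms(2) by (simp add: beta_right)
qed (use assms(2) beta_one in simp)

lemma beta_word:
  assumes "i < m" "j < m" "g \<in> {0, 1} \<times> {0, 1}" "h \<in> {0, 1} \<times> {0, 1}"
  shows "\<beta> (word T (u i) (v i) g) (word T (u j) (v j) h) = (if i = j then pair_sign g h else 1)"
proof -
  have c: "u i \<in> carrier T" "v i \<in> carrier T" "u j \<in> carrier T" "v j \<in> carrier T"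
    using symp_closed assms by auto
  have s: "\<beta> (u i) (v i) = - 1" "\<beta> (v i) (u i) = - 1"
    using symp assms beta_sym[OF c(2,1)] by (auto simp: symplectic_def)
  have o: "\<beta> (u i) (u j) = 1 \<and> \<beta> (u i) (v j) = 1 \<and> \<beta> (v i) (v j) = 1 \<and> \<beta> (v i) (u j) = 1" if "i \<noteq> j"
    using symp assms that beta_sym[OF c(2,3)] unfolding symplectic_def by metis
  let ?p = "\<lambda>x a. if a = (1 :: int) then x else \<one>"
  have p: "\<beta> (?p x a) (?p y b) = (if a = 1 \<and> b = 1 then \<beta> x y else 1)"
    if "x \<in> carrier T" "y \<in> carrier T" for x y a b
    using that by (simp add: beta_one)
  have expand: "\<beta> (x \<otimes> y) (z \<otimes> w) = \<beta> x z * \<beta> x w * (\<beta> y z * \<beta> y w)"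
    if "x \<in> carrier T" "y \<in> carrier T" "z \<in> carrier T" "w \<in> carrier T" for x y z w
    using that by (simp add: beta_left beta_right)
  have "\<beta> (word T (u i) (v i) g) (word T (u j) (v j) h)
    = (if fst g = 1 \<and> fst h = 1 then \<beta> (u i) (u j) else 1) * (if fst g = 1 \<and> snd h = 1 then \<beta> (u i) (v j) else 1) *
      ((if snd g = 1 \<and> fst h = 1 then \<beta> (v i) (u j) else 1) * (if snd g = 1 \<and> snd h = 1 then \<beta> (v i) (v j) else 1))"
  proof -
    have pc: "?p x a \<in> carrier T" if "x \<in> carrier T" for x a using that by simp
    show ?thesis
      unfolding word_def expand[OF pc[OF c(1)] pc[OF c(2)] pc[OF c(3)] pc[OF c(4)]]
      by (simp only: p c)
  qed
  also have "\<dots> = (if i = j then pair_sign g h else 1)"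
  proof (cases "i = j")
    case True
    obtain a b where "g = (a, b)" "a = 0 \<or> a = 1" "b = 0 \<or> b = 1" using assms(3) by blast
    moreover obtain a' b' where "h = (a', b')" "a' = 0 \<or> a' = 1" "b' = 0 \<or> b' = 1" using assms(4) by blast
    ultimately show ?thesis
      unfolding True[symmetric] s beta_self[OF c(1)] beta_self[OF c(2)]
      by (elim disjE) (simp_all add: pair_sign_def True)
  qed (use o in simp)
  finally show ?thesis .
qed

text \<open>Multiplicativity expands the pairing over all pairs of slots, and different planes are
  orthogonal, so only equal slots contribute.\<close>

lemma beta_coord:
  assumes "g \<in> carrier (standard_group m)" "h \<in> carrier (standard_group m)"
  shows "\<beta> (coord g) (coord h) = (\<Prod>i<m. pair_sign (g i) (h i))"
proof -
  have "\<beta> (coord g) (coord h)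
    = (\<Prod>i<m. \<Prod>j<m. \<beta> (word T (u i) (v i) (g i)) (word T (u j) (v j) (h j)))"
  proof -
    have "\<beta> (coord g) (coord h) = (\<Prod>i<m. \<beta> (word T (u i) (v i) (g i)) (coord h))"
      unfolding coord_def[of g] by (rule beta_oprod_left[OF word_symp_closed coord_closed])
    also have "\<dots> = (\<Prod>i<m. \<Prod>j<m. \<beta> (word T (u i) (v i) (g i)) (word T (u j) (v j) (h j)))"
    proof (rule prod.cong[OF refl])
      fix i assume "i \<in> {..<m}"
      then show "\<beta> (word T (u i) (v i) (g i)) (coord h)
        = (\<Prod>j<m. \<beta> (word T (u i) (v i) (g i)) (word T (u j) (v j) (h j)))"
        unfolding coord_def by (intro beta_oprod_right word_symp_closed) simp_all
    qed
    finally show ?thesis .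
  qed
  also have "\<dots> = (\<Prod>i<m. \<Prod>j<m. if i = j then pair_sign (g i) (h i) else 1)"
    using beta_word standard_group_component assms by (intro prod.cong) auto
  also have "\<dots> = (\<Prod>i<m. pair_sign (g i) (h i))" by (simp add: prod.delta')
  finally show ?thesis .
qed

text \<open>Orthogonality of the planes makes \<open>\<mu>\<close> multiplicative across slots.
  Within one plane the extra sign of \<open>form_sign\<close> at (1, 1) is the pairing of
  \<open>u n\<close> with \<open>v n\<close>.\<close>

lemma mu_coord:
  assumes g: "g \<in> carrier (standard_group m)"
  shows "\<mu> (coord g) = (\<Prod>i<m. form_sign (factor_sign m i) (g i))"
proof -
  have "\<mu> (oprod T (\<lambda>i. word T (u i) (v i) (g i)) n) = (\<Prod>i<n. form_sign (factor_sign m i) (g i))"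
    if "n \<le> m" for n
    using that
  proof (induction n)
    case 0
    then show ?case by (simp add: mu_one)
  next
    case (Suc n)
    let ?w = "\<lambda>i. word T (u i) (v i) (g i)"
    have w: "\<And>i. i < n \<Longrightarrow> ?w i \<in> carrier T" "?w n \<in> carrier T"
      using word_symp_closed Suc.prems by auto
    have "\<beta> (oprod T ?w n) (?w n) = (\<Prod>i<n. \<beta> (?w i) (?w n))"
      using w by (intro beta_oprod_left)
    also have "\<dots> = 1"
      using beta_word standard_group_component[OF g] Suc.prems by (intro prod.neutral) auto
    finally have b: "\<beta> (oprod T ?w n) (?w n) = 1" .
    have uv: "u n \<in> carrier T" "v n \<in> carrier T" "\<mu> (u n) = factor_sign m n" "\<mu> (v n) = factor_sign m n"
      "\<beta> (u n) (v n) = - 1"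
      using symp Suc.prems by (auto simp: symplectic_def)
    have "\<mu> (?w n) = form_sign (factor_sign m n) (g n)"
      using standard_group_component[OF g, of n] Suc.prems uv
      by (cases "g n") (auto simp: word_def form_sign_def mu_mult mu_one beta_one)
    then show ?case using Suc b w T.oprod_closed[of n ?w] by (simp add: mu_mult)
  qed
  then show ?thesis unfolding coord_def by simp
qed

text \<open>An element of the kernel pairs trivially with everything in the standard group, where
  the pairing is nondegenerate. Equal cardinalities then give surjectivity.\<close>

lemma coord_iso:
  assumes "card (carrier T) = 4 ^ m"
  shows "coord \<in> iso (standard_group m) T"
proof -
  interpret S: comm_group "standard_group m" by (rule comm_group_standard_group)
  interpret group_hom "standard_group m" T coord
    by (intro group_hom.intro group_hom_axioms.intro S.is_group T.is_group coord_hom)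
  have "inj_on coord (carrier (standard_group m))"
    unfolding inj_on_one_iff
  proof (intro allI impI)
    fix g assume g: "g \<in> carrier (standard_group m)" "coord g = \<one>"
    have "(\<Prod>i<m. pair_sign (g i) (h i)) = 1" if "h \<in> carrier (standard_group m)" for h
      using beta_coord[OF g(1) that] g(2) beta_one coord_closed by simp
    then show "g = \<one>\<^bsub>standard_group m\<^esub>" using pair_sign_nondegenerate[OF g(1)] by force
  qed
  moreover have "coord ` carrier (standard_group m) = carrier T"
    using calculation fin coord_closed assms
    by (intro card_subset_eq) (auto simp: card_image card_standard_group)
  ultimately show ?thesis using coord_hom by (simp add: iso_def bij_betw_def)
qed

end

end

section \<open>Matrix algebras over the quaternions\<close>

lemma matrix_algebra_simps:
  "carrier (matrix_algebra k) = carrier_mat k k"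
  "monoid.mult (matrix_algebra k) = (*)"
  "one (matrix_algebra k) = 1\<^sub>m k"
  "zero (matrix_algebra k) = 0\<^sub>m k k"
  "add (matrix_algebra k) = (+)"
  "module.smult (matrix_algebra k) = (\<lambda>r. map_mat ((*\<^sub>R) r))"
  by (simp_all add: matrix_algebra_def)

lemma real_alg_matrix_algebra: "real_alg (matrix_algebra k :: (real, 'a :: real_algebra_1 mat) module)"
proof -
  let ?A = "matrix_algebra k :: (real, 'a mat) module"
  note simps = matrix_algebra_simps
  have "abelian_group ?A"
  proof (rule abelian_groupI)
    fix x assume "x \<in> carrier ?A"
    then show "\<exists>y\<in>carrier ?A. y \<oplus>\<^bsub>?A\<^esub> x = \<zero>\<^bsub>?A\<^esub>"
      by (intro bexI[of _ "- x"]) (auto simp: simps)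
  qed (auto simp: simps)
  moreover have "monoid ?A"
    by (rule monoidI) (auto simp: simps)
  ultimately have "ring ?A"
    by (rule ringI) (auto simp: simps add_mult_distrib_mat mult_add_distrib_mat)
  moreover have "real_alg_axioms ?A"
    by unfold_locales
      (auto simp: simps scaleR_add_left scaleR_add_right scalar_prod_def scaleR_sum_right intro!: eq_matI)
  ultimately show ?thesis by (simp add: real_alg_def)
qed

lemma index_finsum_matrix_algebra:
  fixes f :: "'i \<Rightarrow> 'a :: real_algebra_1 mat"
  assumes "finite I" "\<And>i. i \<in> I \<Longrightarrow> f i \<in> carrier_mat k k" "r < k" "s < k"
  shows "finsum (matrix_algebra k) f I $$ (r, s) = (\<Sum>i\<in>I. f i $$ (r, s))"
proof -
  interpret real_alg "matrix_algebra k :: (real, 'a mat) module" by (rule real_alg_matrix_algebra)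
  show ?thesis
    using assms(1,2)
  proof (induction I rule: finite_induct)
    case (insert i I)
    have f: "f i \<in> carrier_mat k k" "f \<in> I \<rightarrow> carrier_mat k k" using insert.prems by auto
    then have "finsum (matrix_algebra k) f I \<in> carrier_mat k k"
      using finsum_closed[of f I] by (simp add: matrix_algebra_simps)
    then show ?case using f insert assms(3,4) by (simp add: matrix_algebra_simps)
  qed (use assms(3,4) in \<open>simp add: matrix_algebra_simps\<close>)
qed

lemma index_lincomb_matrix_algebra:
  fixes X :: "'i \<Rightarrow> 'a :: real_algebra_1 mat"
  assumes "finite I" "\<And>i. i \<in> I \<Longrightarrow> X i \<in> carrier_mat k k" "r < k" "s < k"
  shows "(\<Oplus>\<^bsub>matrix_algebra k\<^esub>i\<in>I. c i \<odot>\<^bsub>matrix_algebra k\<^esub> X i) $$ (r, s) = (\<Sum>i\<in>I. c i *\<^sub>R (X i $$ (r, s)))"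
proof -
  have "(\<Oplus>\<^bsub>matrix_algebra k\<^esub>i\<in>I. c i \<odot>\<^bsub>matrix_algebra k\<^esub> X i) $$ (r, s)
    = (\<Sum>i\<in>I. (c i \<odot>\<^bsub>matrix_algebra k\<^esub> X i) $$ (r, s))"
    using assms by (intro index_finsum_matrix_algebra) (auto simp: matrix_algebra_simps)
  also have "\<dots> = (\<Sum>i\<in>I. c i *\<^sub>R (X i $$ (r, s)))"
  proof (rule sum.cong[OF refl])
    fix i assume "i \<in> I"
    then show "(c i \<odot>\<^bsub>matrix_algebra k\<^esub> X i) $$ (r, s) = c i *\<^sub>R (X i $$ (r, s))"
      using assms(2)[of i] assms(3,4) by (auto simp: matrix_algebra_simps)
  qed
  finally show ?thesis .
qed

section \<open>Real coordinates on the quaternions\<close>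

definition qcoord :: "nat \<Rightarrow> quat \<Rightarrow> real" where
  "qcoord l q = (if l = 0 then q1 q else if l = 1 then qi q else if l = 2 then qj q else qk q)"

definition qunit :: "nat \<Rightarrow> quat" where
  "qunit l = (if l = 0 then Quat 1 0 0 0 else if l = 1 then Quat 0 1 0 0
     else if l = 2 then Quat 0 0 1 0 else Quat 0 0 0 1)"

definition qconj :: "quat \<Rightarrow> quat" where
  "qconj q = Quat (q1 q) (- qi q) (- qj q) (- qk q)"

lemma quat_sel_simps [simp]:
  "q1 0 = 0" "qi 0 = 0" "qj 0 = 0" "qk 0 = 0"
  "q1 1 = 1" "qi 1 = 0" "qj 1 = 0" "qk 1 = 0"
  "q1 (x + y) = q1 x + q1 y" "qi (x + y) = qi x + qi y" "qj (x + y) = qj x + qj y" "qk (x + y) = qk x + qk y"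
  "q1 (- x) = - q1 x" "qi (- x) = - qi x" "qj (- x) = - qj x" "qk (- x) = - qk x"
  "q1 (r *\<^sub>R x) = r * q1 x" "qi (r *\<^sub>R x) = r * qi x" "qj (r *\<^sub>R x) = r * qj x" "qk (r *\<^sub>R x) = r * qk x"
  "q1 (x * y) = q1 x * q1 y - qi x * qi y - qj x * qj y - qk x * qk y"
  "qi (x * y) = q1 x * qi y + qi x * q1 y + qj x * qk y - qk x * qj y"
  "qj (x * y) = q1 x * qj y - qi x * qk y + qj x * q1 y + qk x * qi y"
  "qk (x * y) = q1 x * qk y + qi x * qj y - qj x * qi y + qk x * q1 y"
  by (simp_all add: zero_quat_def one_quat_def plus_quat_def uminus_quat_def scaleR_quat_def times_quat_def)

lemma quat_eq_iff: "x = y \<longleftrightarrow> q1 x = q1 y \<and> qi x = qi y \<and> qj x = qj y \<and> qk x = qk y"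
  by (auto intro: quat.expand)

lemma qcoord_linear:
  "qcoord l (x + y) = qcoord l x + qcoord l y" "qcoord l (r *\<^sub>R x) = r * qcoord l x" "qcoord l 0 = 0"
  by (simp_all add: qcoord_def)

lemma qcoord_sum: "qcoord l (\<Sum>i\<in>I. f i) = (\<Sum>i\<in>I. qcoord l (f i))"
  by (induction I rule: infinite_finite_induct) (simp_all add: qcoord_linear)

lemma q1_sum: "q1 (\<Sum>i\<in>I. f i) = (\<Sum>i\<in>I. q1 (f i))"
  by (induction I rule: infinite_finite_induct) simp_all

lemma qconj_linear:
  "qconj (x + y) = qconj x + qconj y" "qconj (r *\<^sub>R x) = r *\<^sub>R qconj x" "qconj 0 = 0"
  by (simp_all add: qconj_def quat_eq_iff)

lemma qconj_sum: "qconj (\<Sum>i\<in>I. f i) = (\<Sum>i\<in>I. qconj (f i))"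
  by (induction I rule: infinite_finite_induct) (simp_all add: qconj_linear)

lemma quat_expand: "x = (\<Sum>l<4. qcoord l x *\<^sub>R qunit l)"
proof -
  have "{..<4 :: nat} = {0, 1, 2, 3}" by auto
  then show ?thesis by (simp add: qcoord_def qunit_def quat_eq_iff)
qed

lemma qcoord_qunit: "l < 4 \<Longrightarrow> l' < 4 \<Longrightarrow> qcoord l (qunit l') = (if l = l' then 1 else 0)"
  by (auto simp: qcoord_def qunit_def)

section \<open>The matrix units as a real basis\<close>

definition matrix_unit :: "nat \<Rightarrow> nat \<times> nat \<times> nat \<Rightarrow> quat mat" where
  "matrix_unit k = (\<lambda>(r, s, l). mat k k (\<lambda>(i, j). if i = r \<and> j = s then qunit l else 0))"

definition unit_index :: "nat \<Rightarrow> (nat \<times> nat \<times> nat) set" where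
  "unit_index k = {..<k} \<times> {..<k} \<times> {..<4}"

lemma card_unit_index: "finite (unit_index k)" "card (unit_index k) = 4 * k * k"
  by (simp_all add: unit_index_def card_cartesian_product)

lemma matrix_unit_closed: "matrix_unit k p \<in> carrier_mat k k"
  by (cases p) (simp add: matrix_unit_def)

lemma index_matrix_unit_sum:
  assumes "r < k" "s < k"
  shows "(\<Oplus>\<^bsub>matrix_algebra k\<^esub>p\<in>unit_index k. c p \<odot>\<^bsub>matrix_algebra k\<^esub> matrix_unit k p) $$ (r, s)
    = (\<Sum>l<4. c (r, s, l) *\<^sub>R qunit l)"
proof -
  have "(\<Oplus>\<^bsub>matrix_algebra k\<^esub>p\<in>unit_index k. c p \<odot>\<^bsub>matrix_algebra k\<^esub> matrix_unit k p) $$ (r, s)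
    = (\<Sum>p\<in>unit_index k. c p *\<^sub>R (matrix_unit k p $$ (r, s)))"
    using assms by (intro index_lincomb_matrix_algebra card_unit_index matrix_unit_closed) auto
  also have "\<dots> = (\<Sum>p\<in>{r} \<times> {s} \<times> {..<4}. c p *\<^sub>R (matrix_unit k p $$ (r, s)))"
    using assms by (intro sum.mono_neutral_right card_unit_index) (auto simp: unit_index_def matrix_unit_def split: if_splits)
  also have "\<dots> = (\<Sum>l<4. c (r, s, l) *\<^sub>R qunit l)"
    using assms
    by (intro sum.reindex_bij_witness[of _ "\<lambda>l. (r, s, l)" "\<lambda>(_, _, l). l"]) (auto simp: matrix_unit_def)
  finally show ?thesis .
qed

lemma matrix_units_span: "spans (matrix_algebra k) (matrix_unit k) (unit_index k)"
  unfolding spans_def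
proof (intro conjI ballI)
  interpret real_alg "matrix_algebra k :: (real, quat mat) module" by (rule real_alg_matrix_algebra)
  show "finite (unit_index k)" by (rule card_unit_index)
  show cl: "matrix_unit k \<in> unit_index k \<rightarrow> carrier (matrix_algebra k)"
    by (simp add: matrix_algebra_simps matrix_unit_closed)
  fix x :: "quat mat" assume x: "x \<in> carrier (matrix_algebra k)"
  define c where "c = (\<lambda>(r, s, l). qcoord l (x $$ (r, s)))"
  let ?s = "\<Oplus>\<^bsub>matrix_algebra k\<^esub>p\<in>unit_index k. c p \<odot>\<^bsub>matrix_algebra k\<^esub> matrix_unit k p"
  have "?s \<in> carrier (matrix_algebra k)" using cl by (intro finsum_closed) auto
  then have s: "?s \<in> carrier_mat k k" by (simp only: matrix_algebra_simps)
  have xc: "x \<in> carrier_mat k k" using x by (simp only: matrix_algebra_simps)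
  have "x = ?s"
  proof (rule eq_matI)
    fix r s assume "r < dim_row ?s" "s < dim_col ?s"
    then have rs: "r < k" "s < k" using s by auto
    show "x $$ (r, s) = ?s $$ (r, s)"
      unfolding index_matrix_unit_sum[OF rs] using quat_expand[of "x $$ (r, s)"] by (simp add: c_def)
  qed (use s xc in auto)
  then show "\<exists>c. x = (\<Oplus>\<^bsub>matrix_algebra k\<^esub>p\<in>unit_index k. c p \<odot>\<^bsub>matrix_algebra k\<^esub> matrix_unit k p)"
    by (rule exI[where x = c])
qed

lemma matrix_units_indep: "indep (matrix_algebra k) (matrix_unit k) (unit_index k)"
  unfolding indep_def
proof (intro conjI allI impI ballI)
  show "finite (unit_index k)" by (rule card_unit_index)
  show "matrix_unit k \<in> unit_index k \<rightarrow> carrier (matrix_algebra k)"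
    by (simp add: matrix_algebra_simps matrix_unit_closed)
  fix c p
  assume z: "(\<Oplus>\<^bsub>matrix_algebra k\<^esub>p\<in>unit_index k. c p \<odot>\<^bsub>matrix_algebra k\<^esub> matrix_unit k p) = \<zero>\<^bsub>matrix_algebra k\<^esub>"
    and p: "p \<in> unit_index k"
  obtain r s l where rsl: "p = (r, s, l)" "r < k" "s < k" "l < 4" using p by (auto simp: unit_index_def)
  have "(\<Sum>l<4. c (r, s, l) *\<^sub>R qunit l) = 0"
    using index_matrix_unit_sum[OF rsl(2,3), of c] rsl unfolding z by (simp add: matrix_algebra_simps)
  then have "qcoord l (\<Sum>l<4. c (r, s, l) *\<^sub>R qunit l) = 0" by (simp add: qcoord_linear)
  then have "(\<Sum>l'<4. c (r, s, l') * (if l = l' then 1 else 0)) = 0"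
    using rsl(4) by (simp add: qcoord_sum qcoord_linear qcoord_qunit)
  then show "c p = 0" using rsl by (simp add: sum.delta if_distrib cong: if_cong)
qed

lemma matrix_algebra_nontrivial: "k > 0 \<Longrightarrow> \<one>\<^bsub>matrix_algebra k\<^esub> \<noteq> (\<zero>\<^bsub>matrix_algebra k\<^esub> :: quat mat)"
proof
  assume k: "k > 0" and "\<one>\<^bsub>matrix_algebra k\<^esub> = (\<zero>\<^bsub>matrix_algebra k\<^esub> :: quat mat)"
  then have "(1\<^sub>m k :: quat mat) $$ (0, 0) = 0\<^sub>m k k $$ (0, 0)" by (simp add: matrix_algebra_simps)
  then show False using k by simp
qed

lemma index_mult_matrix_unit:
  assumes z: "z \<in> carrier_mat k k" and "r < k" "s < k" "i < k" "j < k"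
  shows "(z * matrix_unit k (r, s, l)) $$ (i, j) = (if j = s then z $$ (i, r) * qunit l else 0)"
    and "(matrix_unit k (r, s, l) * z) $$ (i, j) = (if i = r then qunit l * z $$ (s, j) else 0)"
proof -
  have "(z * matrix_unit k (r, s, l)) $$ (i, j)
    = (\<Sum>a\<in>{0..<k}. if a = r then (if j = s then z $$ (i, r) * qunit l else 0) else 0)"
  proof -
    have "(z * matrix_unit k (r, s, l)) $$ (i, j) = (\<Sum>a\<in>{0..<k}. z $$ (i, a) * matrix_unit k (r, s, l) $$ (a, j))"
      using assms by (simp add: scalar_prod_def matrix_unit_def)
    also have "\<dots> = (\<Sum>a\<in>{0..<k}. if a = r then (if j = s then z $$ (i, r) * qunit l else 0) else 0)"
      using assms by (intro sum.cong) (auto simp: matrix_unit_def)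
    finally show ?thesis .
  qed
  then show "(z * matrix_unit k (r, s, l)) $$ (i, j) = (if j = s then z $$ (i, r) * qunit l else 0)"
    using assms by (simp add: sum.delta)
  have "(matrix_unit k (r, s, l) * z) $$ (i, j)
    = (\<Sum>a\<in>{0..<k}. if a = s then (if i = r then qunit l * z $$ (s, j) else 0) else 0)"
  proof -
    have "(matrix_unit k (r, s, l) * z) $$ (i, j) = (\<Sum>a\<in>{0..<k}. matrix_unit k (r, s, l) $$ (i, a) * z $$ (a, j))"
      using assms by (simp add: scalar_prod_def matrix_unit_def)
    also have "\<dots> = (\<Sum>a\<in>{0..<k}. if a = s then (if i = r then qunit l * z $$ (s, j) else 0) else 0)"
      using assms by (intro sum.cong) (auto simp: matrix_unit_def)
    finally show ?thesis .
  qed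
  then show "(matrix_unit k (r, s, l) * z) $$ (i, j) = (if i = r then qunit l * z $$ (s, j) else 0)"
    using assms by (simp add: sum.delta)
qed

text \<open>Commuting with the real matrix units makes \<open>z\<close> a diagonal matrix with a
  single repeated entry \<open>w\<close>. Commuting with the units carrying i and j then removes the
  imaginary part of \<open>w\<close>.\<close>

lemma matrix_algebra_central: "central_algebra (matrix_algebra k :: (real, quat mat) module)"
  unfolding central_algebra_def
proof (intro ballI impI)
  fix z :: "quat mat"
  assume z: "z \<in> carrier (matrix_algebra k)"
    and com: "\<forall>x\<in>carrier (matrix_algebra k). z \<otimes>\<^bsub>matrix_algebra k\<^esub> x = x \<otimes>\<^bsub>matrix_algebra k\<^esub> z"
  have zc: "z \<in> carrier_mat k k" using z by (simp add: matrix_algebra_simps)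
  have e: "(if j = s then z $$ (i, r) * qunit l else 0) = (if i = r then qunit l * z $$ (s, j) else 0)"
    if "r < k" "s < k" "i < k" "j < k" for r s i j l
  proof -
    have "z * matrix_unit k (r, s, l) = matrix_unit k (r, s, l) * z"
      using com matrix_unit_closed by (simp add: matrix_algebra_simps)
    then show ?thesis using index_mult_matrix_unit[OF zc that, of l] by simp
  qed
  have one: "qunit 0 = 1" by (simp add: qunit_def one_quat_def)
  have off: "z $$ (i, r) = 0" if "i < k" "r < k" "i \<noteq> r" for i r
    using e[of r i i i 0] that by (simp add: one)
  have diag: "z $$ (i, i) = z $$ (0, 0)" if "i < k" for i
    using e[of i 0 i 0 0] that by (simp add: one)
  define w where "w = z $$ (0, 0)"
  have w: "w = q1 w *\<^sub>R 1" if "k > 0"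
  proof -
    have "w * qunit l = qunit l * w" for l using e[of 0 0 0 0 l] that by (simp add: w_def)
    from this[of 1] this[of 2] show ?thesis by (simp add: qunit_def quat_eq_iff)
  qed
  have "z = q1 w \<odot>\<^bsub>matrix_algebra k\<^esub> \<one>\<^bsub>matrix_algebra k\<^esub>"
  proof (rule eq_matI)
    fix i j assume "i < dim_row (q1 w \<odot>\<^bsub>matrix_algebra k\<^esub> (\<one>\<^bsub>matrix_algebra k\<^esub> :: quat mat))"
      "j < dim_col (q1 w \<odot>\<^bsub>matrix_algebra k\<^esub> (\<one>\<^bsub>matrix_algebra k\<^esub> :: quat mat))"
    then have ij: "i < k" "j < k" by (simp_all add: matrix_algebra_simps)
    have "z $$ (i, j) = (if i = j then q1 w *\<^sub>R 1 else 0)"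
      using off[OF ij] diag[OF ij(1)] w ij by (cases "i = j") (simp_all add: w_def[symmetric])
    then show "z $$ (i, j) = (q1 w \<odot>\<^bsub>matrix_algebra k\<^esub> \<one>\<^bsub>matrix_algebra k\<^esub>) $$ (i, j)"
      using ij by (simp add: matrix_algebra_simps)
  qed (use zc in \<open>simp_all add: matrix_algebra_simps\<close>)
  then show "\<exists>r. z = r \<odot>\<^bsub>matrix_algebra k\<^esub> \<one>\<^bsub>matrix_algebra k\<^esub>" by blast
qed

lemma card_graded_basis:
  assumes "graded_basis T (matrix_algebra k :: (real, quat mat) module) X"
  shows "card (carrier T) = 4 * k * k"
proof -
  interpret real_alg "matrix_algebra k :: (real, quat mat) module" by (rule real_alg_matrix_algebra)
  have "indep (matrix_algebra k) X (carrier T)" "spans (matrix_algebra k) X (carrier T)"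
    using assms by (simp_all add: graded_basis_def)
  then show ?thesis
    using indep_card_le[OF matrix_units_span] indep_card_le[OF _ matrix_units_indep] card_unit_index
    by (metis le_antisym)
qed

section \<open>The Arf invariant\<close>

definition trace_form :: "nat \<Rightarrow> quat mat \<Rightarrow> quat mat \<Rightarrow> real" where
  "trace_form k x y = (\<Sum>r<k. \<Sum>s<k. q1 (x $$ (r, s) * y $$ (s, r)))"

text \<open>Noncommuting entries do no harm, because the real part of a product of two quaternions
  does not depend on their order.\<close>

lemma trace_form_sym: "trace_form k x y = trace_form k y x"
  unfolding trace_form_def by (subst sum.swap) (simp add: algebra_simps)

lemma trace_form_assoc:
  assumes "x \<in> carrier_mat k k" "y \<in> carrier_mat k k" "z \<in> carrier_mat k k"
  shows "trace_form k (x * y) z = trace_form k x (y * z)"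
proof -
  have "trace_form k (x * y) z = (\<Sum>r<k. \<Sum>s<k. \<Sum>a<k. q1 (x $$ (r, a) * y $$ (a, s) * z $$ (s, r)))"
    using assms unfolding trace_form_def
    by (auto simp: scalar_prod_def sum_distrib_right q1_sum lessThan_atLeast0 simp del: quat_sel_simps intro!: sum.cong)
  also have "\<dots> = (\<Sum>r<k. \<Sum>a<k. \<Sum>s<k. q1 (x $$ (r, a) * y $$ (a, s) * z $$ (s, r)))"
    by (intro sum.cong refl sum.swap)
  also have "\<dots> = trace_form k x (y * z)"
    using assms unfolding trace_form_def
    by (auto simp: scalar_prod_def sum_distrib_left q1_sum lessThan_atLeast0 mult.assoc simp del: quat_sel_simps intro!: sum.cong)
  finally show ?thesis .
qed

lemma trace_form_smult:
  assumes "x \<in> carrier_mat k k"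
  shows "trace_form k (r \<odot>\<^bsub>matrix_algebra k\<^esub> x) y = r * trace_form k x y"
  using assms unfolding trace_form_def
  by (auto simp: matrix_algebra_simps sum_distrib_left algebra_simps intro!: sum.cong)

lemma trace_form_one_one: "trace_form k (1\<^sub>m k) (1\<^sub>m k) = real k"
proof -
  have "trace_form k (1\<^sub>m k) (1\<^sub>m k) = (\<Sum>r<k. \<Sum>s<k. if r = s then 1 else 0)"
    unfolding trace_form_def
  proof (intro sum.cong refl)
    fix r s assume "r \<in> {..<k}" "s \<in> {..<k}"
    then show "q1 ((1\<^sub>m k :: quat mat) $$ (r, s) * 1\<^sub>m k $$ (s, r)) = (if r = s then 1 else 0)"
      by simp
  qed
  then show ?thesis by (simp add: sum.delta)
qed

lemma trace_form_lincomb: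
  fixes X :: "'i \<Rightarrow> quat mat"
  assumes "finite I" "\<And>i. i \<in> I \<Longrightarrow> X i \<in> carrier_mat k k"
  shows "trace_form k (\<Oplus>\<^bsub>matrix_algebra k\<^esub>i\<in>I. c i \<odot>\<^bsub>matrix_algebra k\<^esub> X i) y = (\<Sum>i\<in>I. c i * trace_form k (X i) y)"
proof -
  have "trace_form k (\<Oplus>\<^bsub>matrix_algebra k\<^esub>i\<in>I. c i \<odot>\<^bsub>matrix_algebra k\<^esub> X i) y
    = (\<Sum>r<k. \<Sum>s<k. \<Sum>i\<in>I. c i * q1 (X i $$ (r, s) * y $$ (s, r)))"
    unfolding trace_form_def
  proof (intro sum.cong refl)
    fix r s assume "r \<in> {..<k}" "s \<in> {..<k}"
    then have "(\<Oplus>\<^bsub>matrix_algebra k\<^esub>i\<in>I. c i \<odot>\<^bsub>matrix_algebra k\<^esub> X i) $$ (r, s) = (\<Sum>i\<in>I. c i *\<^sub>R (X i $$ (r, s)))"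
      using assms by (intro index_lincomb_matrix_algebra) auto
    then show "q1 ((\<Oplus>\<^bsub>matrix_algebra k\<^esub>i\<in>I. c i \<odot>\<^bsub>matrix_algebra k\<^esub> X i) $$ (r, s) * y $$ (s, r))
      = (\<Sum>i\<in>I. c i * q1 (X i $$ (r, s) * y $$ (s, r)))"
      by (simp only: sum_distrib_right q1_sum mult_scaleR_left quat_sel_simps(17))
  qed
  also have "\<dots> = (\<Sum>r<k. \<Sum>i\<in>I. \<Sum>s<k. c i * q1 (X i $$ (r, s) * y $$ (s, r)))"
    by (intro sum.cong refl sum.swap)
  also have "\<dots> = (\<Sum>i\<in>I. \<Sum>r<k. \<Sum>s<k. c i * q1 (X i $$ (r, s) * y $$ (s, r)))"
    by (rule sum.swap)
  also have "\<dots> = (\<Sum>i\<in>I. c i * trace_form k (X i) y)"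
    unfolding trace_form_def by (simp only: sum_distrib_left)
  finally show ?thesis .
qed

text \<open>By associativity of the form this amounts to \<open>X t\<close> having trace form 0 with
  the unit matrix for nontrivial \<open>t\<close>. Nondegeneracy provides \<open>u\<close> such that
  \<open>X u\<close> and \<open>X t\<close> anticommute; exchanging them in the form with
  \<open>X u\<close> both preserves and negates the value.\<close>

lemma trace_form_orthogonal:
  assumes k: "k > 0" and sb: "sign_basis T (matrix_algebra k) \<mu> X"
    and uv: "u \<in> carrier T" "v \<in> carrier T"
  shows "trace_form k (X u) (X v) = (if u = v then \<mu> u * real k else 0)"
proof -
  interpret real_alg "matrix_algebra k :: (real, quat mat) module" by (rule real_alg_matrix_algebra)
  note nt = matrix_algebra_nontrivial[OF k]
  note quad = sign_basis_quadratic[OF sb nt matrix_algebra_central]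
  have gb: "graded_basis T (matrix_algebra k) X"
    and sq: "\<And>t. t \<in> carrier T \<Longrightarrow> X t * X t = \<mu> t \<odot>\<^bsub>matrix_algebra k\<^esub> 1\<^sub>m k"
    and mu: "\<And>t. t \<in> carrier T \<Longrightarrow> \<mu> t = 1 \<or> \<mu> t = - 1"
    using sb by (auto simp: sign_basis_def matrix_algebra_simps)
  interpret T: comm_group T using gb by (simp add: graded_basis_def)
  interpret Q: quad_form T \<mu>
    using quad gb_finite[OF gb nt] by unfold_locales
  have X: "X t \<in> carrier_mat k k" if "t \<in> carrier T" for t
    using gb_closed[OF gb nt that] by (simp add: matrix_algebra_simps)
  have assoc: "trace_form k (x * y) (1\<^sub>m k) = trace_form k x y"
    if "x \<in> carrier_mat k k" "y \<in> carrier_mat k k" for x y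
    using trace_form_assoc[OF that one_carrier_mat] that by simp
  have zero: "trace_form k (X t) (1\<^sub>m k) = 0" if t: "t \<in> carrier T" "t \<noteq> \<one>\<^bsub>T\<^esub>" for t
  proof -
    obtain u where u: "u \<in> carrier T" "Q.\<beta> u t \<noteq> 1" using Q.radical t by blast
    have c: "X t * X u = (- 1) \<odot>\<^bsub>matrix_algebra k\<^esub> (X u * X t)"
      using sign_basis_commutation(1)[OF sb nt t(1) u(1)] u Q.beta_cases[OF u(1) t(1)] Q.beta_sym[OF u(1) t(1)]
      by (simp add: matrix_algebra_simps)
    have eq: "trace_form k (X u * X t) (X u) = trace_form k (X t * X u) (X u)"
      using trace_form_assoc[of "X u" k "X t" "X u"] X t u trace_form_sym by simp
    also have neg: "\<dots> = - trace_form k (X u * X t) (X u)"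
      unfolding c using X t u mult_carrier_mat[of "X u" k k "X t" k] by (subst trace_form_smult) auto
    finally have "trace_form k (X u * X t) (X u) = 0" by simp
    then have "trace_form k (X t * X u) (X u) = 0" using eq by simp
    then have "trace_form k (X t) (\<mu> u \<odot>\<^bsub>matrix_algebra k\<^esub> 1\<^sub>m k) = 0"
      using trace_form_assoc[of "X t" k "X u" "X u"] X t u sq by simp
    then have "\<mu> u * trace_form k (1\<^sub>m k) (X t) = 0"
      by (simp add: trace_form_smult trace_form_sym[of k "X t"])
    then show ?thesis using mu[OF u(1)] trace_form_sym[of k "X t"] by auto
  qed
  show ?thesis
  proof (cases "u = v")
    case True
    then show ?thesis
      using assoc[of "X u" "X u"] X[OF uv(1)] sq[OF uv(1)] by (simp add: trace_form_smult trace_form_one_one)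
  next
    case False
    obtain c where c: "X u * X v = c \<odot>\<^bsub>matrix_algebra k\<^esub> X (u \<otimes>\<^bsub>T\<^esub> v)"
      using gb_mult[OF gb nt uv] by (auto simp: matrix_algebra_simps)
    have "u \<otimes>\<^bsub>T\<^esub> v \<noteq> \<one>\<^bsub>T\<^esub>"
      using False uv Q.cancel[of u v] by (metis T.r_one)
    then show ?thesis
      using False uv zero[of "u \<otimes>\<^bsub>T\<^esub> v"] assoc[of "X u" "X v"] c X by (simp add: trace_form_smult)
  qed
qed

text \<open>The trace form is negative semidefinite on antihermitian matrices, but positive definite
  on the span of the basis elements with positive square, so the latter span injects into the
  hermitian matrices.\<close>

lemma arf_matrix_algebra:
  assumes k: "k > 0" and sb: "sign_basis T (matrix_algebra k :: (real, quat mat) module) \<mu> X"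
  shows "arf_invariant (carrier T) \<mu> = - 1"
proof (rule ccontr)
  assume arf: "arf_invariant (carrier T) \<mu> \<noteq> - 1"
  interpret real_alg "matrix_algebra k :: (real, quat mat) module" by (rule real_alg_matrix_algebra)
  note nt = matrix_algebra_nontrivial[OF k]
  have gb: "graded_basis T (matrix_algebra k) X"
    and mu: "\<And>t. t \<in> carrier T \<Longrightarrow> \<mu> t = 1 \<or> \<mu> t = - 1"
    using sb by (auto simp: sign_basis_def)
  have X: "X t \<in> carrier_mat k k" if "t \<in> carrier T" for t
    using gb_closed[OF gb nt that] by (simp add: matrix_algebra_simps)
  have fin: "finite (carrier T)" by (rule gb_finite[OF gb nt])
  define P where "P = {t \<in> carrier T. \<mu> t = 1}"
  define N where "N = {t \<in> carrier T. \<mu> t = - 1}"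
  have "carrier T = P \<union> N" "P \<inter> N = {}" using mu by (auto simp: P_def N_def)
  then have "card P + card N = 4 * k * k"
    using card_graded_basis[OF gb] fin by (metis card_Un_disjoint finite_Un)
  moreover have "card N \<le> card P"
    using arf by (auto simp: arf_invariant_def P_def N_def sgn_if split: if_splits)
  ultimately have cP: "2 * k * k \<le> card P" by linarith
  \<comment> \<open>The conditions for \<open>y\<close> to be antihermitian: one real equation per
    diagonal entry, repeated for both values of \<open>l\<close>, and four per pair of opposite
    entries, two stored above the diagonal and two below. Dropping one of the repetitions makes the
    number of equations strictly less than \<open>2 * k * k\<close>.\<close>
  define J where "J = {..<k} \<times> {..<k} \<times> {..<2 :: nat} - {(0, 0, 1)}"
  have "card J < card ({..<k} \<times> {..<k} \<times> {..<2 :: nat})"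
    unfolding J_def using k by (intro card_Diff1_less) auto
  then have cJ: "card J < card P" using cP by (simp add: card_cartesian_product)
  \<comment> \<open>Above the diagonal \<open>l\<close> selects coordinates 0 and 1 of the entry
    plus the conjugate of its mirror image; below it, \<open>l + 2\<close> selects coordinates 2 and
    3 for the mirrored pair.\<close>
  define a where "a = (\<lambda>(r, s, l) t.
    if r = s then q1 (X t $$ (r, r))
    else if r < s then qcoord l (X t $$ (r, s) + qconj (X t $$ (s, r)))
    else qcoord (l + 2) (X t $$ (s, r) + qconj (X t $$ (r, s))))"
  have "finite J" "finite P" using fin by (auto simp: J_def P_def)
  then obtain c where c: "\<exists>t\<in>P. c t \<noteq> 0" "\<forall>j\<in>J. (\<Sum>t\<in>P. a j t * c t) = 0"
    using underdetermined_system[OF _ _ cJ, of a] by blast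
  define y where "y = (\<Oplus>\<^bsub>matrix_algebra k\<^esub>t\<in>P. c t \<odot>\<^bsub>matrix_algebra k\<^esub> X t)"
  have XP: "X t \<in> carrier_mat k k" if "t \<in> P" for t using that X by (simp add: P_def)
  have yi: "y $$ (r, s) = (\<Sum>t\<in>P. c t *\<^sub>R (X t $$ (r, s)))" if "r < k" "s < k" for r s
    unfolding y_def by (rule index_lincomb_matrix_algebra[OF \<open>finite P\<close> XP that])
  have diag: "q1 (y $$ (r, r)) = 0" if r: "r < k" for r
  proof -
    have "(r, r, 0) \<in> J" using r by (auto simp: J_def)
    then have "(\<Sum>t\<in>P. a (r, r, 0) t * c t) = 0" using c(2) by blast
    then show ?thesis using r by (simp add: yi q1_sum a_def mult.commute)
  qed
  have comb: "qcoord l (y $$ (r, s) + qconj (y $$ (s, r)))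
    = (\<Sum>t\<in>P. qcoord l (X t $$ (r, s) + qconj (X t $$ (s, r))) * c t)" if "r < k" "s < k" for r s l
    using that by (simp add: yi qcoord_linear qcoord_sum qconj_sum qconj_linear sum.distrib algebra_simps)
  have low: "qcoord l (y $$ (r, s) + qconj (y $$ (s, r))) = 0" if rs: "r < s" "s < k" and l: "l < 2" for r s l
  proof -
    have "(r, s, l) \<in> J" using rs l by (auto simp: J_def)
    then have "(\<Sum>t\<in>P. a (r, s, l) t * c t) = 0" using c(2) by blast
    then show ?thesis using rs comb[of r s l] by (simp add: a_def)
  qed
  have high: "qcoord (l + 2) (y $$ (r, s) + qconj (y $$ (s, r))) = 0" if rs: "r < s" "s < k" and l: "l < 2" for r s l
  proof -
    have "(s, r, l) \<in> J" using rs l by (auto simp: J_def)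
    then have "(\<Sum>t\<in>P. a (s, r, l) t * c t) = 0" using c(2) by blast
    then show ?thesis using rs comb[of r s "l + 2"] by (simp add: a_def)
  qed
  have anti: "y $$ (r, s) = - qconj (y $$ (s, r))" if rs: "r < s" "s < k" for r s
    using low[OF rs, of 0] low[OF rs, of 1] high[OF rs, of 0] high[OF rs, of 1]
    by (simp add: qcoord_def quat_eq_iff qconj_def)
  \<comment> \<open>Off the diagonal the product is minus the squared norm of an entry; on the
    diagonal it is the square of a purely imaginary quaternion.\<close>
  have neg: "q1 (y $$ (r, s) * y $$ (s, r)) \<le> 0" if rs: "r < k" "s < k" for r s
  proof -
    have sq: "- (a * a) - b * b - c * c - d * d \<le> (0 :: real)" for a b c d
      using zero_le_square[of a] zero_le_square[of b] zero_le_square[of c] zero_le_square[of d] by linarith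
    consider "r = s" | "r < s" | "s < r" by linarith
    then show ?thesis
    proof cases
      case 1
      then show ?thesis using sq[of 0] diag[OF rs(1)] by simp
    next
      case 2
      then show ?thesis using sq anti[OF 2 rs(2)] by (simp add: qconj_def)
    next
      case 3
      then show ?thesis using sq anti[OF 3 rs(1)] by (simp add: qconj_def)
    qed
  qed
  \<comment> \<open>The two evaluations collide: as an antihermitian matrix \<open>y\<close> has
    value at most 0, as a nonzero combination of orthogonal \<open>X t\<close> with
    \<open>\<mu> t = 1\<close> it has positive value.\<close>
  have "trace_form k y y \<le> 0"
    unfolding trace_form_def using neg by (intro sum_nonpos) auto
  moreover have "trace_form k y y = (\<Sum>t\<in>P. c t * (c t * real k))"
  proof -
    have "trace_form k y y = (\<Sum>t\<in>P. c t * trace_form k (X t) y)"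
      unfolding y_def[abs_def] by (rule trace_form_lincomb[OF \<open>finite P\<close> XP])
    also have "\<dots> = (\<Sum>t\<in>P. c t * (c t * real k))"
    proof (rule sum.cong[OF refl])
      fix t assume t: "t \<in> P"
      have "trace_form k (X t) y = (\<Sum>s\<in>P. c s * trace_form k (X s) (X t))"
        unfolding trace_form_sym[of k "X t"] y_def by (rule trace_form_lincomb[OF \<open>finite P\<close> XP])
      also have "\<dots> = (\<Sum>s\<in>P. if s = t then c t * real k else 0)"
        using t trace_form_orthogonal[OF k sb] by (intro sum.cong) (auto simp: P_def)
      finally show "c t * trace_form k (X t) y = c t * (c t * real k)"
        using t \<open>finite P\<close> by (simp add: sum.delta)
    qed
    finally show ?thesis .
  qed
  moreover have "(\<Sum>t\<in>P. c t * (c t * real k)) > 0"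
  proof -
    obtain p where "p \<in> P" "c p \<noteq> 0" using c(1) by blast
    moreover have "0 \<le> c t * (c t * real k)" for t by (simp add: mult.assoc[symmetric])
    moreover have "0 < c p * (c p * real k)"
      using calculation k by (simp add: mult.assoc[symmetric] zero_less_mult_iff linorder_neq_iff disj_commute)
    ultimately show ?thesis using \<open>finite P\<close> by (intro sum_pos2[of P p]) auto
  qed
  ultimately show False by simp
qed

section \<open>Frames\<close>

text \<open>A frame consists of the images of the generators of degree \<open>a\<close> and \<open>b\<close> of all standard
  factors.\<close>

definition frame :: "(real, 'a) module \<Rightarrow> nat \<Rightarrow> (nat \<Rightarrow> 'a) \<Rightarrow> (nat \<Rightarrow> 'a) \<Rightarrow> bool" where
  "frame A m U V \<longleftrightarrow>
     (\<forall>i<m. U i \<in> carrier A \<and> V i \<in> carrier A \<and>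
        U i \<otimes>\<^bsub>A\<^esub> U i = factor_sign m i \<odot>\<^bsub>A\<^esub> \<one>\<^bsub>A\<^esub> \<and> V i \<otimes>\<^bsub>A\<^esub> V i = factor_sign m i \<odot>\<^bsub>A\<^esub> \<one>\<^bsub>A\<^esub> \<and>
        V i \<otimes>\<^bsub>A\<^esub> U i = (- 1) \<odot>\<^bsub>A\<^esub> (U i \<otimes>\<^bsub>A\<^esub> V i) \<and>
        (\<forall>j<m. i \<noteq> j \<longrightarrow> U i \<otimes>\<^bsub>A\<^esub> U j = U j \<otimes>\<^bsub>A\<^esub> U i \<and> U i \<otimes>\<^bsub>A\<^esub> V j = V j \<otimes>\<^bsub>A\<^esub> U i \<and>
           V i \<otimes>\<^bsub>A\<^esub> V j = V j \<otimes>\<^bsub>A\<^esub> V i))"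

text \<open>The general element of the quaternion algebra with generators \<open>x\<close> and
  \<open>y\<close>: if they anticommute and both square to \<open>s\<close>, it is M_2(\<real>) for
  \<open>s\<close> = 1 and \<bbbH> for \<open>s\<close> = -1.\<close>

definition comb4 :: "(real, 'a) module \<Rightarrow> 'a \<Rightarrow> 'a \<Rightarrow> real \<Rightarrow> real \<Rightarrow> real \<Rightarrow> real \<Rightarrow> 'a" where
  "comb4 A x y a b c d =
     a \<odot>\<^bsub>A\<^esub> \<one>\<^bsub>A\<^esub> \<oplus>\<^bsub>A\<^esub> (b \<odot>\<^bsub>A\<^esub> x \<oplus>\<^bsub>A\<^esub> (c \<odot>\<^bsub>A\<^esub> y \<oplus>\<^bsub>A\<^esub> d \<odot>\<^bsub>A\<^esub> (x \<otimes>\<^bsub>A\<^esub> y)))"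

text \<open>The sign created by bringing a product of two words into normal order: one exchange of
  \<open>y\<close> with \<open>x\<close>, and the squares of \<open>y\<close> and of
  \<open>x\<close>.\<close>

definition word_sign :: "real \<Rightarrow> int \<times> int \<Rightarrow> int \<times> int \<Rightarrow> real" where
  "word_sign s g h = (if snd g = 1 \<and> fst h = 1 then - 1 else 1) *
     (if snd g = 1 \<and> snd h = 1 then s else 1) * (if fst g = 1 \<and> fst h = 1 then s else 1)"

text \<open>The sum over the product group factors into sums over single slots, where four terms are
  checked directly.\<close>

lemma character_orthogonality:
  assumes "g \<in> carrier (standard_group m)" "h \<in> carrier (standard_group m)"
  shows "(\<Sum>k\<in>carrier (standard_group m). (\<Prod>i<m. pair_sign (k i) (g i)) * (\<Prod>i<m. pair_sign (k i) (h i)))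
    = (if g = h then 4 ^ m else 0)"
proof -
  have four: "(\<Sum>k\<in>{0, 1} \<times> {0, 1}. pair_sign k p * pair_sign k q) = (if p = q then 4 else 0)"
    if "p \<in> {0, 1} \<times> {0, 1}" "q \<in> {0, 1} \<times> {0, 1}" for p q
  proof -
    have "{0, 1} \<times> {0, 1 :: int} = {(0 :: int, 0), (0, 1), (1, 0), (1, 1)}" by auto
    then show ?thesis using that by (auto simp: pair_sign_def)
  qed
  have "(\<Sum>k\<in>carrier (standard_group m). (\<Prod>i<m. pair_sign (k i) (g i)) * (\<Prod>i<m. pair_sign (k i) (h i)))
    = (\<Sum>k\<in>(\<Pi>\<^sub>E i\<in>{..<m}. {0, 1} \<times> {0, 1}). \<Prod>i<m. pair_sign (k i) (g i) * pair_sign (k i) (h i))"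
    by (simp add: carrier_standard_group prod.distrib)
  also have "\<dots> = (\<Prod>i<m. \<Sum>k\<in>{0, 1} \<times> {0, 1}. pair_sign k (g i) * pair_sign k (h i))"
    by (rule prod_sum_PiE[symmetric]) auto
  also have "\<dots> = (\<Prod>i<m. if g i = h i then 4 else 0)"
    using four standard_group_component assms by (intro prod.cong) auto
  also have "\<dots> = (if g = h then 4 ^ m else 0)"
  proof (cases "g = h")
    case False
    then obtain i where "g i \<noteq> h i" by blast
    moreover from this have "i < m"
      using assms by (force simp: carrier_standard_group PiE_iff extensional_def)
    ultimately show ?thesis using False by (auto intro!: prod_zero)
  qed simp
  finally show ?thesis .
qed

section \<open>Products and independence in an algebra with a frame\<close>

context real_alg
begin

lemma oprod_smult:
  assumes "\<And>i. i < n \<Longrightarrow> f i \<in> carrier A"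
  shows "oprod A (\<lambda>i. r i \<odot> f i) n = (\<Prod>i<n. r i) \<odot> oprod A f n"
  using assms
proof (induction n)
  case (Suc n)
  then show ?case using oprod_closed[of n f]
    by (simp add: smult_mult_left smult_mult_right smult_smult mult.commute)
qed simp

text \<open>Isolating one slot as L z R shows that the ordered product is multilinear, although its
  factors need not commute.\<close>

lemma oprod_update:
  assumes "\<And>j. j < n \<Longrightarrow> f j \<in> carrier A" "i < n"
  shows "\<exists>L\<in>carrier A. \<exists>R\<in>carrier A. \<forall>z\<in>carrier A. oprod A (f(i := z)) n = L \<otimes> z \<otimes> R"
  using assms
proof (induction n)
  case (Suc n)
  have c: "oprod A (f(i := z)) n \<in> carrier A" if "z \<in> carrier A" for z
    using Suc.prems that by (intro oprod_closed) auto
  show ?case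
  proof (cases "i = n")
    case True
    have F: "oprod A f n \<in> carrier A" using Suc.prems by (intro oprod_closed) auto
    have "oprod A (f(i := z)) n = oprod A f n" for z using True by (intro oprod_cong) auto
    then have "oprod A (f(i := z)) (Suc n) = oprod A f n \<otimes> z \<otimes> \<one>" if "z \<in> carrier A" for z
      using True F that by (simp del: fun_upd_apply) simp
    then show ?thesis using F one_closed by blast
  next
    case False
    then obtain L R where LR: "L \<in> carrier A" "R \<in> carrier A"
      "\<And>z. z \<in> carrier A \<Longrightarrow> oprod A (f(i := z)) n = L \<otimes> z \<otimes> R"
      using Suc.IH Suc.prems by (metis less_SucI less_antisym)
    have fn: "f n \<in> carrier A" using Suc.prems by simp
    have "oprod A (f(i := z)) (Suc n) = L \<otimes> z \<otimes> (R \<otimes> f n)" if "z \<in> carrier A" for z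
      using False LR fn that by (simp add: m_assoc)
    then show ?thesis using LR(1,2) fn m_closed by blast
  qed
qed simp

lemma comb4_closed: "x \<in> carrier A \<Longrightarrow> y \<in> carrier A \<Longrightarrow> comb4 A x y a b c d \<in> carrier A"
  by (simp add: comb4_def)

lemma comb4_add:
  assumes "x \<in> carrier A" "y \<in> carrier A"
  shows "comb4 A x y a b c d \<oplus> comb4 A x y a' b' c' d' = comb4 A x y (a + a') (b + b') (c + c') (d + d')"
  using assms by (simp add: comb4_def smult_l_distr a_ac)

lemma comb4_smult:
  assumes "x \<in> carrier A" "y \<in> carrier A"
  shows "r \<odot> comb4 A x y a b c d = comb4 A x y (r * a) (r * b) (r * c) (r * d)"
  using assms by (simp add: comb4_def smult_r_distr smult_smult)

text \<open>The multiplication table of the basis 1, \<open>x\<close>, \<open>y\<close>,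
  \<open>x \<otimes> y\<close>. The standard factors obey the same table by
  \<open>factor_coeff_mult\<close>, so the map that matches generators is multiplicative.\<close>

lemma comb4_mult:
  assumes xy: "x \<in> carrier A" "y \<in> carrier A" and s: "s * s = 1"
    and sq: "x \<otimes> x = s \<odot> \<one>" "y \<otimes> y = s \<odot> \<one>" and yx: "y \<otimes> x = (- 1) \<odot> (x \<otimes> y)"
  shows "comb4 A x y a b c d \<otimes> comb4 A x y a' b' c' d' = comb4 A x y
    (a * a' + s * (b * b' + c * c') - d * d')
    (a * b' + b * a' + s * (d * c' - c * d'))
    (a * c' + c * a' + s * (b * d' - d * b'))
    (a * d' + d * a' + b * c' - c * b')"
proof -
  let ?w = "x \<otimes> y"
  have w: "?w \<in> carrier A" using xy by simp
  have xw: "x \<otimes> ?w = s \<odot> y" using xy sq by (simp add: m_assoc[symmetric] smult_mult_left)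
  have wy: "?w \<otimes> y = s \<odot> x" using xy sq by (simp add: m_assoc smult_mult_right)
  have wx: "?w \<otimes> x = (- s) \<odot> y"
    using xy yx xw by (simp add: m_assoc smult_mult_right smult_smult)
  have yw: "y \<otimes> ?w = (- s) \<odot> x"
    using xy wy by (simp add: m_assoc[symmetric] yx smult_mult_left smult_smult)
  have ww: "?w \<otimes> ?w = (- 1) \<odot> \<one>"
    using xy w sq s by (simp add: m_assoc yw smult_mult_right smult_smult)
  let ?l = "comb4 A x y a b c d"
  have l: "?l \<in> carrier A" using xy by (rule comb4_closed)
  note distr = l_distr r_distr smult_r_distr smult_mult_left smult_mult_right smult_smult
  have 1: "?l \<otimes> (r \<odot> \<one>) = comb4 A x y (a * r) (b * r) (c * r) (d * r)" for r
    using l xy by (simp add: smult_mult_right comb4_smult mult.commute)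
  have 2: "?l \<otimes> (r \<odot> x) = comb4 A x y (s * b * r) (a * r) (- s * d * r) (- c * r)" for r
    using xy w by (simp add: comb4_def distr sq yx wx a_ac ac_simps)
  have 3: "?l \<otimes> (r \<odot> y) = comb4 A x y (s * c * r) (s * d * r) (a * r) (b * r)" for r
    using xy w by (simp add: comb4_def distr sq wy a_ac ac_simps)
  have 4: "?l \<otimes> (r \<odot> ?w) = comb4 A x y (- d * r) (- s * c * r) (s * b * r) (a * r)" for r
    using xy w by (simp add: comb4_def distr xw yw ww a_ac ac_simps)
  have "?l \<otimes> comb4 A x y a' b' c' d'
    = ?l \<otimes> (a' \<odot> \<one>) \<oplus> (?l \<otimes> (b' \<odot> x) \<oplus> (?l \<otimes> (c' \<odot> y) \<oplus> ?l \<otimes> (d' \<odot> ?w)))"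
    unfolding comb4_def[of A x y a' b' c' d'] using l xy w by (simp add: r_distr)
  also have "\<dots> = comb4 A x y
    (a * a' + s * (b * b' + c * c') - d * d')
    (a * b' + b * a' + s * (d * c' - c * d'))
    (a * c' + c * a' + s * (b * d' - d * b'))
    (a * d' + d * a' + b * c' - c * b')"
    unfolding 1 2 3 4 using xy by (simp add: comb4_add algebra_simps)
  finally show ?thesis .
qed

lemma word_mult:
  assumes xy: "x \<in> carrier A" "y \<in> carrier A"
    and sq: "x \<otimes> x = s \<odot> \<one>" "y \<otimes> y = s \<odot> \<one>" and yx: "y \<otimes> x = (- 1) \<odot> (x \<otimes> y)"
    and gh: "g \<in> {0, 1} \<times> {0, 1}" "h \<in> {0, 1} \<times> {0, 1}"
  shows "word A x y g \<otimes> word A x y h = word_sign s g h \<odot> word A x y (g \<otimes>\<^bsub>Z2_squared\<^esub> h)"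
proof -
  let ?p = "\<lambda>x a. if a = (1 :: int) then x else \<one>"
  have pc: "?p z a \<in> carrier A" if "z \<in> carrier A" for z a using that by simp
  have pp: "?p z a \<otimes> ?p z c = (if a = 1 \<and> c = 1 then s else 1) \<odot> ?p z ((a + c) mod 2)"
    if "z \<in> carrier A" "z \<otimes> z = s \<odot> \<one>" "a \<in> {0, 1}" "c \<in> {0, 1}" for z a c
    using that by auto
  have sw: "?p y b \<otimes> ?p x c = (if b = 1 \<and> c = 1 then - 1 else 1) \<odot> (?p x c \<otimes> ?p y b)" for b c
    using xy yx by simp
  have g: "fst g \<in> {0, 1}" "snd g \<in> {0, 1}" "fst h \<in> {0, 1}" "snd h \<in> {0, 1}" using gh by auto
  note c = pc[OF xy(1)] pc[OF xy(2)]
  have "word A x y g \<otimes> word A x y h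
    = ?p x (fst g) \<otimes> (?p y (snd g) \<otimes> ?p x (fst h)) \<otimes> ?p y (snd h)"
    unfolding word_def using c by (simp only: m_assoc m_closed)
  also have "\<dots> = (if snd g = 1 \<and> fst h = 1 then - 1 else 1) \<odot>
      ((?p x (fst g) \<otimes> ?p x (fst h)) \<otimes> (?p y (snd g) \<otimes> ?p y (snd h)))"
    unfolding sw using c by (simp only: m_assoc m_closed smult_mult_left smult_mult_right)
  also have "\<dots> = word_sign s g h \<odot> word A x y (g \<otimes>\<^bsub>Z2_squared\<^esub> h)"
    unfolding pp[OF xy(1) sq(1) g(1,3)] pp[OF xy(2) sq(2) g(2,4)] using c
    by (simp only: smult_mult_left smult_mult_right smult_smult m_closed smult_closed word_def
        mult_Z2_squared fst_conv snd_conv word_sign_def mult.assoc)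
  finally show ?thesis .
qed

context
  fixes m U V
  assumes fr: "frame A m U V" and nontriv: "\<one> \<noteq> \<zero>"
begin

lemma frame_closed: "i < m \<Longrightarrow> U i \<in> carrier A" "i < m \<Longrightarrow> V i \<in> carrier A"
  using fr by (auto simp: frame_def)

lemma frame_square: "i < m \<Longrightarrow> U i \<otimes> U i = factor_sign m i \<odot> \<one>" "i < m \<Longrightarrow> V i \<otimes> V i = factor_sign m i \<odot> \<one>"
  "i < m \<Longrightarrow> V i \<otimes> U i = (- 1) \<odot> (U i \<otimes> V i)"
  using fr by (auto simp: frame_def)

lemma frame_commute:
  assumes "i < m" "j < m" "i \<noteq> j"
  shows "U i \<otimes> U j = U j \<otimes> U i" "U i \<otimes> V j = V j \<otimes> U i" "V i \<otimes> U j = U j \<otimes> V i" "V i \<otimes> V j = V j \<otimes> V i"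
  using fr assms unfolding frame_def by metis+

lemma comb4_commute:
  assumes "i < m" "j < m" "i \<noteq> j"
  shows "comb4 A (U i) (V i) a b c d \<otimes> comb4 A (U j) (V j) a' b' c' d'
    = comb4 A (U j) (V j) a' b' c' d' \<otimes> comb4 A (U i) (V i) a b c d"
proof -
  have cl: "U i \<in> carrier A" "V i \<in> carrier A" "U j \<in> carrier A" "V j \<in> carrier A"
    using frame_closed assms by auto
  have gen: "comb4 A x y a b c d \<otimes> z = z \<otimes> comb4 A x y a b c d"
    if "x \<in> carrier A" "y \<in> carrier A" "z \<in> carrier A" "x \<otimes> z = z \<otimes> x" "y \<otimes> z = z \<otimes> y" for x y z a b c d
  proof -
    have "x \<otimes> y \<otimes> z = z \<otimes> (x \<otimes> y)"
      using that by (metis m_assoc)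
    then show ?thesis using that by (simp add: comb4_def l_distr r_distr smult_mult_left smult_mult_right)
  qed
  show ?thesis
    using cl frame_commute[OF assms] comb4_closed[OF cl(1,2)]
    by (intro gen gen[symmetric]) auto
qed

lemma word_comb4:
  assumes "g \<in> {0, 1} \<times> {0, 1}" "i < m"
  shows "word A (U i) (V i) g = comb4 A (U i) (V i) (if g = (0, 0) then 1 else 0) (if g = (1, 0) then 1 else 0)
    (if g = (0, 1) then 1 else 0) (if g = (1, 1) then 1 else 0)"
  using assms frame_closed[of i] by (auto simp: word_def comb4_def)

definition frame_basis where
  "frame_basis g = oprod A (\<lambda>i. word A (U i) (V i) (g i)) m"

lemma frame_word_closed: "i < m \<Longrightarrow> word A (U i) (V i) g \<in> carrier A"
  by (simp add: word_closed frame_closed)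

lemma frame_basis_closed: "frame_basis g \<in> carrier A"
  unfolding frame_basis_def by (rule oprod_closed) (rule frame_word_closed)

text \<open>Distinct slots commute, so ordered products multiply slot by slot.\<close>

lemma frame_basis_mult:
  assumes g: "g \<in> carrier (standard_group m)" and h: "h \<in> carrier (standard_group m)"
  shows "frame_basis g \<otimes> frame_basis h
    = (\<Prod>i<m. word_sign (factor_sign m i) (g i) (h i)) \<odot> frame_basis (g \<otimes>\<^bsub>standard_group m\<^esub> h)"
proof -
  have "frame_basis g \<otimes> frame_basis h = oprod A (\<lambda>i. word A (U i) (V i) (g i) \<otimes> word A (U i) (V i) (h i)) m"
    unfolding frame_basis_def
  proof (rule oprod_mult[symmetric])
    fix i j assume ij: "i < m" "j < m" "i \<noteq> j"
    show "word A (U i) (V i) (h i) \<otimes> word A (U j) (V j) (g j) = word A (U j) (V j) (g j) \<otimes> word A (U i) (V i) (h i)"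
      unfolding word_comb4[OF standard_group_component[OF h ij(1)] ij(1)]
        word_comb4[OF standard_group_component[OF g ij(2)] ij(2)]
      by (rule comb4_commute[OF ij])
  qed (rule frame_word_closed, assumption)+
  also have "\<dots> = oprod A (\<lambda>i. word_sign (factor_sign m i) (g i) (h i) \<odot>
      word A (U i) (V i) ((g \<otimes>\<^bsub>standard_group m\<^esub> h) i)) m"
  proof (rule oprod_cong)
    fix i assume i: "i < m"
    show "word A (U i) (V i) (g i) \<otimes> word A (U i) (V i) (h i)
      = word_sign (factor_sign m i) (g i) (h i) \<odot> word A (U i) (V i) ((g \<otimes>\<^bsub>standard_group m\<^esub> h) i)"
      using word_mult[OF frame_closed[OF i] frame_square[OF i] standard_group_component[OF g i]
          standard_group_component[OF h i]] i by (simp add: mult_standard_group)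
  qed
  also have "\<dots> = (\<Prod>i<m. word_sign (factor_sign m i) (g i) (h i)) \<odot> frame_basis (g \<otimes>\<^bsub>standard_group m\<^esub> h)"
    unfolding frame_basis_def by (rule oprod_smult) (rule frame_word_closed)
  finally show ?thesis .
qed

text \<open>In each slot the two orders of multiplication differ by \<open>pair_sign\<close>,
  whether the slot belongs to M_2(\<real>) or to \<bbbH>.\<close>

lemma frame_basis_commute:
  assumes g: "g \<in> carrier (standard_group m)" and h: "h \<in> carrier (standard_group m)"
  shows "frame_basis g \<otimes> frame_basis h = (\<Prod>i<m. pair_sign (g i) (h i)) \<odot> (frame_basis h \<otimes> frame_basis g)"
proof -
  interpret S: comm_group "standard_group m" by (rule comm_group_standard_group)
  have "word_sign (factor_sign m i) (g i) (h i)
    = pair_sign (g i) (h i) * word_sign (factor_sign m i) (h i) (g i)" if "i < m" for i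
    using standard_group_component[OF g that] standard_group_component[OF h that] factor_sign_cases[of m i]
    by (cases "g i"; cases "h i") (auto simp: word_sign_def pair_sign_def)
  then have "(\<Prod>i<m. word_sign (factor_sign m i) (g i) (h i))
    = (\<Prod>i<m. pair_sign (g i) (h i)) * (\<Prod>i<m. word_sign (factor_sign m i) (h i) (g i))"
    by (simp add: prod.distrib)
  then show ?thesis
    unfolding frame_basis_mult[OF g h] frame_basis_mult[OF h g]
    using S.m_comm[OF g h] frame_basis_closed by (simp add: smult_smult)
qed

lemma frame_basis_one: "frame_basis \<one>\<^bsub>standard_group m\<^esub> = \<one>"
proof -
  have "oprod A (\<lambda>i. \<one>) m = \<one>" by (induction m) auto
  moreover have "frame_basis \<one>\<^bsub>standard_group m\<^esub> = oprod A (\<lambda>i. \<one>) m"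
    unfolding frame_basis_def by (rule oprod_cong) (simp add: one_standard_group word_def)
  ultimately show ?thesis by simp
qed

lemma frame_basis_square:
  assumes g: "g \<in> carrier (standard_group m)"
  shows "frame_basis g \<otimes> frame_basis g = (\<Prod>i<m. form_sign (factor_sign m i) (g i)) \<odot> \<one>"
proof -
  have "g \<otimes>\<^bsub>standard_group m\<^esub> g = \<one>\<^bsub>standard_group m\<^esub>"
    using standard_group_component[OF g]
    by (auto simp: mult_standard_group one_standard_group mult_Z2_squared restrict_def fun_eq_iff)
  moreover have "(\<Prod>i<m. word_sign (factor_sign m i) (g i) (g i)) = (\<Prod>i<m. form_sign (factor_sign m i) (g i))"
  proof (rule prod.cong[OF refl])
    fix i assume "i \<in> {..<m}"
    then show "word_sign (factor_sign m i) (g i) (g i) = form_sign (factor_sign m i) (g i)"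
      using standard_group_component[OF g, of i]
      by (cases "g i") (auto simp: word_sign_def form_sign_def)
  qed
  ultimately show ?thesis using frame_basis_mult[OF g g] frame_basis_one by simp
qed

lemma form_sign_cases: "(\<Prod>i<m. form_sign (factor_sign m i) (g i)) = 1 \<or> (\<Prod>i<m. form_sign (factor_sign m i) (g i)) = - 1"
proof -
  have "(\<Prod>i<n. form_sign (factor_sign m i) (g i)) = 1 \<or> (\<Prod>i<n. form_sign (factor_sign m i) (g i)) = - 1" for n
  proof (induction n)
    case (Suc n)
    have "form_sign (factor_sign m n) (g n) = 1 \<or> form_sign (factor_sign m n) (g n) = - 1"
      using factor_sign_cases[of m n] by (auto simp: form_sign_def)
    with Suc show ?case by auto
  qed simp
  then show ?thesis .
qed

lemma frame_basis_Units:
  assumes g: "g \<in> carrier (standard_group m)"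
  shows "frame_basis g \<in> Units A"
proof -
  define s where "s = (\<Prod>i<m. form_sign (factor_sign m i) (g i))"
  have "s * s = 1" using form_sign_cases[of g] by (auto simp: s_def)
  then have "(s \<odot> frame_basis g) \<otimes> frame_basis g = \<one>" "frame_basis g \<otimes> (s \<odot> frame_basis g) = \<one>"
    using frame_basis_square[OF g] frame_basis_closed[of g]
    by (simp_all add: smult_mult_left smult_mult_right smult_smult s_def)
  then show ?thesis using frame_basis_closed[of g] unfolding Units_def by blast
qed

text \<open>Conjugation by the basis elements acts on the basis through pairwise distinct characters.\<close>

lemma frame_basis_indep: "indep A frame_basis (carrier (standard_group m))"
  unfolding indep_def
proof (intro conjI allI impI ballI)
  let ?S = "carrier (standard_group m)"
  let ?\<beta> = "\<lambda>h g. \<Prod>i<m. pair_sign (h i) (g i)"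
  show "finite ?S" by (rule finite_standard_group)
  show "frame_basis \<in> ?S \<rightarrow> carrier A" using frame_basis_closed by simp
  fix c g assume c: "(\<Oplus>g\<in>?S. c g \<odot> frame_basis g) = \<zero>" and g: "g \<in> ?S"
  \<comment> \<open>The inverse of \<open>frame_basis h\<close> is its multiple by \<open>s\<close>.
    Conjugating the relation multiplies each coefficient \<open>c g\<close> by the commutation sign
    of \<open>h\<close> and \<open>g\<close>.\<close>
  have rel: "(\<Oplus>g\<in>?S. (?\<beta> h g * c g) \<odot> frame_basis g) = \<zero>" if h: "h \<in> ?S" for h
  proof -
    define s where "s = (\<Prod>i<m. form_sign (factor_sign m i) (h i))"
    have ss: "s * s = 1" using form_sign_cases[of h] by (auto simp: s_def)
    let ?X = frame_basis
    have Xc: "?X g \<in> carrier A" for g by (rule frame_basis_closed)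
    have term_eq: "?X h \<otimes> (c g \<odot> ?X g) \<otimes> (s \<odot> ?X h) = (?\<beta> h g * c g) \<odot> ?X g" if g: "g \<in> ?S" for g
    proof -
      have "?X h \<otimes> (c g \<odot> ?X g) \<otimes> (s \<odot> ?X h) = (s * c g) \<odot> ((?X h \<otimes> ?X g) \<otimes> ?X h)"
        using Xc by (simp add: smult_mult_left smult_mult_right smult_smult)
      also have "\<dots> = (s * c g * ?\<beta> h g) \<odot> (?X g \<otimes> (?X h \<otimes> ?X h))"
        unfolding frame_basis_commute[OF h g] using Xc by (simp add: smult_mult_left smult_smult m_assoc)
      also have "\<dots> = (s * c g * ?\<beta> h g * s) \<odot> ?X g"
        unfolding frame_basis_square[OF h] s_def[symmetric] using Xc by (simp add: smult_mult_right smult_smult)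
      also have "s * c g * ?\<beta> h g * s = (s * s) * (?\<beta> h g * c g)" by (simp add: ac_simps)
      finally show ?thesis using ss by simp
    qed
    have "(\<Oplus>g\<in>?S. (?\<beta> h g * c g) \<odot> ?X g) = (\<Oplus>g\<in>?S. ?X h \<otimes> (c g \<odot> ?X g) \<otimes> (s \<odot> ?X h))"
      using Xc term_eq by (intro finsum_cong') auto
    also have "\<dots> = (\<Oplus>g\<in>?S. ?X h \<otimes> (c g \<odot> ?X g)) \<otimes> (s \<odot> ?X h)"
      using Xc by (intro finsum_ldistr[symmetric] finite_standard_group) auto
    also have "(\<Oplus>g\<in>?S. ?X h \<otimes> (c g \<odot> ?X g)) = ?X h \<otimes> (\<Oplus>g\<in>?S. c g \<odot> ?X g)"
      using Xc by (intro finsum_rdistr[symmetric] finite_standard_group) auto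
    also have "?X h \<otimes> (\<Oplus>g\<in>?S. c g \<odot> ?X g) \<otimes> (s \<odot> ?X h) = \<zero>" unfolding c using Xc by simp
    finally show ?thesis .
  qed
  \<comment> \<open>Summing the conjugated relations against the character of \<open>g\<close>
    leaves only the coefficient at \<open>g\<close>, multiplied by the group order
    \<open>4 ^ m\<close>.\<close>
  have "\<zero> = (\<Oplus>h\<in>?S. ?\<beta> h g \<odot> (\<Oplus>g'\<in>?S. (?\<beta> h g' * c g') \<odot> frame_basis g'))"
    using rel by (intro finsum_all_zero[symmetric]) simp
  also have "\<dots> = (\<Oplus>g'\<in>?S. (\<Sum>h\<in>?S. (?\<beta> h g' * c g') * ?\<beta> h g) \<odot> frame_basis g')"
    by (rule finsum_smult_swap) (simp_all add: finite_standard_group frame_basis_closed)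
  also have "\<dots> = (\<Oplus>g'\<in>?S. (if g' = g then 4 ^ m * c g else 0) \<odot> frame_basis g')"
  proof (rule finsum_cong'[OF refl])
    fix g' assume g': "g' \<in> ?S"
    have "(\<Sum>h\<in>?S. (?\<beta> h g' * c g') * ?\<beta> h g) = (\<Sum>h\<in>?S. ?\<beta> h g' * ?\<beta> h g) * c g'"
      by (simp add: sum_distrib_left sum_distrib_right ac_simps)
    then show "(\<Sum>h\<in>?S. (?\<beta> h g' * c g') * ?\<beta> h g) \<odot> frame_basis g'
      = (if g' = g then 4 ^ m * c g else 0) \<odot> frame_basis g'"
      using character_orthogonality[OF g' g] by simp
  qed (simp add: frame_basis_closed)
  also have "\<dots> = (4 ^ m * c g) \<odot> frame_basis g"
    by (subst finsum_single[where p = g]) (use g in \<open>auto simp: frame_basis_closed finite_standard_group\<close>)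
  finally have "4 ^ m * c g = 0"
    using smult_eq_zero_iff[OF frame_basis_closed] Units_nonzero[OF nontriv frame_basis_Units[OF g]] by metis
  then show "c g = 0" by simp
qed

text \<open>The independent family has as many members as the given spanning family, so it spans
  too.\<close>

lemma frame_graded_basis:
  assumes "spans A Y J" "card J = 4 ^ m"
  shows "graded_basis (standard_group m) A frame_basis"
  unfolding graded_basis_def
  using comm_group_standard_group frame_basis_indep frame_basis_Units frame_basis_mult
    indep_imp_spans[OF assms(1) frame_basis_indep] assms(2) card_standard_group by auto

end

end

section \<open>The standard factors\<close>

text \<open>Coordinates dual to \<open>factor_basis\<close>, one formula for each standard factor;
  the divisions by 2 invert the four basis matrices of M_2(\<real>).\<close>

definition factor_coeff :: "real mat + quat \<Rightarrow> int \<times> int \<Rightarrow> real" where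
  "factor_coeff x g = (case x of
     Inl M \<Rightarrow>
       (if g = (0, 0) then (M $$ (0, 0) + M $$ (1, 1)) / 2
        else if g = (1, 0) then (M $$ (1, 1) - M $$ (0, 0)) / 2
        else if g = (0, 1) then (M $$ (0, 1) + M $$ (1, 0)) / 2
        else (M $$ (1, 0) - M $$ (0, 1)) / 2)
   | Inr q \<Rightarrow>
       (if g = (0, 0) then q1 q else if g = (1, 0) then qi q else if g = (0, 1) then qj q else qk q))"

definition factor_basis :: "nat \<Rightarrow> nat \<Rightarrow> int \<times> int \<Rightarrow> real mat + quat" where
  "factor_basis m i g = (if i < m - 1 then Inl (M2_basis g) else Inr (quat_basis g))"

lemma image_algebra_simps:
  assumes "inj_on f (carrier A)"
  shows "carrier (image_algebra f A) = f ` carrier A"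
    "\<one>\<^bsub>image_algebra f A\<^esub> = f \<one>\<^bsub>A\<^esub>"
    "\<zero>\<^bsub>image_algebra f A\<^esub> = f \<zero>\<^bsub>A\<^esub>"
    "x \<in> carrier A \<Longrightarrow> y \<in> carrier A \<Longrightarrow> f x \<otimes>\<^bsub>image_algebra f A\<^esub> f y = f (x \<otimes>\<^bsub>A\<^esub> y)"
    "x \<in> carrier A \<Longrightarrow> y \<in> carrier A \<Longrightarrow> f x \<oplus>\<^bsub>image_algebra f A\<^esub> f y = f (x \<oplus>\<^bsub>A\<^esub> y)"
    "x \<in> carrier A \<Longrightarrow> r \<odot>\<^bsub>image_algebra f A\<^esub> f x = f (r \<odot>\<^bsub>A\<^esub> x)"
  using assms by (simp_all add: image_algebra_def Let_def)

lemma M2_algebra_simps: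
  "carrier M2_algebra = carrier_mat 2 2" "monoid.mult M2_algebra = (*)" "\<one>\<^bsub>M2_algebra\<^esub> = 1\<^sub>m 2"
  "add M2_algebra = (+)" "module.smult M2_algebra = (\<lambda>r. map_mat ((*\<^sub>R) r))"
  by (simp_all add: M2_algebra_def matrix_algebra_simps)

lemma quat_algebra_simps:
  "carrier quat_algebra = UNIV" "monoid.mult quat_algebra = (*)" "\<one>\<^bsub>quat_algebra\<^esub> = 1"
  "add quat_algebra = (+)" "module.smult quat_algebra = (*\<^sub>R)"
  by (simp_all add: quat_algebra_def type_algebra_def)

lemma standard_factor_low:
  assumes "i < m - 1"
  shows "carrier (standard_factor m i) = Inl ` carrier_mat 2 2"
    "\<one>\<^bsub>standard_factor m i\<^esub> = Inl (1\<^sub>m 2)"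
    "M \<in> carrier_mat 2 2 \<Longrightarrow> N \<in> carrier_mat 2 2 \<Longrightarrow> Inl M \<otimes>\<^bsub>standard_factor m i\<^esub> Inl N = Inl (M * N)"
    "M \<in> carrier_mat 2 2 \<Longrightarrow> N \<in> carrier_mat 2 2 \<Longrightarrow> Inl M \<oplus>\<^bsub>standard_factor m i\<^esub> Inl N = Inl (M + N)"
    "M \<in> carrier_mat 2 2 \<Longrightarrow> r \<odot>\<^bsub>standard_factor m i\<^esub> Inl M = Inl (map_mat ((*\<^sub>R) r) M)"
  using assms image_algebra_simps[of Inl M2_algebra]
  by (simp_all add: standard_factor_def M2_algebra_simps)

lemma standard_factor_high:
  assumes "\<not> i < m - 1"
  shows "carrier (standard_factor m i) = range Inr"
    "\<one>\<^bsub>standard_factor m i\<^esub> = Inr 1"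
    "Inr p \<otimes>\<^bsub>standard_factor m i\<^esub> Inr q = Inr (p * q)"
    "Inr p \<oplus>\<^bsub>standard_factor m i\<^esub> Inr q = Inr (p + q)"
    "r \<odot>\<^bsub>standard_factor m i\<^esub> Inr q = Inr (r *\<^sub>R q)"
  using assms image_algebra_simps[of Inr quat_algebra]
  by (simp_all add: standard_factor_def quat_algebra_simps)

lemma index_mult_2:
  assumes "M \<in> carrier_mat 2 2" "N \<in> carrier_mat 2 2" "i < 2" "j < 2"
  shows "(M * N) $$ (i, j) = M $$ (i, 0) * N $$ (0, j) + M $$ (i, 1) * (N $$ (1, j) :: real)"
proof -
  have "{0..<2 :: nat} = {0, 1}" by auto
  then show ?thesis using assms by (simp add: scalar_prod_def)
qed

lemma M2_basis_closed: "M2_basis g \<in> carrier_mat 2 2"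
  by (auto simp: M2_basis_def mat_of_rows_list_def)

context
  fixes m i :: nat
begin

lemma factor_cases:
  assumes "x \<in> carrier (standard_factor m i)"
  obtains (low) M where "i < m - 1" "x = Inl M" "M \<in> carrier_mat 2 2"
  | (high) q where "\<not> i < m - 1" "x = Inr q"
  using assms standard_factor_low(1)[of i m] standard_factor_high(1)[of i m] by (cases "i < m - 1") auto

lemma factor_closed:
  assumes "x \<in> carrier (standard_factor m i)" "y \<in> carrier (standard_factor m i)"
  shows "x \<otimes>\<^bsub>standard_factor m i\<^esub> y \<in> carrier (standard_factor m i)"
    "x \<oplus>\<^bsub>standard_factor m i\<^esub> y \<in> carrier (standard_factor m i)"
    "r \<odot>\<^bsub>standard_factor m i\<^esub> x \<in> carrier (standard_factor m i)"
    "\<one>\<^bsub>standard_factor m i\<^esub> \<in> carrier (standard_factor m i)"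
  using assms standard_factor_low[of i m] standard_factor_high[of i m] by (cases "i < m - 1"; auto)+

lemma factor_coeff_linear:
  assumes "x \<in> carrier (standard_factor m i)" "y \<in> carrier (standard_factor m i)"
  shows "factor_coeff (x \<oplus>\<^bsub>standard_factor m i\<^esub> y) g = factor_coeff x g + factor_coeff y g"
    "factor_coeff (r \<odot>\<^bsub>standard_factor m i\<^esub> x) g = r * factor_coeff x g"
proof -
  show "factor_coeff (x \<oplus>\<^bsub>standard_factor m i\<^esub> y) g = factor_coeff x g + factor_coeff y g"
    using assms(1)
  proof (cases rule: factor_cases)
    case (low M)
    moreover obtain N where "y = Inl N" "N \<in> carrier_mat 2 2"
      using assms(2) standard_factor_low(1)[OF low(1)] by auto
    ultimately show ?thesis
      by (simp add: standard_factor_low factor_coeff_def) argo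
  next
    case (high p)
    moreover obtain q where "y = Inr q" using assms(2) standard_factor_high(1)[OF high(1)] by auto
    ultimately show ?thesis by (simp add: standard_factor_high factor_coeff_def)
  qed
  show "factor_coeff (r \<odot>\<^bsub>standard_factor m i\<^esub> x) g = r * factor_coeff x g"
    using assms(1)
  proof (cases rule: factor_cases)
    case (low M)
    then show ?thesis by (simp add: standard_factor_low factor_coeff_def algebra_simps)
  next
    case (high p)
    then show ?thesis by (simp add: standard_factor_high factor_coeff_def)
  qed
qed

lemma factor_coeff_one:
  "factor_coeff \<one>\<^bsub>standard_factor m i\<^esub> g = (if g = (0, 0) then 1 else 0)"
  using standard_factor_low(2)[of i m] standard_factor_high(2)[of i m]
  by (cases "i < m - 1") (simp_all add: factor_coeff_def)

text \<open>Both factors are quaternion algebras with generators squaring to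
  \<open>factor_sign m i\<close>. One table for both spares every later argument the
  distinction.\<close>

lemma factor_coeff_mult:
  assumes x: "x \<in> carrier (standard_factor m i)" and y: "y \<in> carrier (standard_factor m i)"
  defines "a \<equiv> factor_coeff x" and "b \<equiv> factor_coeff y" and "c \<equiv> factor_coeff (x \<otimes>\<^bsub>standard_factor m i\<^esub> y)"
    and "s \<equiv> factor_sign m i"
  shows
    "c (0, 0) = a (0, 0) * b (0, 0) + s * (a (1, 0) * b (1, 0) + a (0, 1) * b (0, 1)) - a (1, 1) * b (1, 1)"
    "c (1, 0) = a (0, 0) * b (1, 0) + a (1, 0) * b (0, 0) + s * (a (1, 1) * b (0, 1) - a (0, 1) * b (1, 1))"
    "c (0, 1) = a (0, 0) * b (0, 1) + a (0, 1) * b (0, 0) + s * (a (1, 0) * b (1, 1) - a (1, 1) * b (1, 0))"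
    "c (1, 1) = a (0, 0) * b (1, 1) + a (1, 1) * b (0, 0) + a (1, 0) * b (0, 1) - a (0, 1) * b (1, 0)"
proof -
  have "c (0, 0) = a (0, 0) * b (0, 0) + s * (a (1, 0) * b (1, 0) + a (0, 1) * b (0, 1)) - a (1, 1) * b (1, 1) \<and>
    c (1, 0) = a (0, 0) * b (1, 0) + a (1, 0) * b (0, 0) + s * (a (1, 1) * b (0, 1) - a (0, 1) * b (1, 1)) \<and>
    c (0, 1) = a (0, 0) * b (0, 1) + a (0, 1) * b (0, 0) + s * (a (1, 0) * b (1, 1) - a (1, 1) * b (1, 0)) \<and>
    c (1, 1) = a (0, 0) * b (1, 1) + a (1, 1) * b (0, 0) + a (1, 0) * b (0, 1) - a (0, 1) * b (1, 0)"
    using x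
  proof (cases rule: factor_cases)
    case (low M)
    moreover obtain N where "y = Inl N" "N \<in> carrier_mat 2 2"
      using y standard_factor_low(1)[OF low(1)] by auto
    ultimately show ?thesis
      unfolding a_def b_def c_def s_def
      by (simp_all add: standard_factor_low factor_coeff_def factor_sign_def index_mult_2 del: index_mult_mat)
        (simp_all add: field_simps)
  next
    case (high p)
    moreover obtain q where "y = Inr q" using y standard_factor_high(1)[OF high(1)] by auto
    ultimately show ?thesis
      unfolding a_def b_def c_def s_def
      by (simp_all add: standard_factor_high factor_coeff_def factor_sign_def)
  qed
  then show "c (0, 0) = a (0, 0) * b (0, 0) + s * (a (1, 0) * b (1, 0) + a (0, 1) * b (0, 1)) - a (1, 1) * b (1, 1)"
    "c (1, 0) = a (0, 0) * b (1, 0) + a (1, 0) * b (0, 0) + s * (a (1, 1) * b (0, 1) - a (0, 1) * b (1, 1))"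
    "c (0, 1) = a (0, 0) * b (0, 1) + a (0, 1) * b (0, 0) + s * (a (1, 0) * b (1, 1) - a (1, 1) * b (1, 0))"
    "c (1, 1) = a (0, 0) * b (1, 1) + a (1, 1) * b (0, 0) + a (1, 0) * b (0, 1) - a (0, 1) * b (1, 0)"
    by blast+
qed

lemma factor_basis_closed: "factor_basis m i g \<in> carrier (standard_factor m i)"
  using standard_factor_low(1)[of i m] standard_factor_high(1)[of i m]
  by (cases "i < m - 1") (auto simp: factor_basis_def M2_basis_closed)

lemma factor_coeff_basis:
  assumes "g \<in> {0, 1} \<times> {0, 1}" "h \<in> {0, 1} \<times> {0, 1}"
  shows "factor_coeff (factor_basis m i g) h = (if g = h then 1 else 0)"
  using assms
  by (cases "i < m - 1")
    (auto simp: factor_basis_def factor_coeff_def M2_basis_def quat_basis_def mat_of_rows_list_def)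

lemma factor_expand:
  assumes "x \<in> carrier (standard_factor m i)"
  defines "F \<equiv> standard_factor m i" and "e \<equiv> factor_basis m i" and "c \<equiv> factor_coeff x"
  shows "x = c (0, 0) \<odot>\<^bsub>F\<^esub> e (0, 0) \<oplus>\<^bsub>F\<^esub> (c (1, 0) \<odot>\<^bsub>F\<^esub> e (1, 0) \<oplus>\<^bsub>F\<^esub>
    (c (0, 1) \<odot>\<^bsub>F\<^esub> e (0, 1) \<oplus>\<^bsub>F\<^esub> c (1, 1) \<odot>\<^bsub>F\<^esub> e (1, 1)))"
  using assms(1)
proof (cases rule: factor_cases)
  case (low M)
  have "M = map_mat ((*\<^sub>R) (c (0, 0))) (M2_basis (0, 0)) + (map_mat ((*\<^sub>R) (c (1, 0))) (M2_basis (1, 0)) +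
    (map_mat ((*\<^sub>R) (c (0, 1))) (M2_basis (0, 1)) + map_mat ((*\<^sub>R) (c (1, 1))) (M2_basis (1, 1))))"
    using low
    by (intro eq_matI)
      (auto simp: c_def factor_coeff_def M2_basis_def mat_of_rows_list_def less_Suc_eq numeral_2_eq_2 field_simps)
  then show ?thesis
    using low M2_basis_closed unfolding F_def e_def
    by (simp add: standard_factor_low factor_basis_def)
next
  case (high q)
  then show ?thesis
    unfolding F_def e_def c_def
    by (simp add: standard_factor_high factor_basis_def factor_coeff_def quat_basis_def quat_eq_iff)
qed

lemma standard_factor_grading_eq:
  "standard_factor_grading m i g = {r \<odot>\<^bsub>standard_factor m i\<^esub> factor_basis m i g | r. True}"
proof (cases "i < m - 1")
  case True
  show ?thesis using True M2_basis_closed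
    by (auto simp: standard_factor_grading_def M2_grading_def factor_basis_def standard_factor_low M2_algebra_simps)
next
  case False
  then show ?thesis
    by (auto simp: standard_factor_grading_def quat_grading_def factor_basis_def standard_factor_high quat_algebra_simps)
qed

end

section \<open>The tensor product of the standard factors\<close>

lemma lookup_free_scale: "Poly_Mapping.lookup (free_scale r p) x = r * Poly_Mapping.lookup p x"
  by (simp add: free_scale_def map.rep_eq when_def)

lemma free_scale_simps:
  "free_scale r (p + q) = free_scale r p + free_scale r q"
  "free_scale r (free_scale s p) = free_scale (r * s) p"
  "free_scale r (Poly_Mapping.single x c) = Poly_Mapping.single x (r * c)"
  "free_scale (- 1) p = - p"
  "free_scale r (p - q) = free_scale r p - free_scale r q"
  by (auto intro!: poly_mapping_eqI simp: lookup_free_scale lookup_add lookup_minus lookup_single when_def algebra_simps)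

lemma keys_free_scale: "Poly_Mapping.keys (free_scale r p) \<subseteq> Poly_Mapping.keys p"
  by (auto simp: in_keys_iff lookup_free_scale)

lemma sum_singles:
  "p = (\<Sum>x\<in>Poly_Mapping.keys p. Poly_Mapping.single x (Poly_Mapping.lookup p x))"
  by (rule poly_mapping_eqI)
    (auto simp: lookup_sum lookup_single when_def sum.delta not_in_keys_iff_lookup_eq_zero)

section \<open>Spanning of the tensor product by basis tensors\<close>

definition basis_tuple :: "nat \<Rightarrow> (nat \<Rightarrow> int \<times> int) \<Rightarrow> nat \<Rightarrow> real mat + quat" where
  "basis_tuple m g = (\<lambda>i\<in>{..<m}. factor_basis m i (g i))"

text \<open>Congruence modulo the relations to a combination of the basis tensors. It is phrased in
  the free space because no algebraic structure on the quotient is available yet.\<close>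

definition expands :: "nat \<Rightarrow> ((nat \<Rightarrow> real mat + quat) \<Rightarrow>\<^sub>0 real) \<Rightarrow> bool" where
  "expands m p \<longleftrightarrow>
     (\<exists>c. p - (\<Sum>g\<in>carrier (standard_group m). Poly_Mapping.single (basis_tuple m g) (c g))
        \<in> multilinear_relations {..<m} (standard_factor m))"

lemma expands_relation:
  assumes "p - q \<in> multilinear_relations {..<m} (standard_factor m)" "expands m q"
  shows "expands m p"
proof -
  obtain c where "q - (\<Sum>g\<in>carrier (standard_group m). Poly_Mapping.single (basis_tuple m g) (c g))
        \<in> multilinear_relations {..<m} (standard_factor m)" (is "q - ?s \<in> _")
    using assms(2) by (auto simp: expands_def)
  from multilinear_relations.plus[OF assms(1) this]
  have "p - ?s \<in> multilinear_relations {..<m} (standard_factor m)" by simp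
  then show ?thesis unfolding expands_def by blast
qed

lemma expands_add:
  assumes "expands m p" "expands m q"
  shows "expands m (p + q)"
proof -
  let ?s = "\<lambda>c. \<Sum>g\<in>carrier (standard_group m). Poly_Mapping.single (basis_tuple m g) (c g)"
  obtain c d where "p - ?s c \<in> multilinear_relations {..<m} (standard_factor m)"
    "q - ?s d \<in> multilinear_relations {..<m} (standard_factor m)"
    using assms by (auto simp: expands_def)
  from multilinear_relations.plus[OF this]
  have "p + q - ?s (\<lambda>g. c g + d g) \<in> multilinear_relations {..<m} (standard_factor m)"
    by (simp add: single_add sum.distrib algebra_simps)
  then show ?thesis unfolding expands_def by (rule exI[where x = "\<lambda>g. c g + d g"])
qed

lemma expands_scale:
  assumes "expands m p"
  shows "expands m (free_scale r p)"
proof -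
  let ?s = "\<lambda>c. \<Sum>g\<in>carrier (standard_group m). Poly_Mapping.single (basis_tuple m g) (c g)"
  obtain c where c: "p - ?s c \<in> multilinear_relations {..<m} (standard_factor m)"
    using assms by (auto simp: expands_def)
  have "free_scale r (?s c) = ?s (\<lambda>g. r * c g)"
    by (rule poly_mapping_eqI)
      (auto simp: lookup_free_scale lookup_sum lookup_single when_def sum_distrib_left intro!: sum.cong)
  then have "free_scale r p - ?s (\<lambda>g. r * c g) \<in> multilinear_relations {..<m} (standard_factor m)"
    using multilinear_relations.scale[OF c, of r] by (simp add: free_scale_simps)
  then show ?thesis unfolding expands_def by (rule exI[where x = "\<lambda>g. r * c g"])
qed

lemma expands_zero: "expands m 0"
  unfolding expands_def by (rule exI[where x = "\<lambda>_. 0"]) (simp add: multilinear_relations.zero)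

lemma expands_sum: "(\<And>x. x \<in> K \<Longrightarrow> expands m (f x)) \<Longrightarrow> expands m (\<Sum>x\<in>K. f x)"
  by (induction K rule: infinite_finite_induct) (auto simp: expands_zero expands_add)

lemma update_tuple:
  "x \<in> tuples I A \<Longrightarrow> i \<in> I \<Longrightarrow> a \<in> carrier (A i) \<Longrightarrow> x(i := a) \<in> tuples I A"
  unfolding tuples_def by (auto simp: PiE_iff extensional_def)

lemma expands_basis_tuple:
  assumes "g \<in> carrier (standard_group m)"
  shows "expands m (Poly_Mapping.single (basis_tuple m g) 1)"
proof -
  have "(\<Sum>h\<in>carrier (standard_group m). Poly_Mapping.single (basis_tuple m h) (if h = g then 1 else 0 :: real))
    = (\<Sum>h\<in>carrier (standard_group m). if h = g then Poly_Mapping.single (basis_tuple m g) 1 else 0)"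
    by (rule sum.cong) auto
  also have "\<dots> = Poly_Mapping.single (basis_tuple m g) 1"
    using assms finite_standard_group by (simp add: sum.delta)
  finally show ?thesis unfolding expands_def
    by (intro exI[where x = "\<lambda>h. if h = g then 1 else 0"]) (simp add: multilinear_relations.zero)
qed

text \<open>Multilinearity in the first \<open>n\<close> slots replaces arbitrary entries by basis elements.\<close>

lemma expands_single_aux:
  assumes "x \<in> tuples {..<m} (standard_factor m)" "n \<le> m"
    and "\<And>i. n \<le> i \<Longrightarrow> i < m \<Longrightarrow> x i \<in> factor_basis m i ` ({0, 1} \<times> {0, 1})"
  shows "expands m (Poly_Mapping.single x 1)"
  using assms
proof (induction n arbitrary: x)
  case 0
  then have "\<forall>i<m. \<exists>h\<in>{0, 1} \<times> {0, 1}. x i = factor_basis m i h" by auto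
  then obtain g where g: "\<And>i. i < m \<Longrightarrow> g i \<in> {0, 1} \<times> {0, 1} \<and> x i = factor_basis m i (g i)" by metis
  define h where "h = (\<lambda>i\<in>{..<m}. g i)"
  have "h \<in> carrier (standard_group m)" using g by (auto simp: h_def carrier_standard_group)
  moreover have "x = basis_tuple m h"
    using 0(1) g by (auto simp: basis_tuple_def h_def tuples_def PiE_iff extensional_def fun_eq_iff)
  ultimately show ?case using expands_basis_tuple by simp
next
  case (Suc n)
  let ?F = "standard_factor m" and ?R = "multilinear_relations {..<m} (standard_factor m)"
  let ?e = "factor_basis m n" and ?c = "factor_coeff (x n)"
  let ?s = "\<lambda>a. Poly_Mapping.single (x(n := a)) 1"
  have n: "n \<in> {..<m}" using Suc.prems by simp
  have xn: "x n \<in> carrier (?F n)" using Suc.prems(1) n by (auto simp: tuples_def PiE_iff)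
  note cl = factor_closed[where m = m and i = n]
  have e: "?e g \<in> carrier (?F n)" for g by (rule factor_basis_closed)
  have base: "expands m (?s (?e g))" if "g \<in> {0, 1} \<times> {0, 1}" for g
  proof (rule Suc.IH)
    show "x(n := ?e g) \<in> tuples {..<m} ?F" by (rule update_tuple[OF Suc.prems(1) n e])
    show "(x(n := ?e g)) i \<in> factor_basis m i ` ({0, 1} \<times> {0, 1})" if "n \<le> i" "i < m" for i
      using that Suc.prems(3)[of i] \<open>g \<in> _\<close> by (cases "i = n") auto
  qed (use Suc.prems in simp)
  have scal: "expands m (?s (r \<odot>\<^bsub>?F n\<^esub> a))" if "a \<in> carrier (?F n)" "expands m (?s a)" for r a
    by (rule expands_relation[OF multilinear_relations.homogeneous[OF Suc.prems(1) n that(1)]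
          expands_scale[OF that(2)]])
  have add: "expands m (?s (a \<oplus>\<^bsub>?F n\<^esub> b))"
    if "a \<in> carrier (?F n)" "b \<in> carrier (?F n)" "expands m (?s a)" "expands m (?s b)" for a b
  proof (rule expands_relation[OF _ expands_add[OF that(3,4)]])
    show "?s (a \<oplus>\<^bsub>?F n\<^esub> b) - (?s a + ?s b) \<in> ?R"
      using multilinear_relations.additive[OF Suc.prems(1) n that(1,2)] by (simp add: diff_diff_eq)
  qed
  have be: "expands m (?s (?c g \<odot>\<^bsub>?F n\<^esub> ?e g))" if "g \<in> {0, 1} \<times> {0, 1}" for g
    by (rule scal[OF e base[OF that]])
  have ce: "?c g \<odot>\<^bsub>?F n\<^esub> ?e g \<in> carrier (?F n)" for g by (rule cl(3)[OF e e])
  have "expands m (?s (?c (0, 0) \<odot>\<^bsub>?F n\<^esub> ?e (0, 0) \<oplus>\<^bsub>?F n\<^esub> (?c (1, 0) \<odot>\<^bsub>?F n\<^esub> ?e (1, 0) \<oplus>\<^bsub>?F n\<^esub>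
    (?c (0, 1) \<odot>\<^bsub>?F n\<^esub> ?e (0, 1) \<oplus>\<^bsub>?F n\<^esub> ?c (1, 1) \<odot>\<^bsub>?F n\<^esub> ?e (1, 1)))))"
    by (intro add be ce cl(2)) auto
  then have "expands m (?s (x n))" using factor_expand[OF xn] by simp
  then show ?case by simp
qed

lemma expands_all:
  assumes "Poly_Mapping.keys p \<subseteq> tuples {..<m} (standard_factor m)"
  shows "expands m p"
proof -
  have "expands m (Poly_Mapping.single x (Poly_Mapping.lookup p x))" if "x \<in> Poly_Mapping.keys p" for x
    using expands_scale[OF expands_single_aux[of x m m], of "Poly_Mapping.lookup p x"] that assms
    by (auto simp: free_scale_simps)
  then show ?thesis by (subst sum_singles) (rule expands_sum)
qed

lemma UN_constant2:
  "p \<in> P \<Longrightarrow> q \<in> Q \<Longrightarrow> (\<And>x y. x \<in> P \<Longrightarrow> y \<in> Q \<Longrightarrow> h x y = C) \<Longrightarrow> (\<Union>x\<in>P. \<Union>y\<in>Q. h x y) = C"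
  by fastforce

text \<open>The spanning family enters only as the dimension bound \<open>4 ^ m\<close>. The locale
  is used both for an explicit frame of matrices and for frames taken from an arbitrary
  grading.\<close>

locale tensor_frame = real_alg A for A :: "(real, 'a) module" (structure) +
  fixes m U V and Y :: "'j \<Rightarrow> 'a" and J
  assumes fr: "frame A m U V" and nontriv: "\<one> \<noteq> \<zero>" and sp: "spans A Y J" "card J = 4 ^ m"
begin

abbreviation "factor \<equiv> standard_factor m"
abbreviation "Tup \<equiv> tuples {..<m} (standard_factor m)"
abbreviation "Rel \<equiv> multilinear_relations {..<m} (standard_factor m)"
abbreviation "S \<equiv> carrier (standard_group m)"
abbreviation "X \<equiv> frame_basis m U V"

text \<open>The algebra homomorphism from the \<open>i\<close>-th factor that sends its generators
  of degrees a and b to \<open>U i\<close> and \<open>V i\<close>.\<close>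

definition factor_map where
  "factor_map i x = comb4 A (U i) (V i) (factor_coeff x (0, 0)) (factor_coeff x (1, 0))
     (factor_coeff x (0, 1)) (factor_coeff x (1, 1))"

lemmas UV = frame_closed[OF fr nontriv]
lemmas UV_square = frame_square[OF fr nontriv]

lemma factor_map_closed: "i < m \<Longrightarrow> factor_map i x \<in> carrier A"
  unfolding factor_map_def by (intro comb4_closed UV)

lemma factor_map_add:
  "i < m \<Longrightarrow> x \<in> carrier (factor i) \<Longrightarrow> y \<in> carrier (factor i) \<Longrightarrow>
    factor_map i (x \<oplus>\<^bsub>factor i\<^esub> y) = factor_map i x \<oplus> factor_map i y"
  by (simp add: factor_map_def comb4_add UV factor_coeff_linear)

lemma factor_map_smult:
  "i < m \<Longrightarrow> x \<in> carrier (factor i) \<Longrightarrow> factor_map i (r \<odot>\<^bsub>factor i\<^esub> x) = r \<odot> factor_map i x"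
  by (simp add: factor_map_def comb4_smult UV factor_coeff_linear(2)[where y = x])

lemma factor_map_mult:
  assumes "i < m" "x \<in> carrier (factor i)" "y \<in> carrier (factor i)"
  shows "factor_map i (x \<otimes>\<^bsub>factor i\<^esub> y) = factor_map i x \<otimes> factor_map i y"
  unfolding factor_map_def factor_coeff_mult[OF assms(2,3)]
  by (rule comb4_mult[symmetric]) (use assms UV UV_square factor_sign_square in auto)

lemma factor_map_one: "i < m \<Longrightarrow> factor_map i \<one>\<^bsub>factor i\<^esub> = \<one>"
  by (simp add: factor_map_def factor_coeff_one comb4_def UV)

lemma factor_map_basis:
  "i < m \<Longrightarrow> g \<in> {0, 1} \<times> {0, 1} \<Longrightarrow> factor_map i (factor_basis m i g) = word A (U i) (V i) g"
  unfolding factor_map_def by (subst word_comb4[OF fr nontriv]) (simp_all add: factor_coeff_basis)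

text \<open>The value \<open>\<zero>\<close> outside the tuples makes the linear extension total.\<close>

definition tuple_map where
  "tuple_map x = (if x \<in> Tup then oprod A (\<lambda>i. factor_map i (x i)) m else \<zero>)"

definition free_map where
  "free_map p = (\<Oplus>x\<in>Poly_Mapping.keys p. Poly_Mapping.lookup p x \<odot> tuple_map x)"

lemma tuple_map_closed [simp]: "tuple_map x \<in> carrier A"
  unfolding tuple_map_def by (simp add: oprod_closed factor_map_closed)

lemma tuple_component: "x \<in> Tup \<Longrightarrow> i < m \<Longrightarrow> x i \<in> carrier (factor i)"
  by (auto simp: tuples_def PiE_iff)

lemma tuple_map_update:
  assumes x: "x \<in> Tup" and i: "i < m"
  shows "\<exists>L\<in>carrier A. \<exists>R\<in>carrier A. \<forall>a\<in>carrier (factor i). tuple_map (x(i := a)) = L \<otimes> factor_map i a \<otimes> R"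
proof -
  obtain L R where LR: "L \<in> carrier A" "R \<in> carrier A"
    "\<And>z. z \<in> carrier A \<Longrightarrow> oprod A ((\<lambda>j. factor_map j (x j))(i := z)) m = L \<otimes> z \<otimes> R"
    using oprod_update[of m "\<lambda>j. factor_map j (x j)" i] factor_map_closed i by blast
  have "tuple_map (x(i := a)) = L \<otimes> factor_map i a \<otimes> R" if a: "a \<in> carrier (factor i)" for a
  proof -
    have "oprod A (\<lambda>j. factor_map j ((x(i := a)) j)) m = oprod A ((\<lambda>j. factor_map j (x j))(i := factor_map i a)) m"
      by (rule oprod_cong) auto
    then show ?thesis
      using LR(3)[OF factor_map_closed[OF i]] update_tuple[OF x _ a] i by (simp add: tuple_map_def)
  qed
  then show ?thesis using LR(1,2) by blast
qed

lemma tuple_map_mult: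
  assumes "x \<in> Tup" "y \<in> Tup"
  shows "tuple_map (\<lambda>i\<in>{..<m}. x i \<otimes>\<^bsub>factor i\<^esub> y i) = tuple_map x \<otimes> tuple_map y"
    and "(\<lambda>i\<in>{..<m}. x i \<otimes>\<^bsub>factor i\<^esub> y i) \<in> Tup"
proof -
  show t: "(\<lambda>i\<in>{..<m}. x i \<otimes>\<^bsub>factor i\<^esub> y i) \<in> Tup"
    using tuple_component[OF assms(1)] tuple_component[OF assms(2)] factor_closed(1)
    unfolding tuples_def by auto
  have "oprod A (\<lambda>i. factor_map i ((\<lambda>i\<in>{..<m}. x i \<otimes>\<^bsub>factor i\<^esub> y i) i)) m
    = oprod A (\<lambda>i. factor_map i (x i) \<otimes> factor_map i (y i)) m"
    using tuple_component assms by (intro oprod_cong) (simp add: factor_map_mult)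
  also have "\<dots> = oprod A (\<lambda>i. factor_map i (x i)) m \<otimes> oprod A (\<lambda>i. factor_map i (y i)) m"
  proof (rule oprod_mult)
    fix i j assume "i < m" "j < m" "i \<noteq> j"
    then show "factor_map i (y i) \<otimes> factor_map j (x j) = factor_map j (x j) \<otimes> factor_map i (y i)"
      unfolding factor_map_def by (rule comb4_commute[OF fr nontriv])
  qed (rule factor_map_closed, assumption)+
  finally show "tuple_map (\<lambda>i\<in>{..<m}. x i \<otimes>\<^bsub>factor i\<^esub> y i) = tuple_map x \<otimes> tuple_map y"
    using t assms by (simp only: tuple_map_def if_True)
qed

lemma free_map_superset:
  assumes "finite K" "Poly_Mapping.keys p \<subseteq> K"
  shows "free_map p = (\<Oplus>x\<in>K. Poly_Mapping.lookup p x \<odot> tuple_map x)"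
  unfolding free_map_def using assms
  by (intro finsum_mono_neutral) (auto simp: in_keys_iff)

lemma free_map_closed [simp]: "free_map p \<in> carrier A"
  unfolding free_map_def by (intro finsum_closed) simp

lemma free_map_add: "free_map (p + q) = free_map p \<oplus> free_map q"
proof -
  let ?K = "Poly_Mapping.keys p \<union> Poly_Mapping.keys q"
  have "free_map (p + q) = (\<Oplus>x\<in>?K. Poly_Mapping.lookup p x \<odot> tuple_map x \<oplus> Poly_Mapping.lookup q x \<odot> tuple_map x)"
    using Poly_Mapping.keys_add[of p q]
    by (subst free_map_superset[of ?K]) (auto simp: lookup_add smult_l_distr)
  also have "\<dots> = (\<Oplus>x\<in>?K. Poly_Mapping.lookup p x \<odot> tuple_map x) \<oplus> (\<Oplus>x\<in>?K. Poly_Mapping.lookup q x \<odot> tuple_map x)"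
    by (rule finsum_addf) auto
  also have "\<dots> = free_map p \<oplus> free_map q"
    by (subst (1 2) free_map_superset[of ?K]) auto
  finally show ?thesis .
qed

lemma free_map_scale: "free_map (free_scale r p) = r \<odot> free_map p"
proof -
  have "free_map (free_scale r p) = (\<Oplus>x\<in>Poly_Mapping.keys p. r \<odot> (Poly_Mapping.lookup p x \<odot> tuple_map x))"
    using keys_free_scale[of r p]
    by (subst free_map_superset[of "Poly_Mapping.keys p"]) (auto simp: lookup_free_scale smult_smult)
  also have "\<dots> = r \<odot> free_map p"
    unfolding free_map_def by (rule finsum_smult[symmetric]) simp
  finally show ?thesis .
qed

lemma free_map_diff: "free_map (p - q) = free_map p \<oplus> (- 1) \<odot> free_map q"
  using free_map_add[of p "- q"] free_map_scale[of "- 1" q] by (simp add: free_scale_simps)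

lemma free_map_single: "free_map (Poly_Mapping.single x c) = c \<odot> tuple_map x"
  by (subst free_map_superset[of "{x}"]) auto

lemma free_map_zero: "free_map 0 = \<zero>"
  by (simp add: free_map_def)

lemma free_map_sum: "finite K \<Longrightarrow> free_map (\<Sum>i\<in>K. f i) = (\<Oplus>i\<in>K. free_map (f i))"
  by (induction K rule: finite_induct) (auto simp: free_map_zero free_map_add)

text \<open>A generating relation changes a single slot, and in that slot \<open>tuple_map\<close>
  is the linear \<open>factor_map\<close> between two fixed factors.\<close>

lemma free_map_relations: "p \<in> Rel \<Longrightarrow> free_map p = \<zero>"
proof (induction rule: multilinear_relations.induct)
  case (additive x i a b)
  then obtain L R where LR: "L \<in> carrier A" "R \<in> carrier A"
    "\<And>a. a \<in> carrier (factor i) \<Longrightarrow> tuple_map (x(i := a)) = L \<otimes> factor_map i a \<otimes> R"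
    using tuple_map_update[of x i] by blast
  have i: "i < m" using additive by simp
  have cl: "factor_map i a \<in> carrier A" "factor_map i b \<in> carrier A" using factor_map_closed i by auto
  have "tuple_map (x(i := a \<oplus>\<^bsub>factor i\<^esub> b)) = tuple_map (x(i := a)) \<oplus> tuple_map (x(i := b))"
    using additive LR cl i factor_closed(2)[of a m i b]
    by (simp add: factor_map_add l_distr r_distr)
  then have "tuple_map (x(i := a \<oplus>\<^bsub>factor i\<^esub> b)) \<oplus> \<ominus> (tuple_map (x(i := a)) \<oplus> tuple_map (x(i := b))) = \<zero>"
    by (simp add: r_neg)
  then show ?case
    by (simp add: free_map_diff free_map_single smult_minus_one a_assoc minus_add)
next
  case (homogeneous x i a r)
  then obtain L R where LR: "L \<in> carrier A" "R \<in> carrier A"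
    "\<And>a. a \<in> carrier (factor i) \<Longrightarrow> tuple_map (x(i := a)) = L \<otimes> factor_map i a \<otimes> R"
    using tuple_map_update[of x i] by blast
  have i: "i < m" using homogeneous by simp
  have cl: "factor_map i a \<in> carrier A" using factor_map_closed i by auto
  have "tuple_map (x(i := r \<odot>\<^bsub>factor i\<^esub> a)) = r \<odot> tuple_map (x(i := a))"
    using homogeneous LR cl i factor_closed(3)[of a m i a r]
    by (simp add: factor_map_smult smult_mult_left smult_mult_right)
  then show ?case
    by (simp add: free_map_diff free_map_single free_map_scale smult_minus_one r_neg)
qed (simp_all add: free_map_zero free_map_add free_map_scale)

lemma basis_tuple_in_Tup: "basis_tuple m g \<in> Tup"
  by (auto simp: basis_tuple_def tuples_def factor_basis_closed)

lemma tuple_map_basis: "g \<in> S \<Longrightarrow> tuple_map (basis_tuple m g) = X g"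
  using basis_tuple_in_Tup[of g] standard_group_component[of g m]
  by (auto simp: tuple_map_def frame_basis_def[OF fr nontriv] basis_tuple_def factor_map_basis intro!: oprod_cong)

text \<open>Modulo the relations \<open>p\<close> is a combination of basis tensors. Their images
  are the independent elements of the frame basis, so all coefficients vanish.\<close>

lemma free_map_eq_zeroD:
  assumes "Poly_Mapping.keys p \<subseteq> Tup" "free_map p = \<zero>"
  shows "p \<in> Rel"
proof -
  obtain c where c: "p - (\<Sum>g\<in>S. Poly_Mapping.single (basis_tuple m g) (c g)) \<in> Rel" (is "p - ?s \<in> Rel")
    using expands_all[OF assms(1)] by (auto simp: expands_def)
  have "free_map ?s = (\<Oplus>g\<in>S. free_map (Poly_Mapping.single (basis_tuple m g) (c g)))"
    by (rule free_map_sum[OF finite_standard_group])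
  also have "\<dots> = (\<Oplus>g\<in>S. c g \<odot> X g)"
    by (rule finsum_cong') (auto simp: free_map_single tuple_map_basis frame_basis_closed[OF fr nontriv])
  finally have s: "free_map ?s = (\<Oplus>g\<in>S. c g \<odot> X g)" .
  have "\<zero> = free_map p \<oplus> (- 1) \<odot> free_map ?s" using free_map_relations[OF c] by (simp only: free_map_diff)
  then have "(- 1) \<odot> free_map ?s = \<zero>" using assms(2) by simp
  then have "free_map ?s = \<zero>" unfolding smult_eq_zero_iff[OF free_map_closed] by simp
  then have "(\<Oplus>g\<in>S. c g \<odot> X g) = \<zero>" using s by simp
  then have "\<And>g. g \<in> S \<Longrightarrow> c g = 0" using indepD[OF frame_basis_indep[OF fr nontriv]] by blast
  then have "?s = 0" by (intro sum.neutral) auto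
  then show ?thesis using c by simp
qed

lemma free_map_surj:
  assumes "a \<in> carrier A"
  shows "\<exists>p. Poly_Mapping.keys p \<subseteq> Tup \<and> free_map p = a"
proof -
  have "spans A X S" using frame_graded_basis[OF fr nontriv sp] by (simp add: graded_basis_def)
  then obtain c where c: "a = (\<Oplus>g\<in>S. c g \<odot> X g)" using assms unfolding spans_def by blast
  let ?s = "\<Sum>g\<in>S. Poly_Mapping.single (basis_tuple m g) (c g)"
  have "free_map ?s = (\<Oplus>g\<in>S. free_map (Poly_Mapping.single (basis_tuple m g) (c g)))"
    by (rule free_map_sum[OF finite_standard_group])
  also have "\<dots> = a"
    unfolding c by (rule finsum_cong') (auto simp: free_map_single tuple_map_basis frame_basis_closed[OF fr nontriv])
  finally have "free_map ?s = a" .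
  moreover have "Poly_Mapping.keys ?s \<subseteq> Tup"
    using basis_tuple_in_Tup by (intro order.trans[OF keys_sum]) auto
  ultimately show ?thesis by blast
qed

lemma free_map_mult:
  assumes "Poly_Mapping.keys p \<subseteq> Tup" "Poly_Mapping.keys q \<subseteq> Tup"
  shows "free_map (free_mult {..<m} factor p q) = free_map p \<otimes> free_map q"
    and "Poly_Mapping.keys (free_mult {..<m} factor p q) \<subseteq> Tup"
proof -
  let ?p = "Poly_Mapping.lookup p" and ?q = "Poly_Mapping.lookup q"
  let ?K = "Poly_Mapping.keys p" and ?L = "Poly_Mapping.keys q"
  let ?xy = "\<lambda>x y. \<lambda>i\<in>{..<m}. x i \<otimes>\<^bsub>factor i\<^esub> y i"
  have "free_map (free_mult {..<m} factor p q)
    = (\<Oplus>x\<in>?K. free_map (\<Sum>y\<in>?L. Poly_Mapping.single (?xy x y) (?p x * ?q y)))"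
    unfolding free_mult_def by (rule free_map_sum) simp
  also have "\<dots> = (\<Oplus>x\<in>?K. (?p x \<odot> tuple_map x) \<otimes> free_map q)"
  proof (rule finsum_cong'[OF refl])
    fix x assume x: "x \<in> ?K"
    have "free_map (\<Sum>y\<in>?L. Poly_Mapping.single (?xy x y) (?p x * ?q y))
      = (\<Oplus>y\<in>?L. free_map (Poly_Mapping.single (?xy x y) (?p x * ?q y)))"
      by (rule free_map_sum) simp
    also have "\<dots> = (\<Oplus>y\<in>?L. (?p x \<odot> tuple_map x) \<otimes> (?q y \<odot> tuple_map y))"
    proof (rule finsum_cong'[OF refl])
      fix y assume y: "y \<in> ?L"
      have "tuple_map (?xy x y) = tuple_map x \<otimes> tuple_map y"
        using x y assms by (intro tuple_map_mult) auto
      then show "free_map (Poly_Mapping.single (?xy x y) (?p x * ?q y))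
        = (?p x \<odot> tuple_map x) \<otimes> (?q y \<odot> tuple_map y)"
        by (simp add: free_map_single smult_mult_left smult_mult_right smult_smult mult.commute)
    qed simp
    also have "\<dots> = (?p x \<odot> tuple_map x) \<otimes> free_map q"
      unfolding free_map_def by (rule finsum_rdistr[symmetric]) auto
    finally show "free_map (\<Sum>y\<in>?L. Poly_Mapping.single (?xy x y) (?p x * ?q y))
      = (?p x \<odot> tuple_map x) \<otimes> free_map q" .
  qed simp
  also have "\<dots> = (\<Oplus>x\<in>?K. ?p x \<odot> tuple_map x) \<otimes> free_map q"
    by (rule finsum_ldistr[symmetric]) auto
  also have "\<dots> = free_map p \<otimes> free_map q" by (simp only: free_map_def)
  finally show "free_map (free_mult {..<m} factor p q) = free_map p \<otimes> free_map q" .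
  have "Poly_Mapping.keys (Poly_Mapping.single (?xy x y) (?p x * ?q y)) \<subseteq> Tup" if "x \<in> ?K" "y \<in> ?L" for x y
    using that assms tuple_map_mult(2)[of x y] by auto
  then show "Poly_Mapping.keys (free_mult {..<m} factor p q) \<subseteq> Tup"
    unfolding free_mult_def
    by (intro order.trans[OF keys_sum] UN_least order.trans[OF keys_sum]) auto
qed

text \<open>With the kernel known, a class of the quotient is a fibre of \<open>free_map\<close>;
  equality of classes becomes an equation in \<open>A\<close>.\<close>

lemma tensor_class_eq:
  assumes "Poly_Mapping.keys p \<subseteq> Tup"
  shows "tensor_class {..<m} factor p = {q. Poly_Mapping.keys q \<subseteq> Tup \<and> free_map q = free_map p}"
proof -
  have "q - p \<in> Rel \<longleftrightarrow> free_map q = free_map p" if q: "Poly_Mapping.keys q \<subseteq> Tup" for q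
  proof -
    have "q - p \<in> Rel \<longleftrightarrow> free_map (q - p) = \<zero>"
      using free_map_relations free_map_eq_zeroD[of "q - p"] keys_diff[of q p] q assms by blast
    also have "\<dots> \<longleftrightarrow> free_map q = free_map p"
      unfolding free_map_diff
      by (simp add: smult_minus_one minus_eq[symmetric])
    finally show ?thesis .
  qed
  then show ?thesis by (auto simp: tensor_class_def)
qed

section \<open>The isomorphism from the tensor product\<close>

definition tensor_map where
  "tensor_map P = free_map (SOME p. p \<in> P)"

text \<open>All members of a class have the same image, so the chosen representative does not
  matter.\<close>

lemma tensor_map_class:
  assumes "Poly_Mapping.keys p \<subseteq> Tup"
  shows "tensor_map (tensor_class {..<m} factor p) = free_map p"
proof -
  have "(SOME q. q \<in> tensor_class {..<m} factor p) \<in> tensor_class {..<m} factor p"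
    by (rule someI[of "\<lambda>q. q \<in> tensor_class {..<m} factor p" p]) (simp add: tensor_class_eq assms)
  then show ?thesis unfolding tensor_map_def tensor_class_eq[OF assms] by blast
qed

lemma tensor_class_cong:
  assumes "Poly_Mapping.keys p \<subseteq> Tup" "Poly_Mapping.keys q \<subseteq> Tup"
  shows "tensor_class {..<m} factor p = tensor_class {..<m} factor q \<longleftrightarrow> free_map p = free_map q"
proof
  assume "tensor_class {..<m} factor p = tensor_class {..<m} factor q"
  then show "free_map p = free_map q" using tensor_map_class assms by metis
qed (simp add: tensor_class_eq assms)

lemma standard_algebra_carrier:
  "carrier (standard_algebra m) = tensor_class {..<m} factor ` {p. Poly_Mapping.keys p \<subseteq> Tup}"
  by (simp add: standard_algebra_def tensor_algebra_def)

text \<open>The operations are unions over all representatives. Since \<open>free_map\<close>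
  respects sums, products and scalars, every representative yields the same class and the union
  collapses.\<close>

lemma standard_algebra_ops:
  assumes p: "Poly_Mapping.keys p \<subseteq> Tup" and q: "Poly_Mapping.keys q \<subseteq> Tup"
  shows "tensor_class {..<m} factor p \<otimes>\<^bsub>standard_algebra m\<^esub> tensor_class {..<m} factor q
      = tensor_class {..<m} factor (free_mult {..<m} factor p q)"
    "tensor_class {..<m} factor p \<oplus>\<^bsub>standard_algebra m\<^esub> tensor_class {..<m} factor q
      = tensor_class {..<m} factor (p + q)"
    "r \<odot>\<^bsub>standard_algebra m\<^esub> tensor_class {..<m} factor p = tensor_class {..<m} factor (free_scale r p)"
proof -
  let ?t = "tensor_class {..<m} factor"
  have mem: "p' \<in> ?t p \<Longrightarrow> Poly_Mapping.keys p' \<subseteq> Tup \<and> free_map p' = free_map p" for p'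
    by (simp add: tensor_class_eq p)
  have memq: "q' \<in> ?t q \<Longrightarrow> Poly_Mapping.keys q' \<subseteq> Tup \<and> free_map q' = free_map q" for q'
    by (simp add: tensor_class_eq q)
  have in_p: "p \<in> ?t p" "q \<in> ?t q" by (simp_all add: tensor_class_eq p q)
  have "?t (free_mult {..<m} factor p' q') = ?t (free_mult {..<m} factor p q)" if "p' \<in> ?t p" "q' \<in> ?t q" for p' q'
    using mem[OF that(1)] memq[OF that(2)] free_map_mult p q by (subst tensor_class_cong) simp_all
  then have "(\<Union>p'\<in>?t p. \<Union>q'\<in>?t q. ?t (free_mult {..<m} factor p' q')) = ?t (free_mult {..<m} factor p q)"
    by (rule UN_constant2[OF in_p])
  then show "?t p \<otimes>\<^bsub>standard_algebra m\<^esub> ?t q = ?t (free_mult {..<m} factor p q)"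
    by (simp add: standard_algebra_def tensor_algebra_def)
  have ka: "Poly_Mapping.keys (p' + q') \<subseteq> Tup" if "Poly_Mapping.keys p' \<subseteq> Tup" "Poly_Mapping.keys q' \<subseteq> Tup" for p' q'
    using Poly_Mapping.keys_add[of p' q'] that by blast
  have "?t (p' + q') = ?t (p + q)" if "p' \<in> ?t p" "q' \<in> ?t q" for p' q'
    using mem[OF that(1)] memq[OF that(2)] ka[of p q] ka[of p' q'] p q
    by (subst tensor_class_cong) (simp_all add: free_map_add)
  then have "(\<Union>p'\<in>?t p. \<Union>q'\<in>?t q. ?t (p' + q')) = ?t (p + q)"
    by (rule UN_constant2[OF in_p])
  then show "?t p \<oplus>\<^bsub>standard_algebra m\<^esub> ?t q = ?t (p + q)"
    by (simp add: standard_algebra_def tensor_algebra_def)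
  have ks: "Poly_Mapping.keys (free_scale r p') \<subseteq> Tup" if "Poly_Mapping.keys p' \<subseteq> Tup" for p'
    using keys_free_scale[of r p'] that by blast
  have "?t (free_scale r p') = ?t (free_scale r p)" if "p' \<in> ?t p" for p'
    using mem[OF that] p ks by (subst tensor_class_cong) (simp_all add: free_map_scale)
  then have "(\<Union>p'\<in>?t p. ?t (free_scale r p')) = ?t (free_scale r p)"
    using UN_constant2[OF in_p(1) UNIV_I, of "\<lambda>p' _. ?t (free_scale r p')"] by simp
  then show "r \<odot>\<^bsub>standard_algebra m\<^esub> ?t p = ?t (free_scale r p)"
    by (simp add: standard_algebra_def tensor_algebra_def)
qed

lemma tensor_map_bij: "bij_betw tensor_map (carrier (standard_algebra m)) (carrier A)"
  unfolding bij_betw_def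
proof
  show "inj_on tensor_map (carrier (standard_algebra m))"
  proof (rule inj_onI)
    fix P Q assume PQ: "P \<in> carrier (standard_algebra m)" "Q \<in> carrier (standard_algebra m)"
      and eq: "tensor_map P = tensor_map Q"
    then obtain p q where "P = tensor_class {..<m} factor p" "Poly_Mapping.keys p \<subseteq> Tup"
      "Q = tensor_class {..<m} factor q" "Poly_Mapping.keys q \<subseteq> Tup"
      by (auto simp: standard_algebra_carrier)
    then show "P = Q" using eq tensor_class_cong[of p q] by (simp add: tensor_map_class)
  qed
  show "tensor_map ` carrier (standard_algebra m) = carrier A"
  proof (intro equalityI subsetI)
    fix a assume "a \<in> carrier A"
    then obtain p where "Poly_Mapping.keys p \<subseteq> Tup" "free_map p = a" using free_map_surj by blast
    then show "a \<in> tensor_map ` carrier (standard_algebra m)"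
      by (intro image_eqI[of _ _ "tensor_class {..<m} factor p"]) (simp_all add: standard_algebra_carrier tensor_map_class)
  qed (auto simp: standard_algebra_carrier tensor_map_class)
qed

lemma tensor_map_hom:
  assumes P: "P \<in> carrier (standard_algebra m)" and Q: "Q \<in> carrier (standard_algebra m)"
  shows "tensor_map (P \<otimes>\<^bsub>standard_algebra m\<^esub> Q) = tensor_map P \<otimes> tensor_map Q"
    "tensor_map (P \<oplus>\<^bsub>standard_algebra m\<^esub> Q) = tensor_map P \<oplus> tensor_map Q"
    "tensor_map (r \<odot>\<^bsub>standard_algebra m\<^esub> P) = r \<odot> tensor_map P"
    "P \<otimes>\<^bsub>standard_algebra m\<^esub> Q \<in> carrier (standard_algebra m)"
    "P \<oplus>\<^bsub>standard_algebra m\<^esub> Q \<in> carrier (standard_algebra m)"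
    "r \<odot>\<^bsub>standard_algebra m\<^esub> P \<in> carrier (standard_algebra m)"
proof -
  obtain p where p: "P = tensor_class {..<m} factor p" "Poly_Mapping.keys p \<subseteq> Tup"
    using P by (auto simp: standard_algebra_carrier)
  obtain q where q: "Q = tensor_class {..<m} factor q" "Poly_Mapping.keys q \<subseteq> Tup"
    using Q by (auto simp: standard_algebra_carrier)
  have ka: "Poly_Mapping.keys (p + q) \<subseteq> Tup" using Poly_Mapping.keys_add[of p q] p q by blast
  have ks: "Poly_Mapping.keys (free_scale r p) \<subseteq> Tup" using keys_free_scale[of r p] p by blast
  note km = free_map_mult[OF p(2) q(2)]
  note ops = standard_algebra_ops[OF p(2) q(2), folded p(1) q(1)]
  show "tensor_map (P \<otimes>\<^bsub>standard_algebra m\<^esub> Q) = tensor_map P \<otimes> tensor_map Q"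
    unfolding ops using p q km by (simp add: tensor_map_class)
  show "tensor_map (P \<oplus>\<^bsub>standard_algebra m\<^esub> Q) = tensor_map P \<oplus> tensor_map Q"
    unfolding ops using p q ka by (simp add: tensor_map_class free_map_add)
  show "tensor_map (r \<odot>\<^bsub>standard_algebra m\<^esub> P) = r \<odot> tensor_map P"
    unfolding ops using p ks by (simp add: tensor_map_class free_map_scale)
  show "P \<otimes>\<^bsub>standard_algebra m\<^esub> Q \<in> carrier (standard_algebra m)"
    "P \<oplus>\<^bsub>standard_algebra m\<^esub> Q \<in> carrier (standard_algebra m)"
    "r \<odot>\<^bsub>standard_algebra m\<^esub> P \<in> carrier (standard_algebra m)"
    unfolding ops using km ka ks by (auto simp: standard_algebra_carrier)
qed

lemma tensor_map_one_zero:
  "\<one>\<^bsub>standard_algebra m\<^esub> \<in> carrier (standard_algebra m)" "tensor_map \<one>\<^bsub>standard_algebra m\<^esub> = \<one>"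
  "\<zero>\<^bsub>standard_algebra m\<^esub> \<in> carrier (standard_algebra m)" "tensor_map \<zero>\<^bsub>standard_algebra m\<^esub> = \<zero>"
proof -
  let ?u = "\<lambda>i\<in>{..<m}. \<one>\<^bsub>factor i\<^esub>"
  have u: "?u \<in> Tup" using factor_closed(4)[OF factor_basis_closed factor_basis_closed] by (auto simp: tuples_def)
  have one: "\<one>\<^bsub>standard_algebra m\<^esub> = tensor_class {..<m} factor (Poly_Mapping.single ?u 1)"
    by (simp add: standard_algebra_def tensor_algebra_def)
  have zero: "\<zero>\<^bsub>standard_algebra m\<^esub> = tensor_class {..<m} factor 0"
    by (simp add: standard_algebra_def tensor_algebra_def)
  show "\<one>\<^bsub>standard_algebra m\<^esub> \<in> carrier (standard_algebra m)" "\<zero>\<^bsub>standard_algebra m\<^esub> \<in> carrier (standard_algebra m)"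
    unfolding one zero standard_algebra_carrier using u by auto
  have "oprod A (\<lambda>i. factor_map i (?u i)) m = oprod A (\<lambda>i. \<one>) m"
    by (rule oprod_cong) (simp add: factor_map_one)
  also have "oprod A (\<lambda>i. \<one>) n = \<one>" for n by (induction n) auto
  finally have "tuple_map ?u = \<one>" using u by (simp only: tuple_map_def if_True)
  then show "tensor_map \<one>\<^bsub>standard_algebra m\<^esub> = \<one>"
    unfolding one using u by (simp add: tensor_map_class free_map_single)
  show "tensor_map \<zero>\<^bsub>standard_algebra m\<^esub> = \<zero>"
    unfolding zero by (simp add: tensor_map_class free_map_zero)
qed

lemma tensor_map_iso: "tensor_map \<in> algebra_iso (standard_algebra m) A"
proof -
  have "tensor_map \<in> ring_iso (standard_algebra m) A"
  proof (rule ring_iso_memI)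
    show "tensor_map P \<in> carrier A" if "P \<in> carrier (standard_algebra m)" for P
      using tensor_map_bij that by (rule bij_betw_apply)
  qed (use tensor_map_bij tensor_map_hom tensor_map_one_zero in auto)
  then show ?thesis using tensor_map_hom(3) by (auto simp: algebra_iso_def)
qed

lemma tuple_map_homogeneous:
  assumes g: "g \<in> S" and x: "x \<in> (\<Pi>\<^sub>E i\<in>{..<m}. standard_factor_grading m i (g i))"
  shows "x \<in> Tup" "\<exists>r. tuple_map x = r \<odot> X g"
proof -
  have "\<forall>i<m. \<exists>r. x i = r \<odot>\<^bsub>factor i\<^esub> factor_basis m i (g i)"
    using x by (auto simp: PiE_iff standard_factor_grading_eq)
  then obtain r where r: "\<And>i. i < m \<Longrightarrow> x i = r i \<odot>\<^bsub>factor i\<^esub> factor_basis m i (g i)" by metis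
  show t: "x \<in> Tup"
    using x r factor_closed(3)[OF factor_basis_closed factor_basis_closed] by (auto simp: tuples_def PiE_iff)
  have "tuple_map x = oprod A (\<lambda>i. r i \<odot> word A (U i) (V i) (g i)) m"
    unfolding tuple_map_def using t standard_group_component[OF g]
    by (auto simp: r factor_map_smult factor_basis_closed factor_map_basis intro!: oprod_cong)
  also have "\<dots> = (\<Prod>i<m. r i) \<odot> X g"
    unfolding frame_basis_def[OF fr nontriv] by (rule oprod_smult) (rule frame_word_closed[OF fr nontriv])
  finally show "\<exists>r. tuple_map x = r \<odot> X g" by blast
qed

text \<open>Every pure tensor of degree \<open>g\<close> maps to a multiple of \<open>X g\<close>,
  and the basis tuple attains \<open>X g\<close> itself, so the image is the whole line.\<close>

lemma tensor_map_grading: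
  assumes g: "g \<in> S"
  shows "tensor_map ` standard_grading m g = line A (X g)"
    and "standard_grading m g \<subseteq> carrier (standard_algebra m)"
proof -
  let ?H = "\<Pi>\<^sub>E i\<in>{..<m}. standard_factor_grading m i (g i)"
  have H: "?H \<subseteq> Tup" using tuple_map_homogeneous(1)[OF g] by blast
  have gr: "standard_grading m g = tensor_class {..<m} factor ` {p. Poly_Mapping.keys p \<subseteq> ?H}"
    by (simp add: standard_grading_def tensor_grading_def)
  show "standard_grading m g \<subseteq> carrier (standard_algebra m)"
    unfolding gr standard_algebra_carrier using H by auto
  have "tensor_map ` standard_grading m g = free_map ` {p. Poly_Mapping.keys p \<subseteq> ?H}"
    unfolding gr image_image using H by (intro image_cong refl tensor_map_class) auto
  also have "\<dots> = line A (X g)"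
  proof (intro equalityI subsetI)
    fix a assume "a \<in> free_map ` {p. Poly_Mapping.keys p \<subseteq> ?H}"
    then obtain p where p: "Poly_Mapping.keys p \<subseteq> ?H" "a = free_map p" by blast
    have "\<forall>x\<in>Poly_Mapping.keys p. \<exists>r. tuple_map x = r \<odot> X g" using tuple_map_homogeneous(2)[OF g] p by blast
    then obtain r where r: "\<And>x. x \<in> Poly_Mapping.keys p \<Longrightarrow> tuple_map x = r x \<odot> X g" by metis
    have "a = (\<Oplus>x\<in>Poly_Mapping.keys p. (Poly_Mapping.lookup p x * r x) \<odot> X g)"
      unfolding p(2) free_map_def using frame_basis_closed[OF fr nontriv]
      by (intro finsum_cong') (auto simp: r smult_smult)
    also have "\<dots> = (\<Sum>x\<in>Poly_Mapping.keys p. Poly_Mapping.lookup p x * r x) \<odot> X g"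
      using frame_basis_closed[OF fr nontriv] by (intro finsum_smult_const) auto
    finally show "a \<in> line A (X g)" using smult_in_line by simp
  next
    fix a assume "a \<in> line A (X g)"
    then obtain r where r: "a = r \<odot> X g" by (auto simp: line_def)
    have "factor_basis m i h \<in> standard_factor_grading m i h" for i h
    proof -
      have "1 \<odot>\<^bsub>factor i\<^esub> factor_basis m i h = factor_basis m i h"
        by (cases "i < m - 1") (auto simp: factor_basis_def standard_factor_low M2_basis_closed standard_factor_high)
      then show ?thesis unfolding standard_factor_grading_eq by (metis (mono_tags, lifting) mem_Collect_eq)
    qed
    then have "basis_tuple m g \<in> ?H" by (auto simp: basis_tuple_def)
    moreover have "free_map (Poly_Mapping.single (basis_tuple m g) r) = a"
      by (simp add: free_map_single tuple_map_basis g r)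
    ultimately show "a \<in> free_map ` {p. Poly_Mapping.keys p \<subseteq> ?H}"
      by (intro image_eqI[of _ _ "Poly_Mapping.single (basis_tuple m g) r"]) auto
  qed
  finally show "tensor_map ` standard_grading m g = line A (X g)" .
qed

end

section \<open>Isomorphisms of real algebras\<close>

text \<open>The record of the tensor product comes without axioms. Injectivity of
  \<open>\<psi>\<close> reduces each law to the same law in \<open>A\<close>; surjectivity supplies
  the additive inverses.\<close>

lemma (in real_alg) real_alg_pullback:
  fixes B :: "(real, 'b) module" and \<psi> :: "'b \<Rightarrow> 'a"
  assumes bij: "bij_betw \<psi> (carrier B) (carrier A)"
    and hom: "\<And>x y. x \<in> carrier B \<Longrightarrow> y \<in> carrier B \<Longrightarrow> \<psi> (x \<otimes>\<^bsub>B\<^esub> y) = \<psi> x \<otimes> \<psi> y"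
      "\<And>x y. x \<in> carrier B \<Longrightarrow> y \<in> carrier B \<Longrightarrow> \<psi> (x \<oplus>\<^bsub>B\<^esub> y) = \<psi> x \<oplus> \<psi> y"
      "\<And>r x. x \<in> carrier B \<Longrightarrow> \<psi> (r \<odot>\<^bsub>B\<^esub> x) = r \<odot> \<psi> x"
      "\<And>x y. x \<in> carrier B \<Longrightarrow> y \<in> carrier B \<Longrightarrow> x \<otimes>\<^bsub>B\<^esub> y \<in> carrier B"
      "\<And>x y. x \<in> carrier B \<Longrightarrow> y \<in> carrier B \<Longrightarrow> x \<oplus>\<^bsub>B\<^esub> y \<in> carrier B"
      "\<And>r x. x \<in> carrier B \<Longrightarrow> r \<odot>\<^bsub>B\<^esub> x \<in> carrier B"
      "\<one>\<^bsub>B\<^esub> \<in> carrier B" "\<psi> \<one>\<^bsub>B\<^esub> = \<one>" "\<zero>\<^bsub>B\<^esub> \<in> carrier B" "\<psi> \<zero>\<^bsub>B\<^esub> = \<zero>"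
  shows "real_alg B"
proof -
  have inj: "x = y" if "x \<in> carrier B" "y \<in> carrier B" "\<psi> x = \<psi> y" for x y
    using bij that by (auto simp: bij_betw_def inj_on_def)
  have cl: "\<psi> x \<in> carrier A" if "x \<in> carrier B" for x
    using bij that by (rule bij_betw_apply)
  have "abelian_group B"
  proof (rule abelian_groupI)
    fix x assume x: "x \<in> carrier B"
    have "\<ominus> \<psi> x \<in> \<psi> ` carrier B"
      using bij_betw_imp_surj_on[OF bij] cl[OF x] by simp
    then obtain y where y: "y \<in> carrier B" "\<psi> y = \<ominus> \<psi> x" by auto
    have "y \<oplus>\<^bsub>B\<^esub> x = \<zero>\<^bsub>B\<^esub>"
      by (rule inj) (use x y cl in \<open>simp_all add: hom l_neg\<close>)
    then show "\<exists>y\<in>carrier B. y \<oplus>\<^bsub>B\<^esub> x = \<zero>\<^bsub>B\<^esub>" using y by blast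
  qed (use cl in \<open>auto intro!: inj simp: hom a_ac\<close>)
  moreover have "monoid B"
    by (rule monoidI) (use cl in \<open>auto intro!: inj simp: hom m_assoc\<close>)
  ultimately have "ring B"
    by (rule ringI) (use cl in \<open>auto intro!: inj simp: hom l_distr r_distr\<close>)
  moreover have "real_alg_axioms B"
    by unfold_locales
      (use cl in \<open>auto intro!: inj simp: hom smult_l_distr smult_r_distr smult_smult smult_mult_left smult_mult_right\<close>)
  ultimately show ?thesis by (simp add: real_alg_def)
qed

lemma (in tensor_frame) real_alg_standard_algebra: "real_alg (standard_algebra m)"
  by (rule real_alg_pullback[OF tensor_map_bij])
    (fact tensor_map_one_zero | rule tensor_map_hom, assumption+)+

lemma algebra_isoD:
  assumes "\<psi> \<in> algebra_iso A B"
  shows "bij_betw \<psi> (carrier A) (carrier B)"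
    "\<And>x. x \<in> carrier A \<Longrightarrow> \<psi> x \<in> carrier B"
    "\<And>x y. x \<in> carrier A \<Longrightarrow> y \<in> carrier A \<Longrightarrow> \<psi> (x \<otimes>\<^bsub>A\<^esub> y) = \<psi> x \<otimes>\<^bsub>B\<^esub> \<psi> y"
    "\<And>x y. x \<in> carrier A \<Longrightarrow> y \<in> carrier A \<Longrightarrow> \<psi> (x \<oplus>\<^bsub>A\<^esub> y) = \<psi> x \<oplus>\<^bsub>B\<^esub> \<psi> y"
    "\<psi> \<one>\<^bsub>A\<^esub> = \<one>\<^bsub>B\<^esub>"
    "\<And>r x. x \<in> carrier A \<Longrightarrow> \<psi> (r \<odot>\<^bsub>A\<^esub> x) = r \<odot>\<^bsub>B\<^esub> \<psi> x"
proof -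
  have "\<psi> \<in> ring_iso A B" using assms by (simp add: algebra_iso_def)
  from ring_iso_memE[OF this]
  show "bij_betw \<psi> (carrier A) (carrier B)"
    "\<And>x. x \<in> carrier A \<Longrightarrow> \<psi> x \<in> carrier B"
    "\<And>x y. x \<in> carrier A \<Longrightarrow> y \<in> carrier A \<Longrightarrow> \<psi> (x \<otimes>\<^bsub>A\<^esub> y) = \<psi> x \<otimes>\<^bsub>B\<^esub> \<psi> y"
    "\<And>x y. x \<in> carrier A \<Longrightarrow> y \<in> carrier A \<Longrightarrow> \<psi> (x \<oplus>\<^bsub>A\<^esub> y) = \<psi> x \<oplus>\<^bsub>B\<^esub> \<psi> y"
    "\<psi> \<one>\<^bsub>A\<^esub> = \<one>\<^bsub>B\<^esub>"
    by blast+
  show "\<And>r x. x \<in> carrier A \<Longrightarrow> \<psi> (r \<odot>\<^bsub>A\<^esub> x) = r \<odot>\<^bsub>B\<^esub> \<psi> x"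
    using assms by (simp add: algebra_iso_def)
qed

lemma algebra_iso_inverse:
  assumes "real_alg A" "\<psi> \<in> algebra_iso A B"
  shows "inv_into (carrier A) \<psi> \<in> algebra_iso B A"
proof -
  interpret real_alg A by fact
  have iso: "\<psi> \<in> ring_iso A B" using assms(2) by (simp add: algebra_iso_def)
  note \<psi> = algebra_isoD[OF assms(2)]
  have "inv_into (carrier A) \<psi> (r \<odot>\<^bsub>B\<^esub> y) = r \<odot>\<^bsub>A\<^esub> inv_into (carrier A) \<psi> y" if y: "y \<in> carrier B" for r y
  proof -
    have x: "inv_into (carrier A) \<psi> y \<in> carrier A" "\<psi> (inv_into (carrier A) \<psi> y) = y"
      using \<psi>(1) y by (auto simp: bij_betw_def inv_into_into f_inv_into_f)
    have "r \<odot>\<^bsub>B\<^esub> y = \<psi> (r \<odot>\<^bsub>A\<^esub> inv_into (carrier A) \<psi> y)" using x \<psi>(6) by simp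
    then show ?thesis using \<psi>(1) x(1) by (simp add: bij_betw_def inv_into_f_f)
  qed
  then show ?thesis using ring_iso_set_sym[OF ring_axioms iso] by (simp add: algebra_iso_def)
qed

lemma algebra_iso_compose:
  assumes "\<psi> \<in> algebra_iso A B" "\<phi> \<in> algebra_iso B C"
  shows "\<phi> \<circ> \<psi> \<in> algebra_iso A C"
  using assms ring_iso_set_trans[of \<psi> A B \<phi> C] algebra_isoD(2)[OF assms(1)]
  by (auto simp: algebra_iso_def)

lemma algebra_iso_inverse_image:
  assumes "\<psi> \<in> algebra_iso A B" "L \<subseteq> carrier A" "\<psi> ` L = M"
  shows "inv_into (carrier A) \<psi> ` M = L"
  using algebra_isoD(1)[OF assms(1)] assms(2,3) by (auto simp: bij_betw_def inv_into_image_cancel)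

lemma algebra_iso_zero:
  assumes "real_alg A" "real_alg B" "\<psi> \<in> algebra_iso A B"
  shows "\<psi> \<zero>\<^bsub>A\<^esub> = \<zero>\<^bsub>B\<^esub>"
proof -
  interpret A: real_alg A by fact
  interpret B: real_alg B by fact
  have "\<psi> (0 \<odot>\<^bsub>A\<^esub> \<zero>\<^bsub>A\<^esub>) = 0 \<odot>\<^bsub>B\<^esub> \<psi> \<zero>\<^bsub>A\<^esub>" by (rule algebra_isoD(6)[OF assms(3) A.zero_closed])
  then show ?thesis using algebra_isoD(2)[OF assms(3) A.zero_closed] by simp
qed

lemma algebra_iso_finsum:
  assumes "real_alg A" "real_alg B" "\<psi> \<in> algebra_iso A B" "finite I" "f \<in> I \<rightarrow> carrier A"
  shows "\<psi> (\<Oplus>\<^bsub>A\<^esub>i\<in>I. f i) = (\<Oplus>\<^bsub>B\<^esub>i\<in>I. \<psi> (f i))"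
proof -
  interpret A: real_alg A by fact
  interpret B: real_alg B by fact
  note \<psi> = algebra_isoD[OF assms(3)]
  show ?thesis
    using assms(4,5)
  proof (induction I rule: finite_induct)
    case empty
    then show ?case by (simp add: algebra_iso_zero[OF assms(1-3)])
  next
    case (insert i I)
    then have f: "f i \<in> carrier A" "f \<in> I \<rightarrow> carrier A" "(\<Oplus>\<^bsub>A\<^esub>i\<in>I. f i) \<in> carrier A" by auto
    then have "(\<lambda>i. \<psi> (f i)) \<in> I \<rightarrow> carrier B" "\<psi> (f i) \<in> carrier B" using \<psi>(2) by auto
    then show ?case using insert f \<psi>(4) by simp
  qed
qed

lemma algebra_iso_line:
  assumes "\<psi> \<in> algebra_iso A B" "x \<in> carrier A"
  shows "\<psi> ` line A x = line B (\<psi> x)"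
  by (simp add: line_def full_SetCompr_eq image_image algebra_isoD(6)[OF assms])

lemma algebra_iso_Units:
  assumes "\<psi> \<in> algebra_iso A B" "x \<in> Units A"
  shows "\<psi> x \<in> Units B"
proof -
  obtain y where "x \<in> carrier A" "y \<in> carrier A" "y \<otimes>\<^bsub>A\<^esub> x = \<one>\<^bsub>A\<^esub>" "x \<otimes>\<^bsub>A\<^esub> y = \<one>\<^bsub>A\<^esub>"
    using assms(2) by (auto simp: Units_def)
  then have "\<psi> y \<otimes>\<^bsub>B\<^esub> \<psi> x = \<one>\<^bsub>B\<^esub>" "\<psi> x \<otimes>\<^bsub>B\<^esub> \<psi> y = \<one>\<^bsub>B\<^esub>" "\<psi> x \<in> carrier B" "\<psi> y \<in> carrier B"
    using algebra_isoD[OF assms(1)] by metis+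
  then show ?thesis unfolding Units_def by blast
qed

lemma graded_basis_transport:
  assumes A: "real_alg A" and B: "real_alg B" and iso: "\<psi> \<in> algebra_iso A B" and gb: "graded_basis T A X"
  shows "graded_basis T B (\<lambda>t. \<psi> (X t))"
proof -
  interpret A: real_alg A by (rule A)
  interpret B: real_alg B by (rule B)
  interpret T: comm_group T using gb by (simp add: graded_basis_def)
  note \<psi> = algebra_isoD[OF iso]
  have ind: "indep A X (carrier T)" and sp: "spans A X (carrier T)" using gb by (auto simp: graded_basis_def)
  have X: "\<And>t. t \<in> carrier T \<Longrightarrow> X t \<in> carrier A" and fin: "finite (carrier T)"
    using indep_closed[OF ind] indep_finite[OF ind] by auto
  have sum: "\<psi> (\<Oplus>\<^bsub>A\<^esub>t\<in>carrier T. c t \<odot>\<^bsub>A\<^esub> X t) = (\<Oplus>\<^bsub>B\<^esub>t\<in>carrier T. c t \<odot>\<^bsub>B\<^esub> \<psi> (X t))" for c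
  proof -
    have "\<psi> (\<Oplus>\<^bsub>A\<^esub>t\<in>carrier T. c t \<odot>\<^bsub>A\<^esub> X t) = (\<Oplus>\<^bsub>B\<^esub>t\<in>carrier T. \<psi> (c t \<odot>\<^bsub>A\<^esub> X t))"
      using X by (intro algebra_iso_finsum[OF A B iso fin]) auto
    also have "\<dots> = (\<Oplus>\<^bsub>B\<^esub>t\<in>carrier T. c t \<odot>\<^bsub>B\<^esub> \<psi> (X t))"
      using X \<psi>(2,6) by (intro B.finsum_cong') auto
    finally show ?thesis .
  qed
  have scl: "(\<Oplus>\<^bsub>A\<^esub>t\<in>carrier T. c t \<odot>\<^bsub>A\<^esub> X t) \<in> carrier A" for c
    using X by (intro A.finsum_closed) auto
  have "indep B (\<lambda>t. \<psi> (X t)) (carrier T)"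
    unfolding indep_def
  proof (intro conjI allI impI ballI)
    show "(\<lambda>t. \<psi> (X t)) \<in> carrier T \<rightarrow> carrier B" using X \<psi>(2) by auto
    fix c t assume "(\<Oplus>\<^bsub>B\<^esub>t\<in>carrier T. c t \<odot>\<^bsub>B\<^esub> \<psi> (X t)) = \<zero>\<^bsub>B\<^esub>" and t: "t \<in> carrier T"
    then have "\<psi> (\<Oplus>\<^bsub>A\<^esub>t\<in>carrier T. c t \<odot>\<^bsub>A\<^esub> X t) = \<psi> \<zero>\<^bsub>A\<^esub>"
      unfolding sum by (simp only: algebra_iso_zero[OF A B iso])
    then have "(\<Oplus>\<^bsub>A\<^esub>t\<in>carrier T. c t \<odot>\<^bsub>A\<^esub> X t) = \<zero>\<^bsub>A\<^esub>"
      by (rule inj_onD[OF bij_betw_imp_inj_on[OF \<psi>(1)]]) (simp_all only: scl A.zero_closed)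
    then show "c t = 0" using indepD[OF ind] t by blast
  qed (rule fin)
  moreover have "spans B (\<lambda>t. \<psi> (X t)) (carrier T)"
    unfolding spans_def
  proof (intro conjI ballI)
    show "(\<lambda>t. \<psi> (X t)) \<in> carrier T \<rightarrow> carrier B" using X \<psi>(2) by auto
    fix y assume "y \<in> carrier B"
    then obtain x where x: "x \<in> carrier A" "y = \<psi> x" using \<psi>(1) by (auto simp: bij_betw_def)
    then obtain c where c: "x = (\<Oplus>\<^bsub>A\<^esub>t\<in>carrier T. c t \<odot>\<^bsub>A\<^esub> X t)" using sp unfolding spans_def by blast
    show "\<exists>c. y = (\<Oplus>\<^bsub>B\<^esub>t\<in>carrier T. c t \<odot>\<^bsub>B\<^esub> \<psi> (X t))"
      unfolding x(2) c sum by (rule exI[where x = c]) (rule refl)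
  qed (rule fin)
  moreover have "\<psi> (X t) \<in> Units B" if "t \<in> carrier T" for t
    using algebra_iso_Units[OF iso] gb that by (simp add: graded_basis_def)
  moreover have "\<exists>c. \<psi> (X u) \<otimes>\<^bsub>B\<^esub> \<psi> (X v) = c \<odot>\<^bsub>B\<^esub> \<psi> (X (u \<otimes>\<^bsub>T\<^esub> v))"
    if uv: "u \<in> carrier T" "v \<in> carrier T" for u v
  proof -
    obtain c where "X u \<otimes>\<^bsub>A\<^esub> X v = c \<odot>\<^bsub>A\<^esub> X (u \<otimes>\<^bsub>T\<^esub> v)" using gb uv unfolding graded_basis_def by blast
    then have "\<psi> (X u) \<otimes>\<^bsub>B\<^esub> \<psi> (X v) = c \<odot>\<^bsub>B\<^esub> \<psi> (X (u \<otimes>\<^bsub>T\<^esub> v))"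
      using \<psi>(3)[OF X[OF uv(1)] X[OF uv(2)]] \<psi>(6)[OF X[OF T.m_closed[OF uv]]] by simp
    then show ?thesis by blast
  qed
  ultimately show ?thesis by (auto simp: graded_basis_def T.comm_group_axioms)
qed

text \<open>The grading of \<open>A\<close> by the frame basis is carried back along the
  isomorphism, which identifies its lines with the components of the tensor product.\<close>

lemma (in tensor_frame) standard_grading_division:
  "abelian_division_grading_1 (standard_group m) (standard_algebra m) (standard_grading m)"
proof -
  let ?B = "standard_algebra m"
  let ?\<phi> = "inv_into (carrier ?B) tensor_map"
  interpret B: real_alg ?B by (rule real_alg_standard_algebra)
  have iso: "?\<phi> \<in> algebra_iso A ?B"
    by (rule algebra_iso_inverse[OF real_alg_standard_algebra tensor_map_iso])
  have "graded_basis (standard_group m) ?B (\<lambda>g. ?\<phi> (X g))"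
    by (rule graded_basis_transport[OF real_alg_axioms real_alg_standard_algebra iso
          frame_graded_basis[OF fr nontriv sp]])
  moreover have "standard_grading m g = line ?B (?\<phi> (X g))" if g: "g \<in> S" for g
    using algebra_iso_inverse_image[OF tensor_map_iso tensor_map_grading(2,1)[OF g]]
      algebra_iso_line[OF iso frame_basis_closed[OF fr nontriv]] by simp
  ultimately show ?thesis by (rule B.graded_basis_imp_grading(1))
qed

section \<open>A frame of quaternionic matrices\<close>

definition monomial_matrix :: "nat \<Rightarrow> (nat \<Rightarrow> nat) \<Rightarrow> (nat \<Rightarrow> quat) \<Rightarrow> quat mat" where
  "monomial_matrix k \<sigma> f = mat k k (\<lambda>(r, s). if s = \<sigma> r then f r else 0)"

lemma monomial_matrix_closed: "monomial_matrix k \<sigma> f \<in> carrier_mat k k"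
  by (simp add: monomial_matrix_def)

lemma monomial_matrix_eqI:
  "(\<And>r. r < k \<Longrightarrow> \<sigma> r = \<tau> r \<and> f r = g r) \<Longrightarrow> monomial_matrix k \<sigma> f = monomial_matrix k \<tau> g"
  unfolding monomial_matrix_def by (rule cong_mat) auto

lemma monomial_matrix_mult:
  assumes "\<And>r. r < k \<Longrightarrow> \<sigma> r < k"
  shows "monomial_matrix k \<sigma> f * monomial_matrix k \<tau> g = monomial_matrix k (\<lambda>r. \<tau> (\<sigma> r)) (\<lambda>r. f r * g (\<sigma> r))"
proof (rule eq_matI)
  fix r s assume "r < dim_row (monomial_matrix k (\<lambda>r. \<tau> (\<sigma> r)) (\<lambda>r. f r * g (\<sigma> r)))"
    "s < dim_col (monomial_matrix k (\<lambda>r. \<tau> (\<sigma> r)) (\<lambda>r. f r * g (\<sigma> r)))"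
  then have rs: "r < k" "s < k" by (simp_all add: monomial_matrix_def)
  have "(monomial_matrix k \<sigma> f * monomial_matrix k \<tau> g) $$ (r, s)
    = (\<Sum>a\<in>{0..<k}. monomial_matrix k \<sigma> f $$ (r, a) * monomial_matrix k \<tau> g $$ (a, s))"
    using rs by (simp add: scalar_prod_def monomial_matrix_def)
  also have "\<dots> = (\<Sum>a\<in>{0..<k}. if a = \<sigma> r then (if s = \<tau> (\<sigma> r) then f r * g (\<sigma> r) else 0) else 0)"
    using rs by (intro sum.cong) (auto simp: monomial_matrix_def)
  also have "\<dots> = monomial_matrix k (\<lambda>r. \<tau> (\<sigma> r)) (\<lambda>r. f r * g (\<sigma> r)) $$ (r, s)"
    using rs assms[OF rs(1)] by (simp add: sum.delta monomial_matrix_def)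
  finally show "(monomial_matrix k \<sigma> f * monomial_matrix k \<tau> g) $$ (r, s)
    = monomial_matrix k (\<lambda>r. \<tau> (\<sigma> r)) (\<lambda>r. f r * g (\<sigma> r)) $$ (r, s)" .
qed (simp_all add: monomial_matrix_def)

lemma monomial_matrix_smult:
  "c \<odot>\<^bsub>matrix_algebra k\<^esub> monomial_matrix k \<sigma> f = monomial_matrix k \<sigma> (\<lambda>r. c *\<^sub>R f r)"
  by (rule eq_matI) (auto simp: matrix_algebra_simps monomial_matrix_def)

lemma monomial_matrix_one: "1\<^sub>m k = monomial_matrix k (\<lambda>r. r) (\<lambda>_. 1)"
  by (rule eq_matI) (auto simp: monomial_matrix_def)

text \<open>The bits from position \<open>n\<close> on remain zero.\<close>

lemma flip_bit_less:
  assumes "i < n" "r < 2 ^ n"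
  shows "flip_bit i r < (2 ^ n :: nat)"
proof -
  have "take_bit n r = r" using assms(2) by (simp add: take_bit_nat_eq_self_iff)
  then have "\<not> bit r j" if "n \<le> j" for j using that by (metis bit_take_bit_iff linorder_not_less)
  then have "take_bit n (flip_bit i r) = flip_bit i r"
    using assms(1) by (intro bit_eqI) (auto simp: bit_take_bit_iff bit_flip_bit_iff not_less[symmetric])
  then show ?thesis by (simp add: take_bit_nat_eq_self_iff)
qed

text \<open>Kronecker products, with rows indexed by bit strings of length \<open>m - 1\<close>. In
  a slot below \<open>m - 1\<close>, \<open>U i\<close> is the diagonal matrix of signs given by bit
  \<open>i\<close> and \<open>V i\<close> flips that bit, as the generators of M_2(\<real>) do on
  one tensor factor. The last slot consists of the scalar matrices i and j, which commute with real
  matrices.\<close>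

lemma quaternion_frame_exists: "\<exists>U V. frame (matrix_algebra (2 ^ (m - 1)) :: (real, quat mat) module) m U V"
proof -
  define k :: nat where "k = 2 ^ (m - 1)"
  define \<sigma> where "\<sigma> i = (if i < m - 1 then flip_bit i else (\<lambda>r :: nat. r))" for i
  define f where "f i r = (if i < m - 1 then (if bit (r :: nat) i then 1 else - 1) else qunit 1)" for i r
  define g where "g i = (if i < m - 1 then 1 else qunit 2)" for i
  define U where "U i = monomial_matrix k (\<lambda>r. r) (f i)" for i
  define V where "V i = monomial_matrix k (\<sigma> i) (\<lambda>_. g i)" for i
  have \<sigma>k: "\<sigma> i r < k" if "r < k" for i r
    using that flip_bit_less by (simp add: \<sigma>_def k_def)
  have bits: "bit (\<sigma> i r) j = (if i = j \<and> i < m - 1 then \<not> bit r j else bit r j)" for i r j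
    by (auto simp: \<sigma>_def bit_flip_bit_iff)
  have \<sigma>\<sigma>: "\<sigma> i (\<sigma> i r) = r" "\<sigma> i (\<sigma> j r) = \<sigma> j (\<sigma> i r)" for i j r
    by (rule bit_eqI; auto simp: bits)+
  have ff: "f i r * f i r = factor_sign m i *\<^sub>R 1" "g i * g i = factor_sign m i *\<^sub>R 1" for i r
    by (auto simp: f_def g_def factor_sign_def quat_eq_iff qunit_def)
  have gf: "g i * f i (\<sigma> i r) = (- 1) *\<^sub>R (f i r * g i)" for i r
    using bits[of i r i] by (auto simp: f_def g_def quat_eq_iff qunit_def)
  have ffc: "f i r * f j r = f j r * f i r" "g i * g j = g j * g i" "f i r * g j = g j * f i (\<sigma> j r)"
    if "i \<noteq> j" "i < m" "j < m" for i j r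
    using bits[of j r i] that by (auto simp: f_def g_def quat_eq_iff qunit_def)
  have "frame (matrix_algebra k) m U V"
    unfolding frame_def matrix_algebra_simps(2)
  proof (intro allI impI conjI)
    fix i assume i: "i < m"
    show "U i \<in> carrier (matrix_algebra k)" "V i \<in> carrier (matrix_algebra k)"
      by (simp_all add: U_def V_def matrix_algebra_simps monomial_matrix_closed)
    note simps = matrix_algebra_simps(3) monomial_matrix_one monomial_matrix_smult monomial_matrix_mult \<sigma>k
    show "U i * U i = factor_sign m i \<odot>\<^bsub>matrix_algebra k\<^esub> \<one>\<^bsub>matrix_algebra k\<^esub>"
      unfolding U_def by (simp only: simps) (rule monomial_matrix_eqI, simp add: ff)
    show "V i * V i = factor_sign m i \<odot>\<^bsub>matrix_algebra k\<^esub> \<one>\<^bsub>matrix_algebra k\<^esub>"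
      unfolding V_def by (simp only: simps) (rule monomial_matrix_eqI, simp add: ff \<sigma>\<sigma>)
    show "V i * U i = (- 1) \<odot>\<^bsub>matrix_algebra k\<^esub> (U i * V i)"
      unfolding U_def V_def by (simp only: simps) (rule monomial_matrix_eqI, simp only: gf simp_thms)
    fix j assume j: "j < m" "i \<noteq> j"
    show "U i * U j = U j * U i"
      unfolding U_def by (simp only: simps) (rule monomial_matrix_eqI, simp only: ffc(1)[OF j(2) i j(1)] simp_thms)
    show "U i * V j = V j * U i"
      unfolding U_def V_def by (simp only: simps) (rule monomial_matrix_eqI, simp only: ffc(3)[OF j(2) i j(1)] simp_thms)
    show "V i * V j = V j * V i"
      unfolding V_def by (simp only: simps) (rule monomial_matrix_eqI, simp only: ffc(2)[OF j(2) i j(1)] \<sigma>\<sigma>(2)[of j i] simp_thms)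
  qed
  then show ?thesis unfolding k_def by blast
qed

text \<open>For size \<open>2 ^ (m - 1)\<close> the number of matrix units is exactly
  \<open>4 ^ m\<close>.\<close>

lemma tensor_frame_matrix_algebra:
  assumes "m \<ge> 1" "frame (matrix_algebra (2 ^ (m - 1)) :: (real, quat mat) module) m U V"
  shows "tensor_frame (matrix_algebra (2 ^ (m - 1))) m U V (matrix_unit (2 ^ (m - 1))) (unit_index (2 ^ (m - 1)))"
proof -
  obtain j where j: "m = Suc j" using assms(1) by (cases m) auto
  have "card (unit_index (2 ^ (m - 1))) = 4 ^ m"
    by (simp add: card_unit_index j power_mult_distrib[symmetric])
  then show ?thesis
    using assms(2) matrix_units_span matrix_algebra_nontrivial[of "2 ^ (m - 1)"] real_alg_matrix_algebra
    by (simp add: tensor_frame_def tensor_frame_axioms_def)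
qed

section \<open>Gradings and quadratic forms\<close>

abbreviation quaternion_matrices :: "nat \<Rightarrow> (real, quat mat) module" where
  "quaternion_matrices k \<equiv> matrix_algebra k"

lemma grading_sign_basis:
  assumes k: "k > 0" and gr: "abelian_division_grading_1 G (quaternion_matrices k) \<Gamma>"
  defines "S \<equiv> grading_support G (quaternion_matrices k) \<Gamma>"
  shows "subgroup S G"
    and "\<exists>X \<mu>. sign_basis (G\<lparr>carrier := S\<rparr>) (quaternion_matrices k) \<mu> X \<and>
      (\<forall>t\<in>S. \<Gamma> t = line (quaternion_matrices k) (X t))"
proof -
  interpret real_alg "quaternion_matrices k" by (rule real_alg_matrix_algebra)
  note nt = matrix_algebra_nontrivial[OF k]
  note st = grading_imp_graded_basis[OF matrix_units_span nt gr, folded S_def]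
  show "subgroup S G" by (rule st(1))
  obtain X where X: "graded_basis (G\<lparr>carrier := S\<rparr>) (quaternion_matrices k) X"
    "\<forall>t\<in>S. \<Gamma> t = line (quaternion_matrices k) (X t)"
    using st(2) by blast
  from gb_sign_basis[OF X(1) nt matrix_algebra_central] X(2)
  show "\<exists>X \<mu>. sign_basis (G\<lparr>carrier := S\<rparr>) (quaternion_matrices k) \<mu> X \<and>
      (\<forall>t\<in>S. \<Gamma> t = line (quaternion_matrices k) (X t))"
    by fastforce
qed

context real_alg
begin

text \<open>A nonzero multiple \<open>c \<odot> X t\<close> has its square multiplied by
  \<open>c * c > 0\<close>, so the sign is the same for all nonzero elements of a component.
  Existence and uniqueness of the sign function come together in this equivalence.\<close>

lemma square_sign_iff:
  assumes nt: "\<one> \<noteq> \<zero>" and sb: "sign_basis (G\<lparr>carrier := S\<rparr>) A \<mu> X"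
    and S: "grading_support G A \<Gamma> = S" and \<Gamma>: "\<forall>t\<in>S. \<Gamma> t = line A (X t)"
  shows "square_sign G A \<Gamma> \<nu> \<longleftrightarrow> \<nu> = \<mu>"
proof
  have gb: "graded_basis (G\<lparr>carrier := S\<rparr>) A X" and mu: "\<mu> \<in> S \<rightarrow>\<^sub>E {1, -1}"
    and sq: "\<And>t. t \<in> S \<Longrightarrow> X t \<otimes> X t = \<mu> t \<odot> \<one>"
    using sb by (auto simp: sign_basis_def)
  have X: "X t \<in> carrier A" if "t \<in> S" for t using gb_closed[OF gb nt] that by simp
  {
    assume "\<nu> = \<mu>"
    have "\<exists>r>0. x \<otimes> x = (r * \<mu> t) \<odot> \<one>" if t: "t \<in> S" and x: "x \<in> \<Gamma> t" "x \<noteq> \<zero>" for t x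
    proof -
      obtain c where c: "x = c \<odot> X t" using x(1) \<Gamma> t by (auto simp: line_def)
      then have "c \<noteq> 0" using x(2) X[OF t] by auto
      then have "c * c > 0" by (auto simp: zero_less_mult_iff linorder_neq_iff)
      moreover have "x \<otimes> x = (c * c * \<mu> t) \<odot> \<one>"
        using c X[OF t] sq[OF t] by (simp add: smult_mult_left smult_mult_right smult_smult mult.assoc)
      ultimately show ?thesis by blast
    qed
    then show "square_sign G A \<Gamma> \<nu>" using mu \<open>\<nu> = \<mu>\<close> S by (simp add: square_sign_def)
  next
    assume nu: "square_sign G A \<Gamma> \<nu>"
    then have nuE: "\<nu> \<in> S \<rightarrow>\<^sub>E {1, -1}" using S by (simp add: square_sign_def)
    show "\<nu> = \<mu>"
    proof (rule PiE_ext[OF nuE mu])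
      fix t assume t: "t \<in> S"
      have "X t \<in> \<Gamma> t" "X t \<noteq> \<zero>"
        using \<Gamma> t self_in_line[OF X[OF t]] gb_nonzero[OF gb nt] by auto
      then obtain r where r: "r > 0" "X t \<otimes> X t = (r * \<nu> t) \<odot> \<one>"
        using nu S t unfolding square_sign_def by blast
      then have "r * \<nu> t = \<mu> t" using sq[OF t] smult_right_cancel[OF one_closed nt] by metis
      moreover have "\<nu> t = 1 \<or> \<nu> t = - 1" "\<mu> t = 1 \<or> \<mu> t = - 1" using nuE mu t by auto
      ultimately show "\<nu> t = \<mu> t" using r(1) by auto
    qed
  }
qed

text \<open>A word in the elements \<open>X (u i)\<close>, \<open>X (v i)\<close> is a scalar
  multiple of \<open>X\<close> at the same word formed in \<open>T\<close>. The frame basis thus has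
  the same lines as \<open>X\<close>, relabelled by the coordinates.\<close>

lemma sign_basis_frame:
  assumes nt: "\<one> \<noteq> \<zero>" and sb: "sign_basis T A \<mu> X" and qf: "quad_form T \<mu>" and symp: "symplectic T \<mu> m u v"
  shows "frame A m (\<lambda>i. X (u i)) (\<lambda>i. X (v i))"
    and "g \<in> carrier (standard_group m) \<Longrightarrow>
      line A (frame_basis m (\<lambda>i. X (u i)) (\<lambda>i. X (v i)) g) = line A (X (quad_form.coord T m u v g))"
proof -
  interpret Q: quad_form T \<mu> by (rule qf)
  have gb: "graded_basis T A X" and sq: "\<And>t. t \<in> carrier T \<Longrightarrow> X t \<otimes> X t = \<mu> t \<odot> \<one>"
    using sb by (auto simp: sign_basis_def)
  note comm = sign_basis_commutation(1)[OF sb nt] and X = gb_closed[OF gb nt]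
  have uv: "u i \<in> carrier T" "v i \<in> carrier T" if "i < m" for i
    using symp that by (auto simp: symplectic_def)
  show fr: "frame A m (\<lambda>i. X (u i)) (\<lambda>i. X (v i))"
    unfolding frame_def
  proof (intro allI impI conjI)
    fix i assume i: "i < m"
    show "X (u i) \<in> carrier A" "X (v i) \<in> carrier A" using X uv i by auto
    show "X (u i) \<otimes> X (u i) = factor_sign m i \<odot> \<one>" "X (v i) \<otimes> X (v i) = factor_sign m i \<odot> \<one>"
      using sq uv i symp by (auto simp: symplectic_def)
    have "Q.\<beta> (v i) (u i) = - 1" using symp i Q.beta_sym[OF uv[OF i]] by (auto simp: symplectic_def)
    then show "X (v i) \<otimes> X (u i) = (- 1) \<odot> (X (u i) \<otimes> X (v i))"
      using comm[OF uv(2)[OF i] uv(1)[OF i]] by simp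
    fix j assume j: "j < m" "i \<noteq> j"
    have b: "Q.\<beta> (u i) (u j) = 1" "Q.\<beta> (u i) (v j) = 1" "Q.\<beta> (v i) (v j) = 1"
      using symp i j by (auto simp: symplectic_def)
    show "X (u i) \<otimes> X (u j) = X (u j) \<otimes> X (u i)" "X (u i) \<otimes> X (v j) = X (v j) \<otimes> X (u i)"
      "X (v i) \<otimes> X (v j) = X (v j) \<otimes> X (v i)"
      using comm[of "u i" "u j"] comm[of "u i" "v j"] comm[of "v i" "v j"] uv i j b X by simp_all
  qed
  assume g: "g \<in> carrier (standard_group m)"
  let ?w = "\<lambda>i. word T (u i) (v i) (g i)"
  have wT: "?w i \<in> carrier T" if "i < m" for i using Q.T.word_closed uv that by auto
  obtain e where e: "e \<noteq> 0" "X \<one>\<^bsub>T\<^esub> = e \<odot> \<one>" using gb_one[OF gb nt] by blast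
  have one: "\<one> = inverse e \<odot> X \<one>\<^bsub>T\<^esub>" using e by (simp add: smult_smult)
  have prod: "\<exists>c. x \<otimes> y = c \<odot> X (s \<otimes>\<^bsub>T\<^esub> t)"
    if st: "s \<in> carrier T" "t \<in> carrier T" and xy: "x = a \<odot> X s" "y = b \<odot> X t" for x y s t a b
  proof -
    obtain c where "X s \<otimes> X t = c \<odot> X (s \<otimes>\<^bsub>T\<^esub> t)" using gb st unfolding graded_basis_def by blast
    then have "x \<otimes> y = (a * (b * c)) \<odot> X (s \<otimes>\<^bsub>T\<^esub> t)"
      using xy X st by (simp add: smult_mult_left smult_mult_right smult_smult ac_simps)
    then show ?thesis by blast
  qed
  have pw: "\<exists>a. (if b then X s else \<one>) = a \<odot> X (if b then s else \<one>\<^bsub>T\<^esub>)" if "s \<in> carrier T" for b s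
    using one X[OF that] by (cases b) (auto intro: exI[of _ 1])
  have word: "\<exists>c. word A (X (u i)) (X (v i)) (g i) = c \<odot> X (?w i)" if i: "i < m" for i
  proof -
    obtain a b where "(if fst (g i) = 1 then X (u i) else \<one>) = a \<odot> X (if fst (g i) = 1 then u i else \<one>\<^bsub>T\<^esub>)"
      "(if snd (g i) = 1 then X (v i) else \<one>) = b \<odot> X (if snd (g i) = 1 then v i else \<one>\<^bsub>T\<^esub>)"
      using pw uv[OF i] by meson
    then show ?thesis unfolding word_def by (intro prod) (use uv[OF i] in auto)
  qed
  have "\<exists>c. oprod A (\<lambda>i. word A (X (u i)) (X (v i)) (g i)) n = c \<odot> X (oprod T ?w n)" if "n \<le> m" for n
    using that
  proof (induction n)
    case 0
    then show ?case using one by auto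
  next
    case (Suc n)
    then obtain c d where "oprod A (\<lambda>i. word A (X (u i)) (X (v i)) (g i)) n = c \<odot> X (oprod T ?w n)"
      "word A (X (u n)) (X (v n)) (g n) = d \<odot> X (?w n)"
      using word[of n] by auto
    moreover have "oprod T ?w n \<in> carrier T" using wT Suc.prems by (intro Q.T.oprod_closed) auto
    ultimately show ?case using wT[of n] Suc.prems by (auto intro!: prod)
  qed
  then obtain c where c: "frame_basis m (\<lambda>i. X (u i)) (\<lambda>i. X (v i)) g = c \<odot> X (quad_form.coord T m u v g)"
    unfolding frame_basis_def[OF fr nt] Q.coord_def[OF symp] by blast
  show "line A (frame_basis m (\<lambda>i. X (u i)) (\<lambda>i. X (v i)) g) = line A (X (quad_form.coord T m u v g))"
    unfolding c
  proof (rule line_eqI[OF X[OF Q.coord_closed[OF symp]] smult_in_line])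
    show "c \<odot> X (quad_form.coord T m u v g) \<noteq> \<zero>"
      using Units_nonzero[OF nt frame_basis_Units[OF fr nt g]] c by simp
  qed
qed

text \<open>The converse passage: relabelling the frame basis along \<open>\<phi>\<close> realizes
  any form with the standard values in these coordinates.\<close>

lemma frame_sign_basis:
  assumes nt: "\<one> \<noteq> \<zero>" and fr: "frame A m U V" and sp: "spans A Y J" "card J = 4 ^ m"
    and T: "comm_group T" and \<phi>: "\<phi> \<in> iso (standard_group m) T"
    and \<mu>: "\<mu> \<in> carrier T \<rightarrow>\<^sub>E {1, -1}"
      "\<And>g. g \<in> carrier (standard_group m) \<Longrightarrow> \<mu> (\<phi> g) = (\<Prod>i<m. form_sign (factor_sign m i) (g i))"
  shows "sign_basis T A \<mu> (\<lambda>t. frame_basis m U V (inv_into (carrier (standard_group m)) \<phi> t))"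
proof -
  interpret T: comm_group T by (rule T)
  interpret S: comm_group "standard_group m" by (rule comm_group_standard_group)
  let ?S = "carrier (standard_group m)"
  let ?\<theta> = "inv_into ?S \<phi>"
  let ?X = "frame_basis m U V"
  have bij: "bij_betw \<phi> ?S (carrier T)" using \<phi> by (simp add: iso_def)
  have \<theta>: "?\<theta> \<in> iso T (standard_group m)" using S.iso_set_sym[OF \<phi>] .
  then have \<theta>S: "?\<theta> t \<in> ?S" and \<theta>m: "t \<in> carrier T \<Longrightarrow> s \<in> carrier T \<Longrightarrow> ?\<theta> (t \<otimes>\<^bsub>T\<^esub> s) = ?\<theta> t \<otimes>\<^bsub>standard_group m\<^esub> ?\<theta> s"
    if "t \<in> carrier T" for t s
    using that by (auto simp: iso_def hom_def)
  have \<phi>\<theta>: "\<phi> (?\<theta> t) = t" if "t \<in> carrier T" for t using bij_betw_inv_into_right[OF bij that] .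
  have bij\<theta>: "bij_betw ?\<theta> (carrier T) ?S" using bij_betw_inv_into[OF bij] .
  have ind: "indep A (\<lambda>t. ?X (?\<theta> t)) (carrier T)"
    by (rule indep_reindex[OF frame_basis_indep[OF fr nt] bij\<theta>])
  have "card (carrier T) = 4 ^ m" using bij_betw_same_card[OF bij] card_standard_group by metis
  then have "spans A (\<lambda>t. ?X (?\<theta> t)) (carrier T)" using indep_imp_spans[OF sp(1) ind] sp(2) by simp
  then have "graded_basis T A (\<lambda>t. ?X (?\<theta> t))"
    unfolding graded_basis_def
    using ind T \<theta>S \<theta>m frame_basis_Units[OF fr nt] frame_basis_mult[OF fr nt] by auto
  moreover have "?X (?\<theta> t) \<otimes> ?X (?\<theta> t) = \<mu> t \<odot> \<one>" if "t \<in> carrier T" for t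
    using frame_basis_square[OF fr nt \<theta>S[OF that]] \<mu>(2)[OF \<theta>S[OF that]] \<phi>\<theta>[OF that] by simp
  ultimately show ?thesis using \<mu>(1) by (simp add: sign_basis_def)
qed

end

definition admissible_form :: "'g monoid \<Rightarrow> ('g \<Rightarrow> real) \<Rightarrow> bool" where
  "admissible_form T \<mu> \<longleftrightarrow>
     \<mu> \<in> quadratic_forms T \<and> type_I T (polarization T \<mu>) \<and> arf_invariant (carrier T) \<mu> = - 1"

lemma sign_basis_admissible:
  assumes k: "k > 0" and sb: "sign_basis T (quaternion_matrices k) \<mu> X"
  shows "admissible_form T \<mu>" "quad_form T \<mu>" "card (carrier T) = 4 * k * k"
proof -
  interpret real_alg "quaternion_matrices k" by (rule real_alg_matrix_algebra)
  note nt = matrix_algebra_nontrivial[OF k]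
  have gb: "graded_basis T (quaternion_matrices k) X" using sb by (simp add: sign_basis_def)
  note quad = sign_basis_quadratic[OF sb nt matrix_algebra_central]
  show "admissible_form T \<mu>"
    using quad arf_matrix_algebra[OF k sb] by (simp add: admissible_form_def)
  show "quad_form T \<mu>"
    using quad gb gb_finite[OF gb nt] by (simp add: quad_form_def quad_form_axioms_def graded_basis_def)
  show "card (carrier T) = 4 * k * k" by (rule card_graded_basis[OF gb])
qed

text \<open>The order of \<open>T\<close> is \<open>4 * k * k\<close> by dimension and a power of 4
  by splitting off planes; comparing square roots gives the claim.\<close>

lemma sign_basis_power_two:
  assumes k: "k > 0" and sb: "sign_basis T (quaternion_matrices k) \<mu> X"
  shows "\<exists>j. k = 2 ^ j"
proof -
  interpret Q: quad_form T \<mu> by (rule sign_basis_admissible(2)[OF k sb])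
  obtain i where i: "card (carrier T) = 4 ^ i"
    using Q.card_power_four[OF Q.T.subgroup_self] Q.radical by blast
  then have eq: "4 * k * k = 4 ^ i" using sign_basis_admissible(3)[OF k sb] by simp
  show ?thesis
  proof (cases i)
    case 0
    then show ?thesis using eq k by simp
  next
    case (Suc j)
    then have "k ^ 2 = (2 ^ j) ^ 2" using eq by (simp add: power2_eq_square power_mult_distrib[symmetric])
    then have "k = 2 ^ j" by (simp only: power2_eq_iff_nonneg zero_le)
    then show ?thesis by blast
  qed
qed

lemma card_half_power: "m \<ge> 1 \<Longrightarrow> 4 * 2 ^ (m - 1) * 2 ^ (m - 1) = (4 :: nat) ^ m"
  by (cases m) (simp_all add: power_mult_distrib[symmetric])

lemma carrier_Z2_power: "carrier (Z2_power r) = (\<Pi>\<^sub>E i\<in>{..<r}. {0, 1})"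
proof -
  have "carrier (integer_mod_group 2) = {0, 1}" by (auto simp: carrier_integer_mod_group)
  then show ?thesis by (simp add: Z2_power_def)
qed

lemma comm_group_Z2_power: "comm_group (Z2_power r)"
  by (rule group.group_comm_groupI) (auto simp: Z2_power_def add.commute)

text \<open>The two coordinates of slot \<open>i\<close> are placed at positions 2i and 2i +
  1.\<close>

lemma standard_group_iso_Z2_power: "standard_group m \<cong> Z2_power (2 * m)"
proof -
  define \<phi> where "\<phi> g = (\<lambda>j\<in>{..<2 * m}. if even j then fst (g (j div 2)) else snd (g (j div 2)))"
    for g :: "nat \<Rightarrow> int \<times> int"
  have closed: "\<phi> g \<in> carrier (Z2_power (2 * m))" if g: "g \<in> carrier (standard_group m)" for g
  proof -
    have "fst (g (j div 2)) \<in> {0, 1}" "snd (g (j div 2)) \<in> {0, 1}" if "j < 2 * m" for j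
    proof -
      have "j div 2 < m" using that by auto
      from standard_group_component[OF g this]
      show "fst (g (j div 2)) \<in> {0, 1}" "snd (g (j div 2)) \<in> {0, 1}" by auto
    qed
    then show ?thesis by (auto simp: carrier_Z2_power \<phi>_def)
  qed
  have "\<phi> \<in> hom (standard_group m) (Z2_power (2 * m))"
  proof (rule homI)
    fix g h assume "g \<in> carrier (standard_group m)" "h \<in> carrier (standard_group m)"
    have "j div 2 < m" if "j < 2 * m" for j using that by auto
    then show "\<phi> (g \<otimes>\<^bsub>standard_group m\<^esub> h) = \<phi> g \<otimes>\<^bsub>Z2_power (2 * m)\<^esub> \<phi> h"
      by (auto simp: \<phi>_def Z2_power_def mult_standard_group mult_Z2_squared restrict_def fun_eq_iff)
  qed (rule closed)
  moreover have inj: "inj_on \<phi> (carrier (standard_group m))"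
  proof (rule inj_onI)
    fix g h assume g: "g \<in> carrier (standard_group m)" and h: "h \<in> carrier (standard_group m)" and eq: "\<phi> g = \<phi> h"
    have "g i = h i" if "i < m" for i
      using fun_cong[OF eq, of "2 * i"] fun_cong[OF eq, of "2 * i + 1"] that by (simp add: \<phi>_def prod_eq_iff)
    then show "g = h" using g h unfolding carrier_standard_group by (intro PiE_ext[of g _ _ h]) auto
  qed
  moreover have "\<phi> ` carrier (standard_group m) = carrier (Z2_power (2 * m))"
  proof (rule card_subset_eq)
    show "finite (carrier (Z2_power (2 * m)))" by (simp add: carrier_Z2_power finite_PiE)
    show "\<phi> ` carrier (standard_group m) \<subseteq> carrier (Z2_power (2 * m))" using closed by blast
    have "card (carrier (Z2_power (2 * m))) = 2 ^ (2 * m)" by (simp add: carrier_Z2_power card_PiE numeral_2_eq_2)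
    also have "\<dots> = card (\<phi> ` carrier (standard_group m))"
      by (simp add: card_image[OF inj] card_standard_group power_mult)
    finally show "card (\<phi> ` carrier (standard_group m)) = card (carrier (Z2_power (2 * m)))" by simp
  qed
  ultimately show ?thesis unfolding is_iso_def iso_def bij_betw_def by blast
qed

lemma card_Z2_power: "card (carrier (Z2_power (2 * m))) = 4 ^ m"
  using iso_same_card[OF standard_group_iso_Z2_power] card_standard_group by metis

section \<open>The correspondence\<close>

context
  fixes m :: nat
  assumes m: "m \<ge> 1"
begin

abbreviation "model_matrices \<equiv> quaternion_matrices (2 ^ (m - 1))"

text \<open>The order of the quantifiers is the point: \<open>\<phi>\<close> depends only on
  \<open>T\<close> and \<open>\<mu>\<close> and is fixed before \<open>X\<close>, so any two bases
  with the same signs are matched with the same degrees of the tensor product.\<close>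

lemma standard_model:
  assumes T: "comm_group T" and c: "card (carrier T) = 4 ^ m" and adm: "admissible_form T \<mu>"
  shows "\<exists>\<phi>\<in>iso (standard_group m) T.
    (\<forall>g\<in>carrier (standard_group m). \<mu> (\<phi> g) = (\<Prod>i<m. form_sign (factor_sign m i) (g i))) \<and>
    (\<forall>X. sign_basis T model_matrices \<mu> X \<longrightarrow>
      (\<exists>\<Psi>\<in>algebra_iso (standard_algebra m) model_matrices.
        \<forall>g\<in>carrier (standard_group m).
          \<Psi> ` standard_grading m g = line model_matrices (X (\<phi> g))))"
proof -
  interpret real_alg model_matrices by (rule real_alg_matrix_algebra)
  have nt: "\<one>\<^bsub>model_matrices\<^esub> \<noteq> \<zero>\<^bsub>model_matrices\<^esub>" by (rule matrix_algebra_nontrivial) simp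
  have "finite (carrier T)" using c by (metis card.infinite power_not_zero zero_neq_numeral)
  then interpret Q: quad_form T \<mu>
    using T adm by (simp add: quad_form_def quad_form_axioms_def admissible_form_def)
  obtain u v where symp: "symplectic T \<mu> m u v"
    using Q.symplectic_exists[OF m c] adm by (auto simp: admissible_form_def)
  have "\<exists>\<Psi>\<in>algebra_iso (standard_algebra m) model_matrices. \<forall>g\<in>carrier (standard_group m).
      \<Psi> ` standard_grading m g = line model_matrices (X (Q.coord m u v g))"
    if sb: "sign_basis T model_matrices \<mu> X" for X
  proof -
    note fr = sign_basis_frame[OF nt sb Q.quad_form_axioms symp]
    interpret F: tensor_frame model_matrices m "\<lambda>i. X (u i)" "\<lambda>i. X (v i)" "matrix_unit (2 ^ (m - 1))" "unit_index (2 ^ (m - 1))"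
      by (rule tensor_frame_matrix_algebra[OF m fr(1)])
    show ?thesis using F.tensor_map_iso F.tensor_map_grading(1) fr(2) by (metis (lifting))
  qed
  then show ?thesis using Q.coord_iso[OF symp c] Q.mu_coord[OF symp] by blast
qed

text \<open>These facts do not mention a frame, but their proofs need one in the matrix algebra; the
  explicit one serves.\<close>

lemma standard_algebra_facts:
  shows "real_alg (standard_algebra m)"
    "algebra_iso (standard_algebra m) model_matrices \<noteq> {}"
    "abelian_division_grading_1 (standard_group m) (standard_algebra m) (standard_grading m)"
    "\<And>g. g \<in> carrier (standard_group m) \<Longrightarrow> standard_grading m g \<subseteq> carrier (standard_algebra m)"
proof -
  obtain U V where "frame model_matrices m U V" using quaternion_frame_exists by blast
  then interpret tensor_frame "model_matrices" m U V "matrix_unit (2 ^ (m - 1))" "unit_index (2 ^ (m - 1))"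
    by (rule tensor_frame_matrix_algebra[OF m])
  show "real_alg (standard_algebra m)" by (rule real_alg_standard_algebra)
  show "algebra_iso (standard_algebra m) model_matrices \<noteq> {}" using tensor_map_iso by blast
  show "abelian_division_grading_1 (standard_group m) (standard_algebra m) (standard_grading m)"
    by (rule standard_grading_division)
  show "standard_grading m g \<subseteq> carrier (standard_algebra m)" if "g \<in> carrier (standard_group m)" for g
    by (rule tensor_map_grading(2)[OF that])
qed

lemma sign_basis_to_standard:
  assumes sb: "sign_basis T model_matrices \<mu> X"
  shows "\<exists>\<phi>\<in>iso (standard_group m) T.
    \<forall>Y. sign_basis T model_matrices \<mu> Y \<longrightarrow>
      (\<exists>\<Psi>\<in>algebra_iso (standard_algebra m) model_matrices.
       \<exists>\<Theta>\<in>algebra_iso model_matrices (standard_algebra m).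
        \<forall>g\<in>carrier (standard_group m).
          \<Psi> ` standard_grading m g = line model_matrices (Y (\<phi> g)) \<and>
          \<Theta> ` line model_matrices (Y (\<phi> g)) = standard_grading m g)"
proof -
  have k: "(2 :: nat) ^ (m - 1) > 0" by simp
  note adm = sign_basis_admissible[OF k sb]
  have c: "card (carrier T) = 4 ^ m" using adm(3) card_half_power[OF m] by simp
  interpret Q: quad_form T \<mu> by (rule adm(2))
  obtain \<phi> where \<phi>: "\<phi> \<in> iso (standard_group m) T"
    "\<forall>Y. sign_basis T model_matrices \<mu> Y \<longrightarrow>
      (\<exists>\<Psi>\<in>algebra_iso (standard_algebra m) model_matrices.
        \<forall>g\<in>carrier (standard_group m).
          \<Psi> ` standard_grading m g = line model_matrices (Y (\<phi> g)))"
    using standard_model[OF Q.T.comm_group_axioms c adm(1)] by blast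
  show ?thesis
  proof (intro bexI[OF _ \<phi>(1)] allI impI)
    fix Y assume "sign_basis T model_matrices \<mu> Y"
    then obtain \<Psi> where \<Psi>: "\<Psi> \<in> algebra_iso (standard_algebra m) model_matrices"
      "\<forall>g\<in>carrier (standard_group m).
        \<Psi> ` standard_grading m g = line model_matrices (Y (\<phi> g))"
      using \<phi>(2) by blast
    have "inv_into (carrier (standard_algebra m)) \<Psi> ` line model_matrices (Y (\<phi> g))
      = standard_grading m g" if "g \<in> carrier (standard_group m)" for g
      using \<Psi>(2) that by (intro algebra_iso_inverse_image[OF \<Psi>(1) standard_algebra_facts(4)]) auto
    then show "\<exists>\<Psi>\<in>algebra_iso (standard_algebra m) model_matrices.
       \<exists>\<Theta>\<in>algebra_iso model_matrices (standard_algebra m).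
        \<forall>g\<in>carrier (standard_group m).
          \<Psi> ` standard_grading m g = line model_matrices (Y (\<phi> g)) \<and>
          \<Theta> ` line model_matrices (Y (\<phi> g)) = standard_grading m g"
      using \<Psi> algebra_iso_inverse[OF standard_algebra_facts(1) \<Psi>(1)] by blast
  qed
qed

text \<open>The isomorphism goes through the tensor product, from the first basis by
  \<open>\<Theta>\<close> and on to the second by \<open>\<Psi>\<close>.\<close>

lemma sign_basis_isomorphic:
  assumes X: "sign_basis T model_matrices \<mu> X"
    and Y: "sign_basis T model_matrices \<mu> Y"
  shows "\<exists>\<psi>\<in>algebra_iso model_matrices model_matrices.
    \<forall>t\<in>carrier T. \<psi> ` line model_matrices (X t)
      = line model_matrices (Y t)"
proof -
  obtain \<phi> where \<phi>: "\<phi> \<in> iso (standard_group m) T"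
    "\<forall>Y. sign_basis T model_matrices \<mu> Y \<longrightarrow>
      (\<exists>\<Psi>\<in>algebra_iso (standard_algebra m) model_matrices. \<exists>\<Theta>\<in>algebra_iso model_matrices (standard_algebra m).
        \<forall>g\<in>carrier (standard_group m). \<Psi> ` standard_grading m g = line model_matrices (Y (\<phi> g)) \<and>
          \<Theta> ` line model_matrices (Y (\<phi> g)) = standard_grading m g)"
    using sign_basis_to_standard[OF X] by blast
  obtain \<Theta> where \<Theta>: "\<Theta> \<in> algebra_iso model_matrices (standard_algebra m)"
    "\<forall>g\<in>carrier (standard_group m). \<Theta> ` line model_matrices (X (\<phi> g)) = standard_grading m g"
    using \<phi>(2) X by meson
  obtain \<Psi> where \<Psi>: "\<Psi> \<in> algebra_iso (standard_algebra m) model_matrices"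
    "\<forall>g\<in>carrier (standard_group m). \<Psi> ` standard_grading m g = line model_matrices (Y (\<phi> g))"
    using \<phi>(2) Y by meson
  have T: "carrier T = \<phi> ` carrier (standard_group m)" using \<phi>(1) by (simp add: iso_def bij_betw_def)
  have key: "(\<Psi> \<circ> \<Theta>) ` line model_matrices (X (\<phi> g)) = line model_matrices (Y (\<phi> g))" if "g \<in> carrier (standard_group m)" for g
    unfolding image_comp[symmetric] bspec[OF \<Theta>(2) that] bspec[OF \<Psi>(2) that] by (rule refl)
  have "(\<Psi> \<circ> \<Theta>) ` line model_matrices (X t) = line model_matrices (Y t)" if "t \<in> carrier T" for t
  proof -
    have "t \<in> \<phi> ` carrier (standard_group m)" using that T by simp
    then obtain g where "g \<in> carrier (standard_group m)" "t = \<phi> g" by blast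
    then show ?thesis using key by (simp only:)
  qed
  then show ?thesis by (intro bexI[OF _ algebra_iso_compose[OF \<Theta>(1) \<Psi>(1)]] ballI)
qed

lemma sign_basis_equivalent_standard:
  assumes X: "sign_basis T model_matrices \<mu> X"
  shows "\<exists>\<phi>\<in>iso (standard_group m) T. \<exists>\<Theta>\<in>algebra_iso model_matrices (standard_algebra m).
    \<exists>\<Psi>\<in>algebra_iso (standard_algebra m) model_matrices.
    \<forall>g\<in>carrier (standard_group m).
      \<Theta> ` line model_matrices (X (\<phi> g)) = standard_grading m g \<and>
      \<Psi> ` standard_grading m g = line model_matrices (X (\<phi> g))"
proof -
  obtain \<phi> where \<phi>: "\<phi> \<in> iso (standard_group m) T"
    "\<forall>Y. sign_basis T model_matrices \<mu> Y \<longrightarrow>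
      (\<exists>\<Psi>\<in>algebra_iso (standard_algebra m) model_matrices. \<exists>\<Theta>\<in>algebra_iso model_matrices (standard_algebra m).
        \<forall>g\<in>carrier (standard_group m). \<Psi> ` standard_grading m g = line model_matrices (Y (\<phi> g)) \<and>
          \<Theta> ` line model_matrices (Y (\<phi> g)) = standard_grading m g)"
    using sign_basis_to_standard[OF X] by blast
  obtain \<Psi> \<Theta> where \<Theta>: "\<Theta> \<in> algebra_iso model_matrices (standard_algebra m)"
    "\<Psi> \<in> algebra_iso (standard_algebra m) model_matrices"
    "\<forall>g\<in>carrier (standard_group m). \<Psi> ` standard_grading m g = line model_matrices (X (\<phi> g)) \<and>
      \<Theta> ` line model_matrices (X (\<phi> g)) = standard_grading m g"
    using \<phi>(2) X by meson
  show ?thesis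
  proof (rule bexI[OF _ \<phi>(1)], rule bexI[OF _ \<Theta>(1)], rule bexI[OF _ \<Theta>(2)], rule ballI, rule conjI)
    fix g assume g: "g \<in> carrier (standard_group m)"
    show "\<Theta> ` line model_matrices (X (\<phi> g)) = standard_grading m g" by (rule conjunct2[OF bspec[OF \<Theta>(3) g]])
    show "\<Psi> ` standard_grading m g = line model_matrices (X (\<phi> g))" by (rule conjunct1[OF bspec[OF \<Theta>(3) g]])
  qed
qed

lemma nontrivial_model: "\<one>\<^bsub>model_matrices\<^esub> \<noteq> \<zero>\<^bsub>model_matrices\<^esub>"
  by (rule matrix_algebra_nontrivial) simp

lemma grading_data:
  assumes gr: "abelian_division_grading_1 G model_matrices \<Gamma>"
  obtains S X \<mu> where "grading_support G model_matrices \<Gamma> = S" "subgroup S G" "sign_basis (G\<lparr>carrier := S\<rparr>) model_matrices \<mu> X"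
    "\<And>t. t \<in> S \<Longrightarrow> \<Gamma> t = line model_matrices (X t)" "\<And>t. t \<in> carrier G \<Longrightarrow> t \<notin> S \<Longrightarrow> \<Gamma> t = {\<zero>\<^bsub>model_matrices\<^esub>}"
    "\<And>\<nu>. square_sign G model_matrices \<Gamma> \<nu> \<longleftrightarrow> \<nu> = \<mu>"
proof -
  interpret real_alg model_matrices by (rule real_alg_matrix_algebra)
  define S where "S = grading_support G model_matrices \<Gamma>"
  have k: "(2 :: nat) ^ (m - 1) > 0" by simp
  note st = grading_sign_basis[OF k gr, folded S_def]
  obtain X \<mu> where sb: "sign_basis (G\<lparr>carrier := S\<rparr>) model_matrices \<mu> X" and \<Gamma>: "\<forall>t\<in>S. \<Gamma> t = line model_matrices (X t)"
    using st(2) by blast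
  show thesis
  proof (rule that[OF S_def[symmetric] st(1) sb])
    show "\<Gamma> t = line model_matrices (X t)" if "t \<in> S" for t using \<Gamma> that by blast
    show "\<Gamma> t = {\<zero>\<^bsub>model_matrices\<^esub>}" if "t \<in> carrier G" "t \<notin> S" for t using that by (simp add: S_def grading_support_def)
    show "square_sign G model_matrices \<Gamma> \<nu> \<longleftrightarrow> \<nu> = \<mu>" for \<nu>
      by (rule square_sign_iff[OF nontrivial_model sb S_def[symmetric] \<Gamma>])
  qed
qed

lemma support_and_sign:
  assumes gr: "abelian_division_grading_1 G model_matrices \<Gamma>"
  shows "subgroup (grading_support G model_matrices \<Gamma>) G"
    "G\<lparr>carrier := grading_support G model_matrices \<Gamma>\<rparr> \<cong> Z2_power (2 * m)"
    "\<exists>!\<mu>. square_sign G model_matrices \<Gamma> \<mu>"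
proof -
  obtain S X \<mu> where S: "grading_support G model_matrices \<Gamma> = S" and sg: "subgroup S G"
    and sb: "sign_basis (G\<lparr>carrier := S\<rparr>) model_matrices \<mu> X" and sq: "\<And>\<nu>. square_sign G model_matrices \<Gamma> \<nu> \<longleftrightarrow> \<nu> = \<mu>"
    using grading_data[OF gr] by metis
  show "subgroup (grading_support G model_matrices \<Gamma>) G" using sg S by simp
  show "\<exists>!\<mu>. square_sign G model_matrices \<Gamma> \<mu>" unfolding sq by simp
  interpret std: comm_group "standard_group m" by (rule comm_group_standard_group)
  have "standard_group m \<cong> G\<lparr>carrier := S\<rparr>"
    using sign_basis_to_standard[OF sb] by (auto simp: is_iso_def)
  then have "G\<lparr>carrier := S\<rparr> \<cong> standard_group m" by (rule std.iso_sym)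
  then show "G\<lparr>carrier := grading_support G model_matrices \<Gamma>\<rparr> \<cong> Z2_power (2 * m)"
    unfolding S using standard_group_iso_Z2_power by (rule iso_trans)
qed

text \<open>An algebra isomorphism respects real multiples of \<one>, so the equation for a square
  is carried over unchanged.\<close>

lemma isomorphic_imp_same_sign:
  assumes \<Gamma>: "abelian_division_grading_1 G model_matrices \<Gamma>" and \<Delta>: "abelian_division_grading_1 G model_matrices \<Delta>"
    and iso: "graded_isomorphic G model_matrices \<Gamma> model_matrices \<Delta>" and \<mu>: "square_sign G model_matrices \<Gamma> \<mu>"
  shows "grading_support G model_matrices \<Gamma> = grading_support G model_matrices \<Delta>" "square_sign G model_matrices \<Delta> \<mu>"
proof -
  interpret real_alg model_matrices by (rule real_alg_matrix_algebra)
  obtain \<psi> where \<psi>: "\<psi> \<in> algebra_iso model_matrices model_matrices" "\<And>g. g \<in> carrier G \<Longrightarrow> \<psi> ` \<Gamma> g = \<Delta> g"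
    using iso by (auto simp: graded_isomorphic_def)
  have sub: "\<Gamma> g \<subseteq> carrier model_matrices" if "g \<in> carrier G" for g
    using \<Gamma> that by (auto simp: abelian_division_grading_1_def division_grading_def graded_algebra_def
        VectorSpace.subspace_def LinearCombinations.submodule_def)
  note iso = algebra_isoD[OF \<psi>(1)]
  have zero: "\<psi> \<zero>\<^bsub>model_matrices\<^esub> = \<zero>\<^bsub>model_matrices\<^esub>" by (rule algebra_iso_zero[OF real_alg_axioms real_alg_axioms \<psi>(1)])
  have zero_iff: "\<psi> x = \<zero>\<^bsub>model_matrices\<^esub> \<longleftrightarrow> x = \<zero>\<^bsub>model_matrices\<^esub>" if "x \<in> carrier model_matrices" for x
    using zero inj_onD[OF bij_betw_imp_inj_on[OF iso(1)], of x "\<zero>\<^bsub>model_matrices\<^esub>"] that zero_closed by auto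
  have "\<Delta> g = {\<zero>\<^bsub>model_matrices\<^esub>} \<longleftrightarrow> \<Gamma> g = {\<zero>\<^bsub>model_matrices\<^esub>}" if g: "g \<in> carrier G" for g
  proof
    assume "\<Gamma> g = {\<zero>\<^bsub>model_matrices\<^esub>}"
    then show "\<Delta> g = {\<zero>\<^bsub>model_matrices\<^esub>}" using \<psi>(2)[OF g] zero by auto
  next
    assume D: "\<Delta> g = {\<zero>\<^bsub>model_matrices\<^esub>}"
    then have "x = \<zero>\<^bsub>model_matrices\<^esub>" if "x \<in> \<Gamma> g" for x
      using that \<psi>(2)[OF g] zero_iff sub[OF g] by blast
    moreover have "\<Gamma> g \<noteq> {}" using D \<psi>(2)[OF g] by auto
    ultimately show "\<Gamma> g = {\<zero>\<^bsub>model_matrices\<^esub>}" by blast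
  qed
  then show S: "grading_support G model_matrices \<Gamma> = grading_support G model_matrices \<Delta>" by (auto simp: grading_support_def)
  have "\<exists>r>0. y \<otimes>\<^bsub>model_matrices\<^esub> y = (r * \<mu> t) \<odot>\<^bsub>model_matrices\<^esub> \<one>\<^bsub>model_matrices\<^esub>"
    if t: "t \<in> grading_support G model_matrices \<Delta>" and y: "y \<in> \<Delta> t" "y \<noteq> \<zero>\<^bsub>model_matrices\<^esub>" for t y
  proof -
    have tG: "t \<in> carrier G" using t by (simp add: grading_support_def)
    obtain x where x: "x \<in> \<Gamma> t" "y = \<psi> x" using y \<psi>(2)[OF tG] by blast
    have xA: "x \<in> carrier model_matrices" using x sub tG by blast
    have "x \<noteq> \<zero>\<^bsub>model_matrices\<^esub>" using x y zero by blast
    then obtain r where r: "r > 0" "x \<otimes>\<^bsub>model_matrices\<^esub> x = (r * \<mu> t) \<odot>\<^bsub>model_matrices\<^esub> \<one>\<^bsub>model_matrices\<^esub>"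
      using \<mu> x(1) t S unfolding square_sign_def by blast
    have "y \<otimes>\<^bsub>model_matrices\<^esub> y = \<psi> (x \<otimes>\<^bsub>model_matrices\<^esub> x)" using iso(3)[OF xA xA] x(2) by simp
    also have "\<dots> = (r * \<mu> t) \<odot>\<^bsub>model_matrices\<^esub> \<one>\<^bsub>model_matrices\<^esub>" unfolding r(2) iso(6)[OF one_closed] iso(5) by (rule refl)
    finally show ?thesis using r(1) by blast
  qed
  then show "square_sign G model_matrices \<Delta> \<mu>" using \<mu> S by (simp add: square_sign_def)
qed

text \<open>On the common support the lines are matched through the tensor product; elsewhere both
  gradings have zero components.\<close>

lemma same_sign_imp_isomorphic:
  assumes \<Gamma>: "abelian_division_grading_1 G model_matrices \<Gamma>" and \<Delta>: "abelian_division_grading_1 G model_matrices \<Delta>"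
    and S: "grading_support G model_matrices \<Gamma> = grading_support G model_matrices \<Delta>"
    and sq: "square_sign G model_matrices \<Gamma> \<mu>" "square_sign G model_matrices \<Delta> \<mu>"
  shows "graded_isomorphic G model_matrices \<Gamma> model_matrices \<Delta>"
proof -
  interpret real_alg model_matrices by (rule real_alg_matrix_algebra)
  obtain S1 X \<mu>1 where 1: "grading_support G model_matrices \<Gamma> = S1" "sign_basis (G\<lparr>carrier := S1\<rparr>) model_matrices \<mu>1 X"
    "\<And>t. t \<in> S1 \<Longrightarrow> \<Gamma> t = line model_matrices (X t)" "\<And>t. t \<in> carrier G \<Longrightarrow> t \<notin> S1 \<Longrightarrow> \<Gamma> t = {\<zero>\<^bsub>model_matrices\<^esub>}"
    "\<And>\<nu>. square_sign G model_matrices \<Gamma> \<nu> \<longleftrightarrow> \<nu> = \<mu>1"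
    by (rule grading_data[OF \<Gamma>]) blast
  obtain S2 Y \<mu>2 where 2: "grading_support G model_matrices \<Delta> = S2" "sign_basis (G\<lparr>carrier := S2\<rparr>) model_matrices \<mu>2 Y"
    "\<And>t. t \<in> S2 \<Longrightarrow> \<Delta> t = line model_matrices (Y t)" "\<And>t. t \<in> carrier G \<Longrightarrow> t \<notin> S2 \<Longrightarrow> \<Delta> t = {\<zero>\<^bsub>model_matrices\<^esub>}"
    "\<And>\<nu>. square_sign G model_matrices \<Delta> \<nu> \<longleftrightarrow> \<nu> = \<mu>2"
    by (rule grading_data[OF \<Delta>]) blast
  have eq: "S2 = S1" "\<mu>1 = \<mu>" "\<mu>2 = \<mu>" using S 1(1,5) 2(1,5) sq by auto
  obtain \<psi> where \<psi>: "\<psi> \<in> algebra_iso model_matrices model_matrices" "\<And>t. t \<in> S1 \<Longrightarrow> \<psi> ` line model_matrices (X t) = line model_matrices (Y t)"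
    using sign_basis_isomorphic[OF 1(2)[unfolded eq] 2(2)[unfolded eq]] by auto
  have zero: "\<psi> \<zero>\<^bsub>model_matrices\<^esub> = \<zero>\<^bsub>model_matrices\<^esub>" by (rule algebra_iso_zero[OF real_alg_axioms real_alg_axioms \<psi>(1)])
  have "\<psi> ` \<Gamma> g = \<Delta> g" if g: "g \<in> carrier G" for g
  proof (cases "g \<in> S1")
    case True
    then show ?thesis using 1(3) 2(3) \<psi>(2) eq(1) by simp
  next
    case False
    then show ?thesis using 1(4)[OF g] 2(4)[OF g] eq(1) zero by simp
  qed
  then show ?thesis using \<psi>(1) unfolding graded_isomorphic_def by blast
qed

text \<open>Both directions are recorded so that the map from one grading can be composed with the
  map to another, possibly over a different group.\<close>

lemma equivalent_standard:
  assumes \<Gamma>: "abelian_division_grading_1 G model_matrices \<Gamma>"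
  shows "\<exists>\<theta>\<in>algebra_iso model_matrices (standard_algebra m). \<forall>t\<in>grading_support G model_matrices \<Gamma>.
      \<exists>g\<in>carrier (standard_group m). \<theta> ` \<Gamma> t = standard_grading m g"
    and "\<exists>\<psi>\<in>algebra_iso (standard_algebra m) model_matrices. \<forall>g\<in>carrier (standard_group m).
      \<exists>t\<in>carrier G. \<psi> ` standard_grading m g = \<Gamma> t"
proof -
  obtain S X \<mu> where S: "grading_support G model_matrices \<Gamma> = S" "subgroup S G" "sign_basis (G\<lparr>carrier := S\<rparr>) model_matrices \<mu> X"
    "\<And>t. t \<in> S \<Longrightarrow> \<Gamma> t = line model_matrices (X t)"
    by (rule grading_data[OF \<Gamma>]) blast
  obtain \<phi> \<theta> \<psi> where \<phi>: "\<phi> \<in> iso (standard_group m) (G\<lparr>carrier := S\<rparr>)" and \<theta>: "\<theta> \<in> algebra_iso model_matrices (standard_algebra m)"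
    and \<psi>: "\<psi> \<in> algebra_iso (standard_algebra m) model_matrices"
    and g: "\<And>g. g \<in> carrier (standard_group m) \<Longrightarrow> \<theta> ` line model_matrices (X (\<phi> g)) = standard_grading m g"
      "\<And>g. g \<in> carrier (standard_group m) \<Longrightarrow> \<psi> ` standard_grading m g = line model_matrices (X (\<phi> g))"
    using sign_basis_equivalent_standard[OF S(3)] by (elim bexE) blast
  have \<phi>S: "\<phi> ` carrier (standard_group m) = S" using \<phi> by (simp add: iso_def bij_betw_def)
  have "\<exists>g\<in>carrier (standard_group m). \<theta> ` \<Gamma> t = standard_grading m g" if t: "t \<in> S" for t
  proof -
    have "t \<in> \<phi> ` carrier (standard_group m)" using t \<phi>S by simp
    then obtain s where s: "s \<in> carrier (standard_group m)" "t = \<phi> s" by blast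
    have "\<theta> ` \<Gamma> t = standard_grading m s" unfolding S(4)[OF t] unfolding s(2) by (rule g(1)[OF s(1)])
    then show ?thesis using s(1) by blast
  qed
  then show "\<exists>\<theta>\<in>algebra_iso model_matrices (standard_algebra m). \<forall>t\<in>grading_support G model_matrices \<Gamma>.
      \<exists>g\<in>carrier (standard_group m). \<theta> ` \<Gamma> t = standard_grading m g"
    unfolding S(1) by (intro bexI[OF _ \<theta>] ballI)
  have "\<exists>t\<in>carrier G. \<psi> ` standard_grading m s = \<Gamma> t" if s: "s \<in> carrier (standard_group m)" for s
  proof -
    have tS: "\<phi> s \<in> S" using s \<phi>S by blast
    have "\<psi> ` standard_grading m s = \<Gamma> (\<phi> s)" unfolding S(4)[OF tS] by (rule g(2)[OF s])
    then show ?thesis using tS subgroup.subset[OF S(2)] by blast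
  qed
  then show "\<exists>\<psi>\<in>algebra_iso (standard_algebra m) model_matrices. \<forall>g\<in>carrier (standard_group m).
      \<exists>t\<in>carrier G. \<psi> ` standard_grading m g = \<Gamma> t"
    by (intro bexI[OF _ \<psi>] ballI)
qed

text \<open>The forms of the two gradings need not agree: equivalence allows degrees to be renamed,
  and passing through standard coordinates absorbs the difference.\<close>

lemma gradings_equivalent:
  assumes "abelian_division_grading_1 G model_matrices \<Gamma>" and "abelian_division_grading_1 H model_matrices \<Delta>"
  shows "graded_equivalent G model_matrices \<Gamma> H model_matrices \<Delta>"
proof -
  obtain \<theta> where \<theta>: "\<theta> \<in> algebra_iso model_matrices (standard_algebra m)"
    "\<forall>t\<in>grading_support G model_matrices \<Gamma>. \<exists>g\<in>carrier (standard_group m). \<theta> ` \<Gamma> t = standard_grading m g"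
    using equivalent_standard(1)[OF assms(1)] by (elim bexE)
  obtain \<psi> where \<psi>: "\<psi> \<in> algebra_iso (standard_algebra m) model_matrices"
    "\<forall>g\<in>carrier (standard_group m). \<exists>t\<in>carrier H. \<psi> ` standard_grading m g = \<Delta> t"
    using equivalent_standard(2)[OF assms(2)] by (elim bexE)
  have "\<exists>h\<in>carrier H. (\<psi> \<circ> \<theta>) ` \<Gamma> t = \<Delta> h" if t: "t \<in> grading_support G model_matrices \<Gamma>" for t
  proof -
    obtain g where g: "g \<in> carrier (standard_group m)" "\<theta> ` \<Gamma> t = standard_grading m g"
      using bspec[OF \<theta>(2) t] by (elim bexE)
    obtain h where h: "h \<in> carrier H" "\<psi> ` standard_grading m g = \<Delta> h"
      using bspec[OF \<psi>(2) g(1)] by (elim bexE)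
    have "(\<psi> \<circ> \<theta>) ` \<Gamma> t = \<Delta> h" unfolding image_comp[symmetric] g(2) h(2) by (rule refl)
    then show ?thesis using h(1) by blast
  qed
  then show ?thesis
    unfolding graded_equivalent_def by (intro bexI[OF _ algebra_iso_compose[OF \<theta>(1) \<psi>(1)]] ballI)
qed

text \<open>In symplectic coordinates every admissible form has the standard values, which the
  explicit matrix frame attains.\<close>

lemma admissible_form_realized:
  assumes T: "comm_group T" and c: "card (carrier T) = 4 ^ m" and adm: "admissible_form T \<mu>"
  shows "\<exists>\<Gamma>\<in>full_gradings T model_matrices. square_sign T model_matrices \<Gamma> \<mu>"
proof -
  obtain U V where fr: "frame model_matrices m U V" using quaternion_frame_exists by blast
  interpret tensor_frame model_matrices m U V "matrix_unit (2 ^ (m - 1))" "unit_index (2 ^ (m - 1))"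
    by (rule tensor_frame_matrix_algebra[OF m fr])
  obtain \<phi> where \<phi>: "\<phi> \<in> iso (standard_group m) T"
    "\<And>g. g \<in> carrier (standard_group m) \<Longrightarrow> \<mu> (\<phi> g) = (\<Prod>i<m. form_sign (factor_sign m i) (g i))"
    using standard_model[OF T c adm] by blast
  have \<mu>: "\<mu> \<in> carrier T \<rightarrow>\<^sub>E {1, -1}" using adm by (simp add: admissible_form_def quadratic_forms_def)
  define Z where "Z t = X (inv_into S \<phi> t)" for t
  have sb: "sign_basis T model_matrices \<mu> Z"
    unfolding Z_def by (rule frame_sign_basis[OF nontriv fr sp T \<phi>(1) \<mu> \<phi>(2)])
  then have gb: "graded_basis T model_matrices Z" by (simp add: sign_basis_def)
  define \<Gamma> where "\<Gamma> t = line model_matrices (Z t)" for t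
  have gr: "abelian_division_grading_1 T model_matrices \<Gamma>" "grading_support T model_matrices \<Gamma> = carrier T"
    by (rule graded_basis_imp_grading[OF gb], simp add: \<Gamma>_def)+
  have "sign_basis (T\<lparr>carrier := carrier T\<rparr>) model_matrices \<mu> Z" using sb by simp
  from square_sign_iff[OF nontriv this gr(2), of \<mu>] have "square_sign T model_matrices \<Gamma> \<mu>"
    by (simp only: \<Gamma>_def simp_thms Ball_def)
  then show ?thesis using gr by (auto simp: full_gradings_def)
qed

section \<open>The bijection between isomorphism classes and forms\<close>

lemma full_gradings_sign:
  assumes "\<Gamma> \<in> full_gradings T model_matrices"
  shows "\<exists>\<mu>. admissible_form T \<mu> \<and> (\<forall>\<nu>. square_sign T model_matrices \<Gamma> \<nu> \<longleftrightarrow> \<nu> = \<mu>)"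
proof -
  have gr: "abelian_division_grading_1 T model_matrices \<Gamma>" and S: "grading_support T model_matrices \<Gamma> = carrier T"
    using assms by (auto simp: full_gradings_def)
  obtain S' X \<mu> where X: "grading_support T model_matrices \<Gamma> = S'" "sign_basis (T\<lparr>carrier := S'\<rparr>) model_matrices \<mu> X"
    "\<And>\<nu>. square_sign T model_matrices \<Gamma> \<nu> \<longleftrightarrow> \<nu> = \<mu>"
    by (rule grading_data[OF gr]) blast
  have "sign_basis T model_matrices \<mu> X" using X(1,2) S by simp
  then have "admissible_form T \<mu>" by (rule sign_basis_admissible(1)[rotated]) simp
  then show ?thesis using X(3) by blast
qed

text \<open>The isomorphism classes are the fibres of the sign function \<open>sg\<close>, which
  gives injectivity; realization of every admissible form gives surjectivity.\<close>

lemma sign_correspondence: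
  assumes T: "comm_group T" and c: "card (carrier T) = 4 ^ m"
  shows "\<exists>\<Phi>. (\<forall>\<Gamma>\<in>full_gradings T model_matrices. square_sign T model_matrices \<Gamma> (\<Phi> (full_grading_iso_rel T model_matrices `` {\<Gamma>}))) \<and>
    bij_betw \<Phi> (full_gradings T model_matrices // full_grading_iso_rel T model_matrices) {\<mu>. admissible_form T \<mu>}"
proof -
  let ?F = "full_gradings T model_matrices" and ?R = "full_grading_iso_rel T model_matrices"
  define sg where "sg \<Gamma> = (THE \<mu>. square_sign T model_matrices \<Gamma> \<mu>)" for \<Gamma>
  have sg: "admissible_form T (sg \<Gamma>)" "square_sign T model_matrices \<Gamma> \<nu> \<longleftrightarrow> \<nu> = sg \<Gamma>" if \<Gamma>: "\<Gamma> \<in> ?F" for \<Gamma> \<nu>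
  proof -
    obtain \<mu> where \<mu>: "admissible_form T \<mu>" "\<And>\<nu>. square_sign T model_matrices \<Gamma> \<nu> \<longleftrightarrow> \<nu> = \<mu>"
      using full_gradings_sign[OF \<Gamma>] by blast
    have "sg \<Gamma> = \<mu>" unfolding sg_def by (rule the_equality) (simp_all only: \<mu>(2))
    then show "admissible_form T (sg \<Gamma>)" "square_sign T model_matrices \<Gamma> \<nu> \<longleftrightarrow> \<nu> = sg \<Gamma>" using \<mu> by auto
  qed
  have rel: "(\<Gamma>, \<Delta>) \<in> ?R \<longleftrightarrow> sg \<Gamma> = sg \<Delta>" if "\<Gamma> \<in> ?F" "\<Delta> \<in> ?F" for \<Gamma> \<Delta>
  proof -
    have gr: "abelian_division_grading_1 T model_matrices \<Gamma>" "abelian_division_grading_1 T model_matrices \<Delta>"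
      "grading_support T model_matrices \<Gamma> = grading_support T model_matrices \<Delta>"
      using that by (auto simp: full_gradings_def)
    have "graded_isomorphic T model_matrices \<Gamma> model_matrices \<Delta> \<longleftrightarrow> sg \<Gamma> = sg \<Delta>"
      using isomorphic_imp_same_sign(2)[OF gr(1,2)] same_sign_imp_isomorphic[OF gr] sg(2) that by metis
    then show ?thesis using that by (simp add: full_grading_iso_rel_def)
  qed
  have cls: "?R `` {\<Gamma>} = {\<Delta> \<in> ?F. sg \<Delta> = sg \<Gamma>}" if "\<Gamma> \<in> ?F" for \<Gamma>
  proof (intro equalityI subsetI)
    fix \<Delta> assume "\<Delta> \<in> ?R `` {\<Gamma>}"
    then have "(\<Gamma>, \<Delta>) \<in> ?R" by blast
    moreover from this have "\<Delta> \<in> ?F" by (simp add: full_grading_iso_rel_def)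
    ultimately show "\<Delta> \<in> {\<Delta> \<in> ?F. sg \<Delta> = sg \<Gamma>}" using rel[OF that] by simp
  next
    fix \<Delta> assume "\<Delta> \<in> {\<Delta> \<in> ?F. sg \<Delta> = sg \<Gamma>}"
    then have "(\<Gamma>, \<Delta>) \<in> ?R" using rel[OF that] by simp
    then show "\<Delta> \<in> ?R `` {\<Gamma>}" by blast
  qed
  \<comment> \<open>Any representative may be chosen, because \<open>sg\<close> is constant on a
    class by \<open>cls\<close>.\<close>
  define \<Phi> where "\<Phi> C = sg (SOME \<Gamma>. \<Gamma> \<in> C)" for C
  have \<Phi>: "\<Phi> (?R `` {\<Gamma>}) = sg \<Gamma>" if "\<Gamma> \<in> ?F" for \<Gamma>
  proof -
    have "(SOME \<Delta>. \<Delta> \<in> {\<Delta> \<in> ?F. sg \<Delta> = sg \<Gamma>}) \<in> {\<Delta> \<in> ?F. sg \<Delta> = sg \<Gamma>}"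
      by (rule someI[of "\<lambda>\<Delta>. \<Delta> \<in> {\<Delta> \<in> ?F. sg \<Delta> = sg \<Gamma>}" \<Gamma>]) (use that in \<open>simp only: mem_Collect_eq simp_thms\<close>)
    then show ?thesis unfolding \<Phi>_def cls[OF that] by blast
  qed
  have "bij_betw \<Phi> (?F // ?R) {\<mu>. admissible_form T \<mu>}"
    unfolding bij_betw_def
  proof
    show "inj_on \<Phi> (?F // ?R)"
    proof (rule inj_onI)
      fix C D assume "C \<in> ?F // ?R" "D \<in> ?F // ?R" and eq: "\<Phi> C = \<Phi> D"
      then obtain \<Gamma> \<Delta> where "\<Gamma> \<in> ?F" "C = ?R `` {\<Gamma>}" "\<Delta> \<in> ?F" "D = ?R `` {\<Delta>}"
        by (auto elim!: quotientE)
      then show "C = D" using eq \<Phi> cls by simp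
    qed
    show "\<Phi> ` (?F // ?R) = {\<mu>. admissible_form T \<mu>}"
    proof (intro equalityI subsetI)
      fix \<mu> assume "\<mu> \<in> \<Phi> ` (?F // ?R)"
      then obtain \<Gamma> where "\<Gamma> \<in> ?F" "\<mu> = \<Phi> (?R `` {\<Gamma>})" by (auto elim!: quotientE)
      then show "\<mu> \<in> {\<mu>. admissible_form T \<mu>}" using sg(1) \<Phi> by simp
    next
      fix \<mu> assume "\<mu> \<in> {\<mu>. admissible_form T \<mu>}"
      then obtain \<Gamma> where \<Gamma>: "\<Gamma> \<in> ?F" "square_sign T model_matrices \<Gamma> \<mu>"
        using admissible_form_realized[OF T c] by blast
      then have "\<mu> = \<Phi> (?R `` {\<Gamma>})" using sg(2) \<Phi> by simp
      then show "\<mu> \<in> \<Phi> ` (?F // ?R)" using quotientI[OF \<Gamma>(1)] by blast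
    qed
  qed
  moreover have "\<forall>\<Gamma>\<in>?F. square_sign T model_matrices \<Gamma> (\<Phi> (?R `` {\<Gamma>}))" using \<Phi> sg(2) by simp
  ultimately show ?thesis by blast
qed

text \<open>The form is read off from the squares in the explicit frame. Its type and its Arf
  invariant then follow from the general statements on gradings of the matrix algebra, without a
  separate count of signs.\<close>

lemma admissible_form_exists: "\<exists>\<mu>. admissible_form (Z2_power (2 * m)) \<mu>"
proof -
  obtain U V where fr: "frame model_matrices m U V" using quaternion_frame_exists by blast
  interpret tensor_frame model_matrices m U V "matrix_unit (2 ^ (m - 1))" "unit_index (2 ^ (m - 1))"
    by (rule tensor_frame_matrix_algebra[OF m fr])
  obtain \<phi> where \<phi>: "\<phi> \<in> iso (standard_group m) (Z2_power (2 * m))"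
    using standard_group_iso_Z2_power by (auto simp: is_iso_def)
  then have bij: "bij_betw \<phi> S (carrier (Z2_power (2 * m)))" by (simp add: iso_def)
  define \<mu> where "\<mu> = (\<lambda>t\<in>carrier (Z2_power (2 * m)). \<Prod>i<m. form_sign (factor_sign m i) (inv_into S \<phi> t i))"
  have "\<mu> \<in> carrier (Z2_power (2 * m)) \<rightarrow>\<^sub>E {1, -1}"
    using form_sign_cases[OF fr nontriv] by (auto simp: \<mu>_def)
  moreover have "\<mu> (\<phi> g) = (\<Prod>i<m. form_sign (factor_sign m i) (g i))" if "g \<in> S" for g
    using bij that by (simp add: \<mu>_def bij_betw_inv_into_left bij_betwE)
  ultimately have "sign_basis (Z2_power (2 * m)) model_matrices \<mu> (\<lambda>t. X (inv_into S \<phi> t))"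
    by (intro frame_sign_basis[OF nontriv fr sp comm_group_Z2_power \<phi>])
  then have "admissible_form (Z2_power (2 * m)) \<mu>" by (rule sign_basis_admissible(1)[rotated]) simp
  then show ?thesis by blast
qed

lemma grading_exists: "\<exists>\<Gamma>. abelian_division_grading_1 (Z2_power (2 * m)) model_matrices \<Gamma>"
  using admissible_form_exists admissible_form_realized[OF comm_group_Z2_power card_Z2_power]
  by (auto simp: full_gradings_def)

end

lemma grading_imp_power_two:
  assumes n: "even n" "0 < n" and gr: "abelian_division_grading_1 G (half_quat_matrices n) \<Gamma>"
  shows "\<exists>m\<ge>1. n = 2 ^ m"
proof -
  have k: "n div 2 > 0" using n by auto
  obtain X \<mu> S where "sign_basis (G\<lparr>carrier := S\<rparr>) (half_quat_matrices n) \<mu> X"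
    using grading_sign_basis(2)[OF k gr] by blast
  then obtain j where "n div 2 = 2 ^ j" using sign_basis_power_two[OF k] by blast
  then have "n = 2 ^ Suc j" using n(1) by auto
  then show ?thesis by (intro exI[of _ "Suc j"]) simp
qed

lemma half_power: "m \<ge> 1 \<Longrightarrow> n = 2 ^ m \<Longrightarrow> n div 2 = 2 ^ (m - 1)" for n :: nat
  by (cases m) simp_all

theorem theorem2p6:
  fixes n :: nat
  assumes "even n" and "0 < n"
  shows
    "((\<exists>(G :: (nat \<Rightarrow> int) monoid) \<Gamma>.
         abelian_division_grading_1 G (half_quat_matrices n) \<Gamma>)
        \<longleftrightarrow> (\<exists>m\<ge>1. n = 2 ^ m)) \<and>
     (\<forall>(G :: 'g monoid) \<Gamma>.
        abelian_division_grading_1 G (half_quat_matrices n) \<Gamma> \<longrightarrow>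
        (\<exists>m\<ge>1. n = 2 ^ m)) \<and>
     (\<forall>m\<ge>1. n = 2 ^ m \<longrightarrow>
        (\<forall>(G :: 'g monoid) \<Gamma>.
           abelian_division_grading_1 G (half_quat_matrices n) \<Gamma> \<longrightarrow>
           (let S = grading_support G (half_quat_matrices n) \<Gamma> in
              subgroup S G \<and> G\<lparr>carrier := S\<rparr> \<cong> Z2_power (2 * m)) \<and>
           (\<exists>!\<mu>. square_sign G (half_quat_matrices n) \<Gamma> \<mu>)) \<and>
        (\<forall>(G :: 'g monoid) \<Gamma> \<Delta> \<mu> \<nu>.
           abelian_division_grading_1 G (half_quat_matrices n) \<Gamma> \<and>
           abelian_division_grading_1 G (half_quat_matrices n) \<Delta> \<and>
           square_sign G (half_quat_matrices n) \<Gamma> \<mu> \<and>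
           square_sign G (half_quat_matrices n) \<Delta> \<nu> \<longrightarrow>
           (graded_isomorphic G (half_quat_matrices n) \<Gamma>
                                (half_quat_matrices n) \<Delta> \<longleftrightarrow>
            grading_support G (half_quat_matrices n) \<Gamma> =
              grading_support G (half_quat_matrices n) \<Delta> \<and> \<mu> = \<nu>)) \<and>
        (\<forall>T :: 'g monoid. group T \<and> T \<cong> Z2_power (2 * m) \<longrightarrow>
           (\<exists>\<Phi>.
              (\<forall>\<Gamma>\<in>full_gradings T (half_quat_matrices n).
                 square_sign T (half_quat_matrices n) \<Gamma>
                   (\<Phi> (full_grading_iso_rel T (half_quat_matrices n) `` {\<Gamma>}))) \<and>
              bij_betw \<Phi>
                (full_gradings T (half_quat_matrices n) //
                   full_grading_iso_rel T (half_quat_matrices n))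
                {\<mu> \<in> quadratic_forms T.
                   type_I T (polarization T \<mu>) \<and> arf_invariant (carrier T) \<mu> = -1})) \<and>
        (\<forall>(G :: 'g monoid) \<Gamma> (H :: 'h monoid) \<Delta>.
           abelian_division_grading_1 G (half_quat_matrices n) \<Gamma> \<and>
           abelian_division_grading_1 H (half_quat_matrices n) \<Delta> \<longrightarrow>
           graded_equivalent G (half_quat_matrices n) \<Gamma>
                             H (half_quat_matrices n) \<Delta>) \<and>
        algebra_iso (standard_algebra m) (half_quat_matrices n) \<noteq> {} \<and>
        abelian_division_grading_1 (standard_group m) (standard_algebra m) (standard_grading m) \<and>
        (\<forall>(G :: 'g monoid) \<Gamma>.
           abelian_division_grading_1 G (half_quat_matrices n) \<Gamma> \<longrightarrow>
           graded_equivalent G (half_quat_matrices n) \<Gamma>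
                             (standard_group m) (standard_algebra m) (standard_grading m)))"
proof (intro conjI allI impI, goal_cases)
  case 1
  show ?case
  proof
    assume "\<exists>(G :: (nat \<Rightarrow> int) monoid) \<Gamma>. abelian_division_grading_1 G (half_quat_matrices n) \<Gamma>"
    then show "\<exists>m\<ge>1. n = 2 ^ m" using grading_imp_power_two[OF assms] by blast
  next
    assume "\<exists>m\<ge>1. n = 2 ^ m"
    then obtain m where m: "m \<ge> 1" "n = 2 ^ m" by blast
    show "\<exists>(G :: (nat \<Rightarrow> int) monoid) \<Gamma>. abelian_division_grading_1 G (half_quat_matrices n) \<Gamma>"
      unfolding half_power[OF m] using grading_exists[OF m(1)] by blast
  qed
next
  case (2 G \<Gamma>)
  then show ?case by (rule grading_imp_power_two[OF assms])
next
  case (3 m G \<Gamma>)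
  from 3(3) show ?case
    unfolding half_power[OF 3(1,2)] Let_def by (intro conjI support_and_sign[OF 3(1)])
next
  case (4 m G \<Gamma>)
  from 4(3) show ?case
    unfolding half_power[OF 4(1,2)] by (rule support_and_sign(3)[OF 4(1)])
next
  case (5 m G \<Gamma> \<Delta> \<mu> \<nu>)
  note gr = 5(3)[unfolded half_power[OF 5(1,2)]]
  have \<Gamma>: "abelian_division_grading_1 G (quaternion_matrices (2 ^ (m - 1))) \<Gamma>"
    and \<Delta>: "abelian_division_grading_1 G (quaternion_matrices (2 ^ (m - 1))) \<Delta>"
    and \<mu>: "square_sign G (quaternion_matrices (2 ^ (m - 1))) \<Gamma> \<mu>"
    and \<nu>: "square_sign G (quaternion_matrices (2 ^ (m - 1))) \<Delta> \<nu>"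
    using gr by blast+
  show ?case
    unfolding half_power[OF 5(1,2)]
  proof
    assume iso: "graded_isomorphic G (quaternion_matrices (2 ^ (m - 1))) \<Gamma> (quaternion_matrices (2 ^ (m - 1))) \<Delta>"
    note same = isomorphic_imp_same_sign[OF 5(1) \<Gamma> \<Delta> iso \<mu>]
    then show "grading_support G (quaternion_matrices (2 ^ (m - 1))) \<Gamma>
        = grading_support G (quaternion_matrices (2 ^ (m - 1))) \<Delta> \<and> \<mu> = \<nu>"
      using support_and_sign(3)[OF 5(1) \<Delta>] \<nu> by blast
  next
    assume "grading_support G (quaternion_matrices (2 ^ (m - 1))) \<Gamma>
        = grading_support G (quaternion_matrices (2 ^ (m - 1))) \<Delta> \<and> \<mu> = \<nu>"
    then show "graded_isomorphic G (quaternion_matrices (2 ^ (m - 1))) \<Gamma> (quaternion_matrices (2 ^ (m - 1))) \<Delta>"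
      using same_sign_imp_isomorphic[OF 5(1) \<Gamma> \<Delta> _ \<mu>] \<nu> by blast
  qed
next
  case (6 m T)
  \<comment> \<open>\<open>T\<close> is assumed to be a group isomorphic to
    \<open>Z2_power (2 * m)\<close>; commutativity and cardinality are carried over from
    there.\<close>
  interpret Z: comm_group "Z2_power (2 * m)" by (rule comm_group_Z2_power)
  have T: "group T" "T \<cong> Z2_power (2 * m)" using 6(3) by blast+
  have "comm_group T"
    using Z.iso_imp_comm_group[OF group.iso_sym[OF T]] T(1) by (simp add: group.is_monoid)
  moreover have "card (carrier T) = 4 ^ m" using iso_same_card[OF T(2)] card_Z2_power by metis
  ultimately show ?case
    unfolding half_power[OF 6(1,2)] using sign_correspondence[OF 6(1)] by (simp only: admissible_form_def)
next
  case (7 m G \<Gamma> H \<Delta>)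
  then show ?case
    unfolding half_power[OF 7(1,2)] by (intro gradings_equivalent[OF 7(1)]) blast+
next
  case (8 m)
  then show ?case unfolding half_power[OF 8(1,2)] by (intro standard_algebra_facts(2))
next
  case (9 m)
  then show ?case by (intro standard_algebra_facts(3))
next
  case (10 m G \<Gamma>)
  from 10(3) show ?case
    unfolding half_power[OF 10(1,2)] graded_equivalent_def by (rule equivalent_standard(1)[OF 10(1)])
qed

end
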